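(* Let $n \ge 2$, let $G$ be a dicyclic group of order $4n$, and let $S$ be a sequence over $G$. (1) Suppose $n$ is even. Then the following are equivalent: (a) $|S| = \mathsf s(G)-1$ and $S$ has no product-one subsequence of length $\exp(G)=2n$; (b) there exist $\alpha,\tau\in G$ with $G = \langle \alpha,\tau \mid \alpha^{2n}=1_G,\ \tau^2=\alpha^n,\ \tau\alpha=\alpha^{-1}\tau\rangle$ such that either (i) $n \ge 4$ and $S = (\alpha^{r_1})^{[2n-1]} \boldsymbol{\cdot} (\alpha^{r_2})^{[2n-1]} \boldsymbol{\cdot} \alpha^{r_3}\tau$ with $r_1,r_2,r_3\in[0,2n-1]$ and $\gcd(r_1-r_2,2n)=1$; or (ii) $n=2$ and $S \in \{ (\alpha^{t_1})^{[3]} \boldsymbol{\cdot} (\alpha^{t_2})^{[3]} \boldsymbol{\cdot} \alpha^{t_3}\tau,\ (\alpha^{t_1})^{[3]} \boldsymbol{\cdot} (\alpha^{t_3}\tau)^{[3]} \boldsymbol{\cdot} \alpha^{t_2},\ (\alpha^{t_1})^{[3]} \boldsymbol{\cdot} (\alpha^{t_3}\tau)^{[3]} \boldsymbol{\cdot} \alpha^{t_4}\tau \}$, where $t_1,t_2,t_3,t_4\in[0,3]$, $t_1$ is even, $t_2$ is odd, and $t_3 \not\equiv t_4 \pmod 2$. (2) The following are equivalent: (a) $|S| = \mathsf E(G)-1$ and $S$ has no product-one subsequence of length $|G|$; (b) there exist $\alpha,\tau\in G$ with $G = \langle \alpha,\tau \mid \alpha^{2n}=1_G,\ \tau^2=\alpha^n,\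 \tau\alpha=\alpha^{-1}\tau\rangle$ such that either (i) $n\ge 3$ and $S = (\alpha^{r_1})^{[4n-1]} \boldsymbol{\cdot} (\alpha^{r_2})^{[2n-1]} \boldsymbol{\cdot} \alpha^{r_3}\tau$ with $r_1,r_2,r_3\in[0,2n-1]$ and $\gcd(r_1-r_2,2n)=1$; or (ii) $n=2$ and $S \in \{ ((\alpha^{t_1})^{[3]} \boldsymbol{\cdot} (\alpha^{t_2})^{[3]} \boldsymbol{\cdot} \alpha^{t_3}\tau) \boldsymbol{\cdot} S_0,\ ((\alpha^{t_1})^{[3]} \boldsymbol{\cdot} (\alpha^{t_3}\tau)^{[3]} \boldsymbol{\cdot} \alpha^{t_2}) \boldsymbol{\cdot} S_1,\ ((\alpha^{t_1})^{[3]} \boldsymbol{\cdot} (\alpha^{t_3}\tau)^{[3]} \boldsymbol{\cdot} \alpha^{t_4}\tau) \boldsymbol{\cdot} S_1 \}$, where $S_0 \in \{(\alpha^{t_1})^{[4]}, (\alpha^{t_2})^{[4]}\}$, $S_1 \in \{(\alpha^{t_1})^{[4]}, (\alpha^{t_3}\tau)^{[4]}\}$, $t_1,t_2,t_3,t_4\in[0,3]$, $t_1$ is even, $t_2$ is odd, and $t_3\not\equiv t_4 \pmod 2$.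
   Context: A sequence over a finite group $G$ is a finite unordered list of elements of $G$ with repetitions allowed; $|S|$ is its length, a subsequence is a sub-multiset, $S_1 \boldsymbol{\cdot} S_2$ denotes concatenation and $g^{[k]}$ denotes $g$ repeated $k$ times. A sequence is product-one if its terms can be ordered so that their product equals $1_G$. $\exp(G) = \operatorname{lcm}\{\operatorname{ord}(g)\mid g\in G\}$. $\mathsf s(G)$ (resp. $\mathsf E(G)$) is the smallest integer $\ell$ such that every sequence over $G$ of length at least $\ell$ has a product-one subsequence of length $\exp(G)$ (resp. $|G|$). $[a,b]=\{x\in\mathbb Z\mid a\le x\le b\}$. A dicyclic group of order $4n$ is a group with presentation $\langle \alpha,\tau \mid \alpha^{2n}=1,\ \tau^2=\alpha^n,\ \tau\alpha=\alpha^{-1}\tau\rangle$. *)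

theory Defs
  imports "HOL-Algebra.Algebra" "HOL-Library.Multiset"
begin

section \<open>Group presentations\<close>

text \<open>
  A word over formal generators of type \<open>'x\<close> is a list of signed letters: \<open>(x, True)\<close> stands for
  \<open>x\<close> and \<open>(x, False)\<close> for its formal inverse. A relation \<open>u = v\<close> is given as the pair \<open>(u, v)\<close>.
\<close>

type_synonym 'x gen_word = "('x \<times> bool) list"

primrec eval_word :: "('a, 'b) monoid_scheme \<Rightarrow> ('x \<Rightarrow> 'a) \<Rightarrow> 'x gen_word \<Rightarrow> 'a" where
  "eval_word G f [] = \<one>\<^bsub>G\<^esub>"
| "eval_word G f (l # w) = (if snd l then f (fst l) else inv\<^bsub>G\<^esub> (f (fst l))) \<otimes>\<^bsub>G\<^esub> eval_word G f w"

text \<open>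
  The classes of the following congruence are the elements of the quotient of the free group on
  \<open>'x\<close> by the normal closure of the elements \<open>u v\<^sup>-\<^sup>1\<close> with \<open>(u, v) \<in> R\<close>.
\<close>

inductive word_cong :: "('x gen_word \<times> 'x gen_word) set \<Rightarrow> 'x gen_word \<Rightarrow> 'x gen_word \<Rightarrow> bool"
  for R where
  refl: "word_cong R w w"
| sym: "word_cong R u v \<Longrightarrow> word_cong R v u"
| trans: "word_cong R u v \<Longrightarrow> word_cong R v w \<Longrightarrow> word_cong R u w"
| cancel: "word_cong R (u @ [(x, b), (x, \<not> b)] @ v) (u @ v)"
| relation: "(l, r) \<in> R \<Longrightarrow> word_cong R (u @ l @ v) (u @ r @ v)"

text \<open>
  \<open>G\<close> is presented by the generators \<open>f x\<close> and the relations \<open>R\<close>: the generators generate \<open>G\<close>, and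
  two words have the same value in \<open>G\<close> exactly when their equality follows from \<open>R\<close>.
\<close>

definition has_presentation ::
  "('a, 'b) monoid_scheme \<Rightarrow> ('x \<Rightarrow> 'a) \<Rightarrow> ('x gen_word \<times> 'x gen_word) set \<Rightarrow> bool" where
  "has_presentation G f R \<longleftrightarrow>
     group G \<and> range f \<subseteq> carrier G \<and> generate G (range f) = carrier G \<and>
     (\<forall>u v. eval_word G f u = eval_word G f v \<longleftrightarrow> word_cong R u v)"


section \<open>Dicyclic groups\<close>

datatype dicyclic_gen = Alpha | Tau

definition dicyclic_relations :: "nat \<Rightarrow> (dicyclic_gen gen_word \<times> dicyclic_gen gen_word) set" where
  "dicyclic_relations n =
     {(replicate (2 * n) (Alpha, True), []),
      ([(Tau, True), (Tau, True)], replicate n (Alpha, True)),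
      ([(Tau, True), (Alpha, True)], [(Alpha, False), (Tau, True)])}"

definition dicyclic_presentation :: "nat \<Rightarrow> ('a, 'b) monoid_scheme \<Rightarrow> 'a \<Rightarrow> 'a \<Rightarrow> bool" where
  "dicyclic_presentation n G \<alpha> \<tau> \<longleftrightarrow>
     has_presentation G (case_dicyclic_gen \<alpha> \<tau>) (dicyclic_relations n)"

definition dicyclic_group :: "nat \<Rightarrow> ('a, 'b) monoid_scheme \<Rightarrow> bool" where
  "dicyclic_group n G \<longleftrightarrow> (\<exists>\<alpha> \<tau>. dicyclic_presentation n G \<alpha> \<tau>)"


section \<open>Sequences over a group\<close>

text \<open>
  A sequence over \<open>G\<close> is a multiset \<open>S\<close> with \<open>set_mset S \<subseteq> carrier G\<close>; concatenation is multiset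
  sum and the subsequences of \<open>S\<close> are the multisets \<open>T \<subseteq># S\<close>.
\<close>

definition product_one :: "('a, 'b) monoid_scheme \<Rightarrow> 'a multiset \<Rightarrow> bool" where
  "product_one G S \<longleftrightarrow> (\<exists>xs. mset xs = S \<and> foldr (\<otimes>\<^bsub>G\<^esub>) xs \<one>\<^bsub>G\<^esub> = \<one>\<^bsub>G\<^esub>)"

definition has_product_one_subseq :: "('a, 'b) monoid_scheme \<Rightarrow> nat \<Rightarrow> 'a multiset \<Rightarrow> bool" where
  "has_product_one_subseq G k S \<longleftrightarrow> (\<exists>T. T \<subseteq># S \<and> size T = k \<and> product_one G T)"

definition group_exp :: "('a, 'b) monoid_scheme \<Rightarrow> nat" where
  "group_exp G = Lcm (group.ord G ` carrier G)"

definition s_const :: "('a, 'b) monoid_scheme \<Rightarrow> nat" where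
  "s_const G = (LEAST l. \<forall>S. set_mset S \<subseteq> carrier G \<longrightarrow> l \<le> size S \<longrightarrow>
     has_product_one_subseq G (group_exp G) S)"

definition E_const :: "('a, 'b) monoid_scheme \<Rightarrow> nat" where
  "E_const G = (LEAST l. \<forall>S. set_mset S \<subseteq> carrier G \<longrightarrow> l \<le> size S \<longrightarrow>
     has_product_one_subseq G (order G) S)"

end

theory Submission
  imports Defs "HOL-Number_Theory.Cong"
begin

text \<open>
  Write a sequence over the group as the exponents \<open>a\<close> of its terms \<open>\<alpha>\<^sup>a\<close> and the exponents \<open>b\<close> of
  its terms \<open>\<alpha>\<^sup>b \<tau>\<close>. As soon as a selection contains some \<open>\<alpha>\<^sup>b \<tau>\<close>, ordering it suitably gives the
  exponents \<open>a\<close> arbitrary signs and the exponents \<open>b\<close> any balanced signs, so a product-one subsequence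
  of length \<open>L\<close> is a signed zero sum modulo \<open>2 n\<close>. Let the sequence have length \<open>L + 2 n - 1\<close>. With at
  least two and at most \<open>n\<close> terms \<open>\<alpha>\<^sup>b \<tau>\<close>, the sums obtained by flipping signs either cover a whole
  parity class or most \<open>a\<close> lie in one residue class, where the Erdos-Ginzburg-Ziv theorem applies. With
  more than \<open>n\<close> such terms, pair the terms congruent modulo \<open>n\<close>: a union of \<open>L / 2\<close> pairs has product
  \<open>1\<close> or \<open>\<alpha>\<^sup>n\<close>, and exchanging pairs repairs the second case. Hence, for \<open>n \<ge> 3\<close>, an extremal
  sequence has exactly one term \<open>\<alpha>\<^sup>b \<tau>\<close>, and the other terms form an extremal sequence for the cyclic
  group of order \<open>2 n\<close>, described by the inverse of the Erdos-Ginzburg-Ziv theorem. For \<open>n = 2\<close> the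
  same holds once \<open>\<alpha>\<close> is chosen among the elements of order \<open>4\<close> so that \<open>\<alpha>\<close> and \<open>\<alpha>\<^sup>3\<close> occur most often.
\<close>

section \<open>Subset sums modulo an integer\<close>

text \<open>Modulo the powers of \<open>\<alpha>\<close> the group has order 2, so a product-one
  subsequence contains an even number of terms \<open>\<alpha>^b \<tau>\<close>. A single such term
  is therefore wasted, and it accounts for the difference between the bound \<open>L + 2 n\<close>
  and the Erdos-Ginzburg-Ziv bound \<open>L + 2 n - 1\<close> of the cyclic group. What has to be
  shown is that, for a suitable presentation, two such terms in a sequence of length
  \<open>L + 2 n - 1\<close> always yield a subsequence of length \<open>L\<close>. The obstacle is
  a factor 2: changing a sign moves a sum by an even amount, so subset sums modulo \<open>n\<close>
  leave a parity or a summand \<open>n\<close> to be settled by exchanging terms. Pairs of equal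
  weight cancel because \<open>L / 2\<close> is even; this is the origin of \<open>4 dvd L\<close>.
  It holds for \<open>L = 2 n\<close> if \<open>n\<close> is even; for odd \<open>n\<close> the
  exponent is \<open>4 n\<close>, the order of the group, and the two constants coincide. Matching
  differences among leftover terms requires \<open>n - 1 > n / 2\<close>, that is
  \<open>n \<ge> 3\<close>, which is why \<open>n = 2\<close> stands apart.\<close>

definition all_residues :: "nat \<Rightarrow> ('b \<Rightarrow> int) \<Rightarrow> 'b multiset \<Rightarrow> bool" where
  "all_residues N f F \<longleftrightarrow> (\<forall>r. \<exists>Z. Z \<subseteq># F \<and> int N dvd (\<Sum>x\<in>#Z. f x) - r)"

text \<open>Filling the cyclic group of order \<open>q\<close> one residue at a time takes
  \<open>q - 1\<close> nonzero weights. Asking this for every divisor prevents the weights from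
  crowding into a proper subgroup.\<close>

definition spread :: "nat \<Rightarrow> ('b \<Rightarrow> int) \<Rightarrow> 'b multiset \<Rightarrow> bool" where
  "spread N f D \<longleftrightarrow> (\<forall>q. q dvd N \<and> 2 \<le> q \<longrightarrow> q \<le> size (filter_mset (\<lambda>x. \<not> int q dvd f x) D) + 1)"

definition resid :: "nat \<Rightarrow> ('b \<Rightarrow> int) \<Rightarrow> 'b multiset \<Rightarrow> int set" where
  "resid N f F = (\<lambda>Z. (\<Sum>x\<in>#Z. f x) mod int N) ` {Z. Z \<subseteq># F}"

lemma resid_subset: "N > 0 \<Longrightarrow> resid N f F \<subseteq> {0..<int N}"
  by (auto simp: resid_def)

lemma finite_resid: "N > 0 \<Longrightarrow> finite (resid N f F)"
  by (rule finite_subset[OF resid_subset]) simp_all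

lemma resid_mono: "F \<subseteq># F' \<Longrightarrow> resid N f F \<subseteq> resid N f F'"
  unfolding resid_def by (rule image_mono) (blast intro: subset_mset.order_trans)

lemma all_residues_iff:
  assumes "N > 0"
  shows "all_residues N f F \<longleftrightarrow> resid N f F = {0..<int N}"
proof
  assume all_residues: "all_residues N f F"
  show "resid N f F = {0..<int N}"
  proof (intro equalityI resid_subset assms subsetI)
    fix r assume r: "r \<in> {0..<int N}"
    obtain Z where Z: "Z \<subseteq># F" "int N dvd (\<Sum>x\<in>#Z. f x) - r"
      using all_residues unfolding all_residues_def by blast
    have "(\<Sum>x\<in>#Z. f x) mod int N = r mod int N"
      using Z(2) by (simp add: mod_eq_dvd_iff)
    with r have "(\<Sum>x\<in>#Z. f x) mod int N = r" by simp
    with Z(1) show "r \<in> resid N f F" unfolding resid_def by blast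
  qed
next
  assume eq: "resid N f F = {0..<int N}"
  show "all_residues N f F" unfolding all_residues_def
  proof
    fix r
    have "r mod int N \<in> resid N f F" using eq assms by simp
    then obtain Z where "Z \<subseteq># F" "(\<Sum>x\<in>#Z. f x) mod int N = r mod int N"
      unfolding resid_def by force
    then show "\<exists>Z. Z \<subseteq># F \<and> int N dvd (\<Sum>x\<in>#Z. f x) - r"
      by (auto simp: mod_eq_dvd_iff)
  qed
qed

lemma resid_add_mset_shift:
  "r \<in> resid N f F \<Longrightarrow> (r + f d) mod int N \<in> resid N f (add_mset d F)"
proof -
  assume "r \<in> resid N f F"
  then obtain Z where Z: "Z \<subseteq># F" "r = (\<Sum>x\<in>#Z. f x) mod int N" unfolding resid_def by blast
  have "(r + f d) mod int N = (\<Sum>x\<in>#add_mset d Z. f x) mod int N"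
    by (simp add: Z(2) mod_simps add.commute)
  moreover have "add_mset d Z \<subseteq># add_mset d F" using Z(1) by simp
  ultimately show ?thesis unfolding resid_def by blast
qed

text \<open>Membership in \<open>H\<close> depends on \<open>h\<close> modulo \<open>N\<close> only,
  so \<open>(N - 1) * h\<close> serves as \<open>- h\<close>, and closure under addition makes
  \<open>H\<close> an ideal of the integers; \<open>q\<close> is its least positive element.\<close>

lemma stabiliser_multiple:
  fixes R :: "int set" and N :: nat
  assumes N: "N > 0" and R: "R \<subseteq> {0..<int N}"
  defines "H \<equiv> {h. \<forall>r\<in>R. (r + h) mod int N \<in> R}"
  obtains q :: nat where "q dvd N" "q > 0" "\<And>h. h \<in> H \<longleftrightarrow> int q dvd h"
proof -
  have zero: "0 \<in> H" using R by (auto simp: H_def)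
  have add: "h + h' \<in> H" if "h \<in> H" "h' \<in> H" for h h'
  proof -
    have "(r + (h + h')) mod int N \<in> R" if "r \<in> R" for r
    proof -
      have "((r + h) mod int N + h') mod int N \<in> R"
        using \<open>h \<in> H\<close> \<open>h' \<in> H\<close> that unfolding H_def by blast
      then show ?thesis by (simp add: mod_simps add.assoc)
    qed
    then show ?thesis unfolding H_def by blast
  qed
  have mult_nat: "int k * h \<in> H" if "h \<in> H" for h k
    by (induction k) (auto simp: zero distrib_right intro: add that)
  have cong: "h' \<in> H" if "h \<in> H" "h mod int N = h' mod int N" for h h'
  proof -
    have "(r + h) mod int N = (r + h') mod int N" for r
      using that(2) by (metis mod_add_right_eq)
    then show ?thesis using that(1) unfolding H_def by simp
  qed
  have neg: "- h \<in> H" if "h \<in> H" for h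
  proof (rule cong[OF mult_nat[OF that, of "N - 1"]])
    have "int (N - 1) * h = - h + int N * h" using N by (simp add: of_nat_diff algebra_simps)
    then show "int (N - 1) * h mod int N = - h mod int N" by (simp add: mod_eq_dvd_iff)
  qed
  have mult: "k * h \<in> H" if "h \<in> H" for h k
  proof (cases "k \<ge> 0")
    case True then show ?thesis using mult_nat[OF that, of "nat k"] by simp
  next
    case False then show ?thesis using neg[OF mult_nat[OF that, of "nat (- k)"]] by simp
  qed
  have N_in: "int N \<in> H" by (rule cong[OF zero]) simp
  define q where "q = (LEAST q. q > 0 \<and> int q \<in> H)"
  have q: "q > 0 \<and> int q \<in> H" unfolding q_def by (rule LeastI[of _ N]) (use N N_in in simp)
  have least: "q \<le> q'" if "q' > 0" "int q' \<in> H" for q'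
    unfolding q_def by (rule Least_le) (use that in simp)
  have dvd: "int q dvd h" if "h \<in> H" for h
  proof -
    have "h + (- (h div int q)) * int q \<in> H" using add mult that q by blast
    moreover have "h + (- (h div int q)) * int q = h mod int q"
      by (simp add: minus_mult_div_eq_mod [symmetric] mult.commute)
    ultimately have in_H: "h mod int q \<in> H" by simp
    have "h mod int q = 0"
    proof (rule ccontr)
      assume "h mod int q \<noteq> 0"
      then have pos: "h mod int q > 0" using q by (metis of_nat_0_less_iff order_le_less pos_mod_sign)
      have "q \<le> nat (h mod int q)" using least[of "nat (h mod int q)"] pos in_H by simp
      moreover have "h mod int q < int q" using q by simp
      ultimately show False using pos by linarith
    qed
    then show ?thesis by presburger
  qed
  show ?thesis
  proof (rule that)
    show "q dvd N" using dvd[OF N_in] by simp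
    show "q > 0" using q by simp
    show "h \<in> H \<longleftrightarrow> int q dvd h" for h
      using dvd q mult by (metis dvd_def mult.commute)
  qed
qed

lemma filter_mset_emptyI: "(\<And>x. x \<in># M \<Longrightarrow> \<not> P x) \<Longrightarrow> filter_mset P M = {#}"
  by (induction M) auto

lemma filter_mset_allI: "(\<And>x. x \<in># M \<Longrightarrow> P x) \<Longrightarrow> filter_mset P M = M"
  by (induction M) auto

lemma dvd_sum_mset: "(\<And>x. x \<in># M \<Longrightarrow> (d::int) dvd f x) \<Longrightarrow> d dvd (\<Sum>x\<in>#M. f x)"
  by (induction M) auto

text \<open>A submultiset \<open>F\<close> of \<open>D\<close> that is maximal with \<open>size F + k \<le> card (resid N f F)\<close> has a residue
  set stable under the remaining weights. Its stabiliser consists of the multiples of a divisor \<open>q\<close>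
  of \<open>N\<close>, and for \<open>q < N\<close> the claim modulo \<open>q\<close> shows that every coset is met.\<close>

theorem resid_growth_all_residues:
  assumes "N > 0" and "F0 \<subseteq># D" and "size F0 + k \<le> card (resid N f F0)" and "k > 0"
    and "\<And>q. q dvd N \<Longrightarrow> 2 \<le> q \<Longrightarrow> q < N \<Longrightarrow> q \<le> size (filter_mset (\<lambda>x. \<not> int q dvd f x) D) + 1"
    and "N \<le> size (filter_mset (\<lambda>x. \<not> int N dvd f x) D) + k"
  shows "\<exists>F. F \<subseteq># D \<and> all_residues N f F \<and> size F + k \<le> N"
  using assms
proof (induction N arbitrary: F0 k rule: less_induct)
  case (less N)
  define P where "P F \<longleftrightarrow> F \<subseteq># D \<and> size F + k \<le> card (resid N f F)" for F
  have "P F0" unfolding P_def using less.prems by simp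
  then obtain F where "P F" and max: "\<And>F'. P F' \<Longrightarrow> size F' \<le> size F"
    using ex_has_greatest_nat[of P F0 size "Suc (size D)"] size_mset_mono[of _ D]
    unfolding P_def by (auto simp: less_Suc_eq_le)
  define R where "R = resid N f F"
  have F: "F \<subseteq># D" "size F + k \<le> card R" using \<open>P F\<close> unfolding P_def R_def by auto
  have R: "R \<subseteq> {0..<int N}" "finite R"
    unfolding R_def using resid_subset finite_resid less.prems by metis+
  have cardR: "card R \<le> N" using card_mono[OF _ R(1)] by simp
  obtain q where q: "q dvd N" "q > 0"
    and stab: "\<And>h. (\<forall>r\<in>R. (r + h) mod int N \<in> R) \<longleftrightarrow> int q dvd h"
    by (rule stabiliser_multiple[OF less.prems(1) R(1)]) simp
  have rest: "int q dvd f d" if d: "d \<in># D - F" for d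
  proof -
    have sub: "add_mset d F \<subseteq># D"
    proof -
      have "{#d#} + F \<subseteq># (D - F) + F" using d by (intro subset_mset.add_right_mono) simp
      then show ?thesis using F(1) by simp
    qed
    have R': "R \<subseteq> resid N f (add_mset d F)" unfolding R_def by (rule resid_mono) simp
    have fin: "finite (resid N f (add_mset d F))" by (rule finite_resid) (rule less.prems)
    \<comment> \<open>By maximality the extra term \<open>d\<close> yields no new residue, so adding
      \<open>f d\<close> maps \<open>R\<close> into itself and \<open>f d\<close> lies in the
      stabiliser.\<close>
    have "\<not> P (add_mset d F)" using max[of "add_mset d F"] by auto
    then have "card (resid N f (add_mset d F)) \<le> size F + k"
      unfolding P_def using sub by auto
    then have "resid N f (add_mset d F) = R"
      using card_subset_eq[OF fin R'] card_mono[OF fin R'] F(2) by fastforce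
    then show ?thesis using resid_add_mset_shift[of _ N f F d] stab unfolding R_def by blast
  qed
  have "R = {0..<int N}"
  proof (cases "q = N")
    case True
    \<comment> \<open>All weights that are not multiples of \<open>N\<close> sit in
      \<open>F\<close>, which is therefore long enough to give \<open>N\<close> residues.\<close>
    have "filter_mset (\<lambda>x. \<not> int q dvd f x) (D - F) = {#}"
      using rest by (intro filter_mset_emptyI) simp
    then have "filter_mset (\<lambda>x. \<not> int q dvd f x) D = filter_mset (\<lambda>x. \<not> int q dvd f x) F"
      using F(1) by (metis filter_union_mset add.right_neutral subset_mset.add_diff_inverse)
    then have "size (filter_mset (\<lambda>x. \<not> int q dvd f x) D) \<le> size F"
      by (simp add: size_filter_mset_lesseq)
    then have "N \<le> card R" using less.prems(6) F(2) True by simp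
    then show ?thesis using cardR R by (intro card_subset_eq) auto
  next
    case False
    then have "q < N" using q less.prems(1) dvd_imp_le by fastforce
    have "\<exists>F'. F' \<subseteq># D \<and> all_residues q f F' \<and> size F' + 1 \<le> q"
    proof (rule less.IH[of q "{#}" 1])
      show "q' \<le> size (filter_mset (\<lambda>x. \<not> int q' dvd f x) D) + 1"
        if "q' dvd q" "2 \<le> q'" "q' < q" for q'
        using less.prems(5)[of q'] that q \<open>q < N\<close> dvd_trans by auto
      show "q \<le> size (filter_mset (\<lambda>x. \<not> int q dvd f x) D) + 1"
        using less.prems(5)[of q] q \<open>q < N\<close> by (cases "q \<ge> 2") auto
    qed (use q \<open>q < N\<close> in \<open>auto simp: resid_def\<close>)
    then obtain F' where F': "F' \<subseteq># D" "all_residues q f F'" by blast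
    show ?thesis
    proof (intro equalityI R subsetI)
      fix r assume r: "r \<in> {0..<int N}"
      obtain Z where Z: "Z \<subseteq># F'" "int q dvd (\<Sum>x\<in>#Z. f x) - r"
        using F'(2) unfolding all_residues_def by blast
      \<comment> \<open>Dropping the terms outside \<open>F\<close> keeps the sum modulo
        \<open>q\<close>, since their weights are multiples of \<open>q\<close>; the stabiliser then
        moves the sum of \<open>Y\<close> to \<open>r\<close>.\<close>
      define Y where "Y = Z \<inter># F"
      have ZY: "Z = (Z - F) + Y" unfolding Y_def
        by (intro multiset_eqI) simp
      have "Z \<subseteq># D" using Z(1) F'(1) by (rule subset_mset.order_trans)
      then have "Z - F \<subseteq># D - F"
        by (auto simp: subseteq_mset_def intro: diff_le_mono)
      then have "int q dvd (\<Sum>x\<in>#Z - F. f x)"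
        using rest by (intro dvd_sum_mset) (meson mset_subset_eqD)
      moreover have "(\<Sum>x\<in>#Z. f x) = (\<Sum>x\<in>#Z - F. f x) + (\<Sum>x\<in>#Y. f x)"
        by (subst ZY) simp
      ultimately have "int q dvd (\<Sum>x\<in>#Y. f x) - r"
        using Z(2) dvd_diff[of "int q" "(\<Sum>x\<in>#Z. f x) - r" "\<Sum>x\<in>#Z - F. f x"] by simp
      have d: "int q dvd r - (\<Sum>x\<in>#Y. f x) mod int N"
      proof -
        have "int q dvd (\<Sum>x\<in>#Y. f x) - (\<Sum>x\<in>#Y. f x) mod int N"
          using q(1) by (meson dvd_minus_mod dvd_trans int_dvd_int_iff)
        then show ?thesis
          using \<open>int q dvd (\<Sum>x\<in>#Y. f x) - r\<close> dvd_diff[of "int q" "(\<Sum>x\<in>#Y. f x) - (\<Sum>x\<in>#Y. f x) mod int N" "(\<Sum>x\<in>#Y. f x) - r"] by simp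
      qed
      have "Y \<subseteq># F" unfolding Y_def by simp
      then have "(\<Sum>x\<in>#Y. f x) mod int N \<in> R" unfolding R_def resid_def by blast
      then have "((\<Sum>x\<in>#Y. f x) mod int N + (r - (\<Sum>x\<in>#Y. f x) mod int N)) mod int N \<in> R"
        using stab d by blast
      then show "r \<in> R" using r by simp
    qed
  qed
  moreover from this have "all_residues N f F"
    unfolding R_def by (simp add: all_residues_iff[OF less.prems(1)])
  ultimately show ?case using F by auto
qed

text \<open>The empty selection has the single sum \<open>0\<close>, which starts the growth with
  \<open>k = 1\<close>.\<close>

corollary spread_imp_all_residues:
  assumes "N > 0" "spread N f D"
  shows "\<exists>F. F \<subseteq># D \<and> all_residues N f F \<and> size F + 1 \<le> N"
proof (rule resid_growth_all_residues[where ?F0.0 = "{#}"])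
  show "N \<le> size (filter_mset (\<lambda>x. \<not> int N dvd f x) D) + 1"
    using assms unfolding spread_def by (cases "N \<ge> 2") auto
qed (use assms in \<open>auto simp: spread_def resid_def\<close>)

section \<open>The Erdos-Ginzburg-Ziv theorem\<close>

definition zero_sum_sub :: "nat \<Rightarrow> nat \<Rightarrow> ('b \<Rightarrow> int) \<Rightarrow> 'b multiset \<Rightarrow> bool" where
  "zero_sum_sub m L f M \<longleftrightarrow> (\<exists>U. U \<subseteq># M \<and> size U = L \<and> int m dvd (\<Sum>x\<in>#U. f x))"

lemma zero_sum_sub_mono: "zero_sum_sub m L f M \<Longrightarrow> M \<subseteq># M' \<Longrightarrow> zero_sum_sub m L f M'"
  unfolding zero_sum_sub_def using subset_mset.order_trans[of _ M M'] by blast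

lemma sub_mset_image_mset:
  assumes "U \<subseteq># image_mset f M"
  obtains V where "V \<subseteq># M" "image_mset f V = U"
proof -
  obtain W where "image_mset f M = U + W" using assms by (metis subset_mset.add_diff_inverse)
  then obtain V W' where "M = V + W'" "U = image_mset f V"
    using image_mset_eq_plusD[of f M U W] by blast
  then show ?thesis using that[of V] by simp
qed

lemma zero_sum_sub_image:
  assumes "zero_sum_sub m L g (image_mset f M)"
  shows "zero_sum_sub m L (\<lambda>x. g (f x)) M"
proof -
  obtain U where U: "U \<subseteq># image_mset f M" "size U = L" "int m dvd (\<Sum>x\<in>#U. g x)"
    using assms unfolding zero_sum_sub_def by blast
  obtain V where "V \<subseteq># M" "image_mset f V = U" using sub_mset_image_mset[OF U(1)] .
  then show ?thesis using U(2,3) unfolding zero_sum_sub_def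
    by (intro exI[of _ V]) (auto simp: multiset.map_comp comp_def)
qed

lemma ex_sub_mset_size:
  assumes "k \<le> size M"
  obtains U where "U \<subseteq># M" "size U = k"
proof -
  obtain xs where xs: "mset xs = M" using ex_mset by blast
  have "M = mset (take k xs) + mset (drop k xs)" using xs by (metis append_take_drop_id mset_append)
  moreover have "size (mset (take k xs)) = k" using xs assms by auto
  ultimately show ?thesis using that[of "mset (take k xs)"] by simp
qed

lemma ex_sub_mset_between:
  assumes "F \<subseteq># M" "size F \<le> k" "k \<le> size M"
  obtains U where "F \<subseteq># U" "U \<subseteq># M" "size U = k"
proof -
  have "k - size F \<le> size (M - F)" using assms by (simp add: size_Diff_submset)
  then obtain V where V: "V \<subseteq># M - F" "size V = k - size F" using ex_sub_mset_size by blast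
  have "F + V \<subseteq># F + (M - F)" using V(1) by simp
  then have "F + V \<subseteq># M" using assms(1) by simp
  then show ?thesis using that[of "F + V"] V(2) assms(2) by simp
qed

text \<open>Sort by \<open>g\<close> and match the \<open>i\<close>-th term with the one
  \<open>size M - r\<close> places further on. Equal values at both ends would fill the whole
  stretch between them, which has more than \<open>size M - r\<close> terms.\<close>

lemma distinct_pairs:
  fixes g :: "'b \<Rightarrow> int"
  assumes "2 * r \<le> size M" and "\<And>c. size (filter_mset (\<lambda>x. g x = c) M) + r \<le> size M"
  obtains P E where "M = image_mset fst P + image_mset snd P + E" "size P = r"
    "\<And>u v. (u, v) \<in># P \<Longrightarrow> g u \<noteq> g v"
proof -
  obtain ys where ys: "mset ys = M" using ex_mset by blast
  define xs where "xs = sort_key g ys"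
  have xs: "mset xs = M" unfolding xs_def using ys by simp
  have sorted: "sorted (map g xs)" unfolding xs_def by simp
  define l where "l = length xs"
  have l: "size M = l" using xs unfolding l_def by auto
  define P where "P = zip (take r xs) (drop (l - r) xs)"
  have len: "length (take r xs) = r" "length (drop (l - r) xs) = r"
    using assms(1) l unfolding l_def by auto
  have fst: "map fst P = take r xs" and snd: "map snd P = drop (l - r) xs"
    unfolding P_def using len by simp_all
  have "xs = take r xs @ drop r (take (l - r) xs) @ drop (l - r) xs"
  proof -
    have "r \<le> l - r" using assms(1) l by simp
    then have "take r xs = take r (take (l - r) xs)" by (simp add: min_absorb1)
    then show ?thesis by (metis append.assoc append_take_drop_id)
  qed
  then have "M = mset (take r xs) + mset (drop (l - r) xs) + mset (drop r (take (l - r) xs))"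
    using xs by (metis add.assoc add.commute mset_append)
  then have "M = image_mset fst (mset P) + image_mset snd (mset P) + mset (drop r (take (l - r) xs))"
    using fst snd by (metis mset_map)
  moreover have "size (mset P) = r" unfolding P_def using len by simp
  moreover have "g u \<noteq> g v" if "(u, v) \<in># mset P" for u v
  proof
    assume eq: "g u = g v"
    obtain i where i: "i < r" "u = xs ! i" "v = xs ! (l - r + i)"
    proof -
      obtain i where i: "i < length P" "P ! i = (u, v)" using \<open>(u, v) \<in># mset P\<close>
        by (auto simp: in_set_conv_nth)
      then have "i < r" unfolding P_def using len by simp
      moreover have "u = xs ! i" "v = xs ! (l - r + i)"
        using i(2) \<open>i < r\<close> len assms(1) l unfolding P_def by (auto simp: l_def)
      ultimately show ?thesis using that by blast
    qed
    have "g (xs ! j) = g u" if "j \<in> {i..l - r + i}" for j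
    proof (rule antisym)
      have j: "j < length xs" "l - r + i < length xs"
        using that i(1) assms(1) l unfolding l_def by auto
      show "g (xs ! j) \<le> g u"
        using sorted_nth_mono[OF sorted, of j "l - r + i"] that j eq i by simp
      show "g u \<le> g (xs ! j)"
        using sorted_nth_mono[OF sorted, of i j] that j i by simp
    qed
    then have "{i..l - r + i} \<subseteq> {j. j < length xs \<and> g (xs ! j) = g u}"
      using i(1) assms(1) l unfolding l_def by auto
    then have "card {i..l - r + i} \<le> card {j. j < length xs \<and> g (xs ! j) = g u}"
      by (intro card_mono) auto
    also have "\<dots> = size (filter_mset (\<lambda>x. g x = g u) M)"
      unfolding xs[symmetric] mset_filter[symmetric] size_mset by (rule length_filter_conv_card[symmetric])
    finally show False using assms(2)[of "g u"] l by simp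
  qed
  ultimately show ?thesis using that by blast
qed

text \<open>Choosing one member of each pair turns selections of a fixed length into subset sums of
  differences: \<open>Z\<close> holds the pairs whose second member is taken.\<close>

lemma sum_pairs_choice:
  fixes f :: "'b \<Rightarrow> int"
  assumes "Z \<subseteq># P"
  shows "(\<Sum>x\<in>#image_mset fst (P - Z) + image_mset snd Z. f x)
    = (\<Sum>x\<in>#image_mset fst P. f x) + (\<Sum>(u, v)\<in>#Z. f v - f u)"
proof -
  have P: "P = (P - Z) + Z" using assms by simp
  have "(\<Sum>x\<in>#image_mset snd Z. f x) = (\<Sum>x\<in>#image_mset fst Z. f x) + (\<Sum>(u, v)\<in>#Z. f v - f u)"
    by (induction Z) auto
  moreover have "image_mset fst P = image_mset fst (P - Z) + image_mset fst Z"
    by (metis P image_mset_union)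
  ultimately show ?thesis by simp
qed

lemma pairs_choice_subset:
  assumes "Z \<subseteq># P"
  shows "image_mset fst (P - Z) + image_mset snd Z \<subseteq># image_mset fst P + image_mset snd P"
  using assms by (intro subset_mset.add_mono image_mset_subseteq_mono) auto

lemma sum_mset_cong_const:
  assumes "\<And>x. x \<in># U \<Longrightarrow> [f x = c] (mod m)"
  shows "[(\<Sum>x\<in>#U. f x) = int (size U) * c] (mod m)"
  using assms
proof (induction U)
  case (add x U)
  then have "[f x + (\<Sum>x\<in>#U. f x) = c + int (size U) * c] (mod m)"
    by (intro cong_add) auto
  then show ?case by (simp add: algebra_simps)
qed simp

lemma const_imp_zero_sum_sub:
  assumes "\<And>x. x \<in># M \<Longrightarrow> [f x = c] (mod int m)" "m dvd L" "L \<le> size M"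
  shows "zero_sum_sub m L f M"
proof -
  obtain U where U: "U \<subseteq># M" "size U = L" using ex_sub_mset_size[OF assms(3)] .
  have "[(\<Sum>x\<in>#U. f x) = int L * c] (mod int m)"
    using sum_mset_cong_const[of U f c "int m"] assms(1) U mset_subset_eqD by metis
  then have "int m dvd (\<Sum>x\<in>#U. f x)"
    using assms(2) by (metis cong_dvd_iff dvd_mult2 int_dvd_int_iff)
  then show ?thesis using U unfolding zero_sum_sub_def by blast
qed

text \<open>Either \<open>p\<close> terms agree modulo \<open>p\<close>, or \<open>p - 1\<close>
  pairs with distinct partners and one further term \<open>e\<close> can be split off. The
  \<open>p - 1\<close> nonzero differences reach every residue, in particular the one that makes the
  total vanish.\<close>

lemma prime_block:
  assumes p: "Factorial_Ring.prime (p::nat)" and M: "2 * p \<le> size M + 1"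
  shows "zero_sum_sub p p f M"
proof (cases "\<exists>c. size (filter_mset (\<lambda>x. f x mod int p = c) M) \<ge> p")
  case True
  then obtain c where c: "size (filter_mset (\<lambda>x. f x mod int p = c) M) \<ge> p" by blast
  have "zero_sum_sub p p f (filter_mset (\<lambda>x. f x mod int p = c) M)"
    by (rule const_imp_zero_sum_sub[where c = c]) (use c in \<open>auto simp: cong_def\<close>)
  then show ?thesis by (rule zero_sum_sub_mono) simp
next
  case False
  have p2: "p \<ge> 2" using p by (rule prime_ge_2_nat)
  obtain P E where M_eq: "M = image_mset fst P + image_mset snd P + E" and P: "size P = p - 1"
    and distinct: "\<And>u v. (u, v) \<in># P \<Longrightarrow> f u mod int p \<noteq> f v mod int p"
  proof (rule distinct_pairs[of "p - 1" M "\<lambda>x. f x mod int p"])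
    show "size (filter_mset (\<lambda>x. f x mod int p = c) M) + (p - 1) \<le> size M" for c
    proof -
      have "size (filter_mset (\<lambda>x. f x mod int p = c) M) < p" using False not_le by blast
      then show ?thesis using M by linarith
    qed
  qed (use M p2 in auto)
  have "size M = 2 * (p - 1) + size E" using M_eq P by simp
  then have "E \<noteq> {#}" using M p2 by auto
  then obtain e where e: "e \<in># E" by blast
  have "spread p (\<lambda>(u, v). f v - f u) P"
    unfolding spread_def
  proof (intro allI impI)
    fix q assume q: "q dvd p \<and> 2 \<le> q"
    then have "q = p" using p by (auto simp: prime_nat_iff)
    have "filter_mset (\<lambda>x. \<not> int q dvd (case x of (u, v) \<Rightarrow> f v - f u)) P = P"
      using distinct \<open>q = p\<close> by (intro filter_mset_allI) (auto simp: mod_eq_dvd_iff dvd_diff_commute)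
    then show "q \<le> size (filter_mset (\<lambda>x. \<not> int q dvd (case x of (u, v) \<Rightarrow> f v - f u)) P) + 1"
      using P p2 \<open>q = p\<close> by simp
  qed
  then obtain F where F: "F \<subseteq># P" "all_residues p (\<lambda>(u, v). f v - f u) F"
    using spread_imp_all_residues[of p "\<lambda>(u, v). f v - f u" P] p2 by auto
  obtain Z where Z: "Z \<subseteq># F" "int p dvd (\<Sum>(u, v)\<in>#Z. f v - f u) - (- (\<Sum>x\<in>#image_mset fst P. f x) - f e)"
    using F(2) unfolding all_residues_def by blast
  have ZP: "Z \<subseteq># P" using Z(1) F(1) by (rule subset_mset.order_trans)
  define U where "U = image_mset fst (P - Z) + image_mset snd Z"
  have "U \<subseteq># image_mset fst P + image_mset snd P" unfolding U_def by (rule pairs_choice_subset[OF ZP])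
  then have "add_mset e U \<subseteq># M" unfolding M_eq using e
    by (metis add_mset_add_single mset_subset_eq_single subset_mset.add_mono)
  moreover have "size (add_mset e U) = p"
  proof -
    have "size (P - Z) + size Z = p - 1" using ZP P size_Diff_submset size_mset_mono by fastforce
    then show ?thesis unfolding U_def using p2 by simp
  qed
  moreover have "int p dvd (\<Sum>x\<in>#add_mset e U. f x)"
    using Z(2) sum_pairs_choice[OF ZP, of f] unfolding U_def by (simp add: algebra_simps)
  ultimately show ?thesis unfolding zero_sum_sub_def by blast
qed

section \<open>Blocks with sums divisible by a prime, and the passage to composite moduli\<close>

definition blocks :: "nat \<Rightarrow> ('b \<Rightarrow> int) \<Rightarrow> 'b multiset multiset \<Rightarrow> bool" where
  "blocks p f Bs \<longleftrightarrow> (\<forall>B\<in>#Bs. size B = p \<and> int p dvd (\<Sum>x\<in>#B. f x))"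

lemma blocks_add [simp]:
  "blocks p f (add_mset B Bs) \<longleftrightarrow> size B = p \<and> int p dvd (\<Sum>x\<in>#B. f x) \<and> blocks p f Bs"
  unfolding blocks_def by auto

lemma blocks_size: "blocks p f Bs \<Longrightarrow> size (\<Sum>\<^sub># Bs) = size Bs * p"
  by (induction Bs) auto

lemma blocks_sum:
  "blocks p f Bs \<Longrightarrow> (\<Sum>x\<in>#\<Sum>\<^sub># Bs. f x) = int p * (\<Sum>B\<in>#Bs. (\<Sum>x\<in>#B. f x) div int p)"
  by (induction Bs) (auto simp: distrib_left)

text \<open>Blocks are removed greedily; before the last of the \<open>j\<close> blocks at least
  \<open>2 * p - 1\<close> terms remain. That the blocks are disjoint inside \<open>M\<close> is
  expressed by \<open>\<Sum>\<^sub># Bs \<subseteq># M\<close>.\<close>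

lemma ex_blocks:
  assumes "\<And>M. 2 * p \<le> size M + 1 \<Longrightarrow> zero_sum_sub p p f M" and "(j + 1) * p \<le> size M + 1"
  obtains Bs where "blocks p f Bs" "size Bs = j" "\<Sum>\<^sub># Bs \<subseteq># M"
  using assms(2)
proof (induction j arbitrary: thesis)
  case 0
  show ?case by (rule "0"(1)[of "{#}"]) (auto simp: blocks_def)
next
  case (Suc j)
  obtain Bs where Bs: "blocks p f Bs" "size Bs = j" "\<Sum>\<^sub># Bs \<subseteq># M"
    using Suc.IH Suc.prems(2) by auto
  have "size (M - \<Sum>\<^sub># Bs) = size M - j * p"
    using Bs blocks_size size_Diff_submset by metis
  then have "2 * p \<le> size (M - \<Sum>\<^sub># Bs) + 1" using Suc.prems(2) by (simp add: algebra_simps)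
  then obtain B where B: "B \<subseteq># M - \<Sum>\<^sub># Bs" "size B = p" "int p dvd (\<Sum>x\<in>#B. f x)"
    using assms(1) unfolding zero_sum_sub_def by blast
  have "B + \<Sum>\<^sub># Bs \<subseteq># (M - \<Sum>\<^sub># Bs) + \<Sum>\<^sub># Bs" using B(1) by simp
  then have "\<Sum>\<^sub># (add_mset B Bs) \<subseteq># M" using Bs(3) by simp
  then show ?case using Suc.prems(1)[of "add_mset B Bs"] Bs B by simp
qed

text \<open>Block sums are \<open>p\<close> times their quotients, so a zero sum modulo
  \<open>k\<close> of quotients is a zero sum modulo \<open>p * k\<close> of the union of the
  blocks.\<close>

lemma blocks_zero_sum_sub:
  assumes "blocks p f Bs" "\<Sum>\<^sub># Bs \<subseteq># M"
    and "zero_sum_sub k j (\<lambda>B. (\<Sum>x\<in>#B. f x) div int p) Bs"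
  shows "zero_sum_sub (p * k) (p * j) f M"
proof -
  obtain Cs where Cs: "Cs \<subseteq># Bs" "size Cs = j" "int k dvd (\<Sum>B\<in>#Cs. (\<Sum>x\<in>#B. f x) div int p)"
    using assms(3) unfolding zero_sum_sub_def by blast
  have bl: "blocks p f Cs" using assms(1) Cs(1) mset_subset_eqD unfolding blocks_def by metis
  have "\<Sum>\<^sub># Cs \<subseteq># \<Sum>\<^sub># Bs" using Cs(1) by (metis subset_mset.add_diff_inverse sum_mset.union mset_subset_eq_add_left)
  then have "\<Sum>\<^sub># Cs \<subseteq># M" using assms(2) by (rule subset_mset.order_trans)
  then show ?thesis unfolding zero_sum_sub_def
    using blocks_size[OF bl] blocks_sum[OF bl] Cs(2,3)
    by (intro exI[of _ "\<Sum>\<^sub># Cs"]) (auto simp: mult.commute)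
qed

text \<open>Splitting off a prime factor \<open>p\<close> of \<open>k\<close> gives
  \<open>L' + k' - 1\<close> blocks, just enough for the claim modulo \<open>k'\<close> on the
  quotients. These are again integers, so the induction runs over integer sequences with the
  identity as weight.\<close>

lemma EGZ_int:
  assumes "k > 0" "k dvd L" "L + k \<le> size M + 1"
  shows "zero_sum_sub k L (\<lambda>x. x) (M :: int multiset)"
  using assms
proof (induction k arbitrary: L M rule: less_induct)
  case (less k)
  show ?case
  proof (cases "k = 1")
    case True
    then show ?thesis using less.prems by (intro const_imp_zero_sum_sub) auto
  next
    case False
    then obtain p where p: "Factorial_Ring.prime p" "p dvd k" using prime_factor_nat by blast
    then obtain k' where k': "k = p * k'" by (auto elim: dvdE)
    have "k' > 0" "k' < k" using less.prems(1) k' prime_gt_1_nat[OF p(1)] by auto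
    obtain L' where L': "L = p * L'" "k' dvd L'"
      using less.prems(2) k' prime_gt_0_nat[OF p(1)] by (auto elim!: dvdE simp: mult.assoc)
    have "(L' + k' - 1 + 1) * p \<le> size M + 1"
      using less.prems(3) k' L' \<open>k' > 0\<close> by (simp add: algebra_simps)
    then obtain Bs where Bs: "blocks p (\<lambda>x. x) Bs" "size Bs = L' + k' - 1" "\<Sum>\<^sub># Bs \<subseteq># M"
      using ex_blocks[of p "\<lambda>x::int. x" "L' + k' - 1" M] prime_block[OF p(1)] by metis
    have "zero_sum_sub k' L' (\<lambda>x. x) (image_mset (\<lambda>B. (\<Sum>x\<in>#B. x) div int p) Bs)"
      by (rule less.IH) (use \<open>k' < k\<close> \<open>k' > 0\<close> L' Bs(2) in auto)
    then have "zero_sum_sub k' L' (\<lambda>B. (\<Sum>x\<in>#B. x) div int p) Bs" by (rule zero_sum_sub_image)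
    then show ?thesis unfolding k' L'(1) by (rule blocks_zero_sum_sub[OF Bs(1,3)])
  qed
qed

theorem EGZ:
  assumes "k > 0" "k dvd L" "L + k \<le> size M + 1"
  shows "zero_sum_sub k L f M"
  using zero_sum_sub_image[of k L "\<lambda>x. x" f M] EGZ_int[of k L "image_mset f M"] assms by simp

section \<open>Extremal sequences over cyclic groups\<close>

abbreviation residues_mod :: "nat \<Rightarrow> int multiset \<Rightarrow> int multiset" where
  "residues_mod m M \<equiv> image_mset (\<lambda>x. x mod int m) M"

abbreviation block_in :: "nat \<Rightarrow> int multiset \<Rightarrow> bool" where
  "block_in m M \<equiv> zero_sum_sub m m (\<lambda>x. x) M"

text \<open>\<open>2 * m - 2\<close> is the largest length that a sequence without a block can have.
  That the difference of the two residues is a unit modulo \<open>m\<close> is deduced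
  separately.\<close>

definition inverse_EGZ :: "nat \<Rightarrow> bool" where
  "inverse_EGZ m \<longleftrightarrow> (\<forall>M. size M + 2 = 2 * m \<longrightarrow> \<not> block_in m M \<longrightarrow>
     (\<exists>a b. residues_mod m M = replicate_mset (m - 1) a + replicate_mset (m - 1) b))"

lemma count_res: "count (residues_mod m M) c = size (filter_mset (\<lambda>x. x mod int m = c) M)"
  by (induction M) auto

lemma count_res_ge_imp_block:
  assumes "count (residues_mod m M) c \<ge> m"
  shows "block_in m M"
proof -
  have "block_in m (filter_mset (\<lambda>x. x mod int m = c) M)"
    by (rule const_imp_zero_sum_sub[where c = c]) (use assms in \<open>auto simp: cong_def count_res\<close>)
  then show ?thesis by (rule zero_sum_sub_mono) simp
qed

lemma sub_replicate_two:
  assumes "U \<subseteq># replicate_mset i a + replicate_mset j b"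
  obtains i' j' where "i' \<le> i" "j' \<le> j" "U = replicate_mset i' a + replicate_mset j' b"
proof -
  have U: "U = U \<inter># replicate_mset i a + (U - replicate_mset i a)"
    by (intro multiset_eqI) simp
  have "U - replicate_mset i a \<subseteq># replicate_mset j b"
    using assms by (simp add: subset_eq_diff_conv add.commute)
  moreover have "U \<inter># replicate_mset i a \<subseteq># replicate_mset i a" by simp
  ultimately show ?thesis using that U by (metis msubseteq_replicate_msetE)
qed

text \<open>Turning a pair round changes the sign of its difference, so differences of pairs are
  compared up to sign.\<close>

definition cong_pm :: "int \<Rightarrow> int \<Rightarrow> int \<Rightarrow> bool" where
  "cong_pm m a b \<longleftrightarrow> [a = b] (mod m) \<or> [a = - b] (mod m)"

lemma cong_pm_trans: "cong_pm m a b \<Longrightarrow> cong_pm m b c \<Longrightarrow> cong_pm m a c"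
  unfolding cong_pm_def by (metis cong_minus_minus_iff cong_trans minus_minus)

text \<open>Both members of \<open>e\<close> and one member of each other pair make \<open>p\<close>
  terms, with \<open>p - 2\<close> differences left to steer the sum. If those of \<open>e1\<close>
  and \<open>e2\<close> do not agree up to sign, then \<open>0\<close>, the two differences and
  their sum are four residues from two terms; the growth starts with \<open>k = 2\<close>, and
  \<open>p - 2\<close> differences reach every residue. The assumption \<open>ne\<close> spares
  \<open>e\<close>, whose members may agree after a re-pairing.\<close>

lemma pair_differences_growth:
  fixes P :: "(int \<times> int) multiset"
  assumes p: "Factorial_Ring.prime p" and noblock: "\<not> block_in p (image_mset fst P + image_mset snd P)"
    and size: "size P = p - 1" and sub: "{#e, e1, e2#} \<subseteq># P"
    and ne: "\<And>u v. (u, v) \<in># P - {#e#} \<Longrightarrow> \<not> [u = v] (mod int p)"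
  shows "cong_pm (int p) (snd e1 - fst e1) (snd e2 - fst e2)"
proof (rule ccontr)
  assume neq: "\<not> ?thesis"
  define f where "f = (\<lambda>(u::int, v). v - u)"
  define D where "D = P - {#e#}"
  have p2: "p \<ge> 2" using p by (rule prime_ge_2_nat)
  have PD: "P = add_mset e D" unfolding D_def
    using sub by (metis insert_DiffM mset_subset_eqD union_single_eq_member add_mset_commute)
  have "{#e1, e2#} \<subseteq># D" using sub unfolding PD by (simp add: add_mset_commute)
  have e12: "e1 \<in># D" "e2 \<in># D" using \<open>{#e1, e2#} \<subseteq># D\<close> by (auto dest: mset_subset_eqD)
  have f_ne: "\<not> int p dvd f x" if "x \<in># D" for x
    using ne[of "fst x" "snd x"] that unfolding f_def D_def
    by (auto simp: case_prod_beta cong_iff_dvd_diff dvd_diff_commute)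
  have "\<exists>F. F \<subseteq># D \<and> all_residues p f F \<and> size F + 2 \<le> p"
  proof (rule resid_growth_all_residues[OF _ \<open>{#e1, e2#} \<subseteq># D\<close>])
    have ne1: "\<not> int p dvd f e1" and ne2: "\<not> int p dvd f e2" using f_ne e12 by auto
    have ne3: "\<not> int p dvd f e1 - f e2" and ne4: "\<not> int p dvd f e1 + f e2"
      using neq unfolding f_def cong_pm_def by (auto simp: cong_iff_dvd_diff case_prod_beta algebra_simps)
    define T where "T = {0, f e1 mod int p, f e2 mod int p, (f e1 + f e2) mod int p}"
    have "T \<subseteq> resid p f {#e1, e2#}"
    proof -
      have "(\<Sum>x\<in>#Z. f x) mod int p \<in> resid p f {#e1, e2#}" if "Z \<subseteq># {#e1, e2#}" for Z
        using that unfolding resid_def by blast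
      from this[of "{#}"] this[of "{#e1#}"] this[of "{#e2#}"] this[of "{#e1, e2#}"]
      show ?thesis unfolding T_def by simp
    qed
    moreover have "card T = 4"
    proof -
      have "f e1 mod int p \<noteq> 0" "f e2 mod int p \<noteq> 0" "(f e1 + f e2) mod int p \<noteq> 0"
        using ne1 ne2 ne4 by (simp_all add: dvd_eq_mod_eq_0)
      moreover have "f e1 mod int p \<noteq> f e2 mod int p" using ne3 by (simp add: mod_eq_dvd_iff)
      moreover have "f e1 mod int p \<noteq> (f e1 + f e2) mod int p"
        using ne2 by (simp add: mod_eq_dvd_iff)
      moreover have "f e2 mod int p \<noteq> (f e1 + f e2) mod int p"
        using ne1 by (simp add: mod_eq_dvd_iff)
      ultimately show ?thesis unfolding T_def by simp
    qed
    moreover have "finite (resid p f {#e1, e2#})" by (rule finite_resid) (use p2 in simp)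
    ultimately have "4 \<le> card (resid p f {#e1, e2#})" by (metis card_mono)
    then show "size {#e1, e2#} + 2 \<le> card (resid p f {#e1, e2#})" by simp
    show "q \<le> size (filter_mset (\<lambda>x. \<not> int q dvd f x) D) + 1" if "q dvd p" "2 \<le> q" "q < p" for q
      using that p by (auto simp: prime_nat_iff)
    have "filter_mset (\<lambda>x. \<not> int p dvd f x) D = D" by (rule filter_mset_allI) (rule f_ne)
    then show "p \<le> size (filter_mset (\<lambda>x. \<not> int p dvd f x) D) + 2" using size p2 PD by simp
  qed (use p2 in auto)
  then obtain F where F: "F \<subseteq># D" "all_residues p f F" by blast
  obtain Z where Z: "Z \<subseteq># F"
    "int p dvd (\<Sum>x\<in>#Z. f x) - (- (\<Sum>x\<in>#image_mset fst D. x) - fst e - snd e)"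
    using F(2) unfolding all_residues_def by blast
  have ZD: "Z \<subseteq># D" using Z(1) F(1) by (rule subset_mset.order_trans)
  define U where "U = image_mset fst (D - Z) + image_mset snd Z"
  have "U \<subseteq># image_mset fst D + image_mset snd D" unfolding U_def by (rule pairs_choice_subset[OF ZD])
  then have "{#fst e, snd e#} + U \<subseteq># image_mset fst P + image_mset snd P" unfolding PD by simp
  moreover have "size ({#fst e, snd e#} + U) = p"
  proof -
    have "size (D - Z) + size Z = p - 2" using ZD size PD size_Diff_submset size_mset_mono by fastforce
    then show ?thesis unfolding U_def using p2 by simp
  qed
  moreover have "int p dvd (\<Sum>x\<in>#{#fst e, snd e#} + U. x)"
    using Z(2) sum_pairs_choice[OF ZD, of "\<lambda>x. x"] unfolding U_def f_def by (simp add: algebra_simps)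
  ultimately have "block_in p (image_mset fst P + image_mset snd P)"
    unfolding zero_sum_sub_def by (intro exI[of _ "{#fst e, snd e#} + U"]) simp
  then show False using noblock by blast
qed

lemma res_pairs_const:
  assumes "\<And>u v. (u, v) \<in># P \<Longrightarrow> {#u mod int m, v mod int m#} = {#a, b#}"
  shows "residues_mod m (image_mset fst P + image_mset snd P)
    = replicate_mset (size P) a + replicate_mset (size P) b"
  using assms
proof (induction P)
  case (add e P)
  have IH: "residues_mod m (image_mset fst P + image_mset snd P)
    = replicate_mset (size P) a + replicate_mset (size P) b"
    by (rule add.IH) (rule add.prems, simp)
  have "{#fst e mod int m, snd e mod int m#} = {#a, b#}"
    using add.prems[of "fst e" "snd e"] by simp
  have "residues_mod m (image_mset fst (add_mset e P) + image_mset snd (add_mset e P))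
    = {#fst e mod int m, snd e mod int m#} + residues_mod m (image_mset fst P + image_mset snd P)" by simp
  also have "\<dots> = {#a, b#} + (replicate_mset (size P) a + replicate_mset (size P) b)"
    unfolding IH \<open>{#fst e mod int m, snd e mod int m#} = {#a, b#}\<close> ..
  finally show ?case by simp
qed simp

text \<open>Pair the terms so that no two partners agree. Two pairs whose differences do not agree up to sign
  yield an additional residue, so the differences of every such pairing agree up to sign.\<close>

lemma inverse_EGZ_prime:
  assumes p: "Factorial_Ring.prime p"
  shows "inverse_EGZ p"
  unfolding inverse_EGZ_def
proof (intro allI impI)
  fix M :: "int multiset"
  assume size: "size M + 2 = 2 * p" and noblock: "\<not> block_in p M"
  have p2: "p \<ge> 2" using p by (rule prime_ge_2_nat)
  have less: "count (residues_mod p M) c < p" for c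
    using count_res_ge_imp_block[of p M c] noblock by force
  consider "p = 2" | "p = 3" | "p \<ge> 5"
  proof -
    have "p \<noteq> 4" using p unfolding prime_nat_iff by (auto dest: spec[of _ 2])
    then show ?thesis using that p2 by linarith
  qed
  then show "\<exists>a b. residues_mod p M = replicate_mset (p - 1) a + replicate_mset (p - 1) b"
  proof cases
    case 1
    then have "size M = Suc (Suc 0)" using size by simp
    then obtain x N where "M = add_mset x N" "size N = 1"
      using size_eq_Suc_imp_eq_union[of M "Suc 0"] by auto
    moreover from this obtain y where "N = {#y#}" using size_1_singleton_mset by blast
    ultimately show ?thesis using 1 by auto
  next
    case 2
    \<comment> \<open>If all three residues were present, \<open>0 + 1 + 2\<close> would give a
      block; so at most two occur among the four terms, each at most twice.\<close>
    have sum: "count (residues_mod p M) 0 + count (residues_mod p M) 1 + count (residues_mod p M) 2 = 4"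
    proof -
      have "count (residues_mod 3 N) 0 + count (residues_mod 3 N) 1 + count (residues_mod 3 N) 2 = size N" for N :: "int multiset"
      proof (induction N)
        case (add x N)
        have "x mod 3 = 0 \<or> x mod 3 = 1 \<or> x mod 3 = 2" by presburger
        then show ?case using add by auto
      qed simp
      then show ?thesis using size 2 by simp
    qed
    have "\<exists>c\<in>{0, 1, 2}. count (residues_mod p M) c = 0"
    proof (rule ccontr)
      assume "\<not> ?thesis"
      then have "0 \<in># residues_mod p M" "1 \<in># residues_mod p M" "2 \<in># residues_mod p M" by (auto simp: count_eq_zero_iff)
      then obtain x y z where xyz: "x \<in># M" "x mod 3 = 0" "y \<in># M" "y mod 3 = 1" "z \<in># M" "z mod 3 = 2"
        using 2 by auto
      have "{#x, y, z#} \<subseteq># M" using xyz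
        by (auto simp: insert_subset_eq_iff in_diff_count)
      moreover have "3 dvd x + y + z" using xyz by presburger
      ultimately have "block_in p M" unfolding zero_sum_sub_def using 2
        by (intro exI[of _ "{#x, y, z#}"]) (auto simp: add.assoc)
      then show False using noblock by blast
    qed
    then obtain c where c: "c \<in> {0, 1, 2}" "count (residues_mod p M) c = 0" by blast
    have le: "count (residues_mod p M) d \<le> 2" for d using less[of d] 2 by simp
    have other: "count (residues_mod p M) d = 0" if "d \<notin> {0, 1, 2}" for d
    proof -
      have "d \<notin># residues_mod p M"
      proof
        assume "d \<in># residues_mod p M"
        then obtain x where "d = x mod 3" using 2 by auto
        then show False using that by simp presburger
      qed
      then show ?thesis by (simp add: count_eq_zero_iff)
    qed
    define a b :: int where "a = (if c = 0 then 1 else 0)" and "b = (if c = 2 then 1 else 2)"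
    have "residues_mod p M = replicate_mset 2 a + replicate_mset 2 b"
    proof (rule multiset_eqI)
      fix d
      show "count (residues_mod p M) d = count (replicate_mset 2 a + replicate_mset 2 b) d"
        using c sum le[of 0] le[of 1] le[of 2] other[of d] unfolding a_def b_def by auto
    qed
    then show ?thesis using 2 by auto
  next
    case 3
    \<comment> \<open>No residue occurs more than \<open>p - 1\<close> times, so all
      \<open>2 * p - 2\<close> terms can be paired with distinct partners and \<open>E\<close> is
      empty.\<close>
    obtain P E where M: "M = image_mset fst P + image_mset snd P + E" and P: "size P = p - 1"
      and distinct: "\<And>u v. (u, v) \<in># P \<Longrightarrow> u mod int p \<noteq> v mod int p"
    proof (rule distinct_pairs[of "p - 1" M "\<lambda>x. x mod int p"])
      show "size (filter_mset (\<lambda>x. x mod int p = c) M) + (p - 1) \<le> size M" for c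
        using less[of c] size unfolding count_res by linarith
    qed (use size p2 in auto)
    have "size M = 2 * (p - 1) + size E" using M P by simp
    then have "size E = 0" using size p2 by arith
    then have "E = {#}" by simp
    then have M: "M = image_mset fst P + image_mset snd P" using M by simp
    have K: "cong_pm (int p) (snd e1 - fst e1) (snd e2 - fst e2)"
      if "M = image_mset fst Q + image_mset snd Q" "size Q = p - 1" "{#e, e1, e2#} \<subseteq># Q"
        "\<And>u v. (u, v) \<in># Q - {#e#} \<Longrightarrow> \<not> [u = v] (mod int p)" for Q e e1 e2
      using pair_differences_growth[OF p _ that(2-4)] noblock that(1) by blast
    \<comment> \<open>Neither \<open>2\<close> nor \<open>3\<close> vanishes modulo
      \<open>p \<ge> 5\<close>, so nonzero differences stay nonzero when doubled or tripled.\<close>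
    have odd_p: "\<not> int p dvd 2 * d \<and> \<not> int p dvd 3 * d" if "\<not> int p dvd d" for d :: int
    proof -
      have "Factorial_Ring.prime (int p)" using p by simp
      moreover have "\<not> int p dvd 2" "\<not> int p dvd 3"
        using 3 zdvd_not_zless[of 2 "int p"] zdvd_not_zless[of 3 "int p"] by auto
      ultimately show ?thesis using that by (simp add: prime_dvd_mult_iff)
    qed
    \<comment> \<open>Suppose \<open>u\<close> and \<open>x\<close> differ. Re-pairing as
      \<open>(y, v)\<close> and \<open>(x, u)\<close> and sparing the former shows that
      \<open>u - x\<close> is plus or minus the common difference \<open>y - x\<close>. Another
      re-pairing then contains a pair with difference twice \<open>y - x\<close>, which cannot agree
      with \<open>y - x\<close> up to sign.\<close>
    have main: "[u = x] (mod int p)"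
      if Q: "M = image_mset fst Q + image_mset snd Q" "Q = {#(x, y), (u, v), g#} + Q'"
        "size Q = p - 1" "\<And>u v. (u, v) \<in># Q \<Longrightarrow> \<not> [u = v] (mod int p)"
        and d: "[v - u = y - x] (mod int p)" for Q Q' x y u v g
    proof (rule ccontr)
      assume ux: "\<not> [u = x] (mod int p)"
      have xy: "\<not> int p dvd y - x"
        using Q(4)[of x y] Q(2) by (auto simp: cong_iff_dvd_diff dvd_diff_commute)
      have two: False if "[t = 2 * (y - x)] (mod int p)" "cong_pm (int p) t (y - x)" for t
      proof -
        have "int p dvd y - x \<or> int p dvd 3 * (y - x)"
          using that(2) unfolding cong_pm_def
        proof
          assume "[t = y - x] (mod int p)"
          then have "[2 * (y - x) = y - x] (mod int p)" using that(1) cong_trans cong_sym by blast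
          then show ?thesis by (simp add: cong_iff_dvd_diff algebra_simps)
        next
          assume "[t = - (y - x)] (mod int p)"
          then have "[2 * (y - x) = - (y - x)] (mod int p)" using that(1) cong_trans cong_sym by blast
          then show ?thesis by (simp add: cong_iff_dvd_diff algebra_simps)
        qed
        then show False using xy odd_p by blast
      qed
      have g: "cong_pm (int p) (snd g - fst g) (y - x)"
        using K[OF Q(1,3), of "(u, v)" g "(x, y)"] Q(2,4) by (auto simp: add_mset_commute)
      have "cong_pm (int p) (u - x) (snd g - fst g)"
        using K[of "{#(y, v), (x, u), g#} + Q'" "(y, v)" "(x, u)" g]
          Q ux cong_sym[of x u] by auto
      then have "cong_pm (int p) (u - x) (y - x)" using g by (rule cong_pm_trans)
      then show False unfolding cong_pm_def
      proof
        assume u: "[u - x = y - x] (mod int p)"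
        have t: "[v - x = 2 * (y - x)] (mod int p)" using cong_add[OF d u] by (simp add: algebra_simps)
        have "\<not> int p dvd v - x" using t odd_p[OF xy] cong_dvd_iff by blast
        then have "\<not> [x = v] (mod int p)" by (simp add: cong_iff_dvd_diff dvd_diff_commute)
        then have "cong_pm (int p) (v - x) (snd g - fst g)"
          using K[of "{#(y, u), (x, v), g#} + Q'" "(y, u)" "(x, v)" g]
          Q by auto
        then show False using two[OF t] g cong_pm_trans by blast
      next
        assume u: "[u - x = - (y - x)] (mod int p)"
        have t: "[y - u = 2 * (y - x)] (mod int p)"
          using cong_diff[OF cong_refl[of "y - x"] u] by (simp add: algebra_simps)
        have "\<not> int p dvd y - u" using t odd_p[OF xy] cong_dvd_iff by blast
        then have "\<not> [u = y] (mod int p)" by (simp add: cong_iff_dvd_diff dvd_diff_commute)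
        then have "cong_pm (int p) (y - u) (snd g - fst g)"
          using K[of "{#(v, x), (u, y), g#} + Q'" "(v, x)" "(u, y)" g]
          Q by auto
        then show False using two[OF t] g cong_pm_trans by blast
      qed
    qed
    have "P \<noteq> {#}" using P 3 by auto
    then obtain e0 P1 where P1: "P = add_mset e0 P1" by (metis multiset_cases)
    obtain x y where e0: "e0 = (x, y)" by force
    have ne: "\<not> [u = v] (mod int p)" if "(u, v) \<in># P" for u v
      using distinct[OF that] by (simp add: cong_def)
    have "{#u mod int p, v mod int p#} = {#x mod int p, y mod int p#}" if uv: "(u, v) \<in># P" for u v
    proof (cases "(u, v) = e0")
      case False
      then obtain P2 where P2: "P1 = add_mset (u, v) P2"
        using uv P1 by (metis insert_DiffM insert_iff set_mset_add_mset_insert)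
      then have "size P2 + 3 = p" "P2 \<noteq> {#}" using P P1 3 by auto
      then obtain g P3 where P3: "P2 = add_mset g P3" by (metis multiset_cases)
      have Peq: "P = {#(x, y), (u, v), g#} + P3" unfolding P1 P2 P3 e0 by simp
      have "cong_pm (int p) (v - u) (y - x)"
        using K[OF M P, of g "(u, v)" "(x, y)"] ne Peq by (auto simp: add_mset_commute)
      then show ?thesis unfolding cong_pm_def
      proof
        assume d: "[v - u = y - x] (mod int p)"
        have "[u = x] (mod int p)" by (rule main[OF M Peq P ne d])
        moreover from this have "[v = y] (mod int p)" using cong_add[OF d] by force
        ultimately show ?thesis by (simp add: cong_def)
      next
        \<comment> \<open>Opposite differences become equal ones once \<open>(u, v)\<close> is
          replaced by \<open>(v, u)\<close>.\<close>
        assume "[v - u = - (y - x)] (mod int p)"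
        then have d: "[u - v = y - x] (mod int p)"
          by (metis cong_minus_minus_iff minus_diff_eq minus_minus)
        have "[v = x] (mod int p)"
        proof (rule main[of "{#(x, y), (v, u), g#} + P3", OF _ HOL.refl _ _ d])
          show "M = image_mset fst ({#(x, y), (v, u), g#} + P3) + image_mset snd ({#(x, y), (v, u), g#} + P3)"
            unfolding M Peq by simp
          show "size ({#(x, y), (v, u), g#} + P3) = p - 1" using P Peq by simp
          show "\<not> [u' = v'] (mod int p)" if "(u', v') \<in># {#(x, y), (v, u), g#} + P3" for u' v'
            using that ne[of u' v'] ne[of v' u'] unfolding Peq by (auto simp: cong_sym_eq)
        qed
        moreover from this have "[u = y] (mod int p)" using cong_add[OF d] by force
        ultimately show ?thesis by (simp add: cong_def add_mset_commute)
      qed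
    qed (simp add: e0)
    then have "residues_mod p M = replicate_mset (size P) (x mod int p) + replicate_mset (size P) (y mod int p)"
      unfolding M by (rule res_pairs_const)
    then show ?thesis unfolding P by blast
  qed
qed

lemma two_valued_neq:
  assumes "m \<ge> 2" "\<not> block_in m M" "residues_mod m M = replicate_mset (m - 1) a + replicate_mset (m - 1) b"
  shows "a \<noteq> b"
proof
  assume "a = b"
  then have "count (residues_mod m M) a = 2 * (m - 1)" using assms(3) by simp
  then have "count (residues_mod m M) a \<ge> m" using assms(1) by linarith
  then show False using count_res_ge_imp_block assms(2) by blast
qed

section \<open>From primes to composite moduli in the inverse theorem\<close>

lemma size_block_complement: "U \<subseteq># M \<Longrightarrow> size U = m \<Longrightarrow> size (M - U) = size M - m"
  by (simp add: size_Diff_submset)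

text \<open>The complement of every block is extremal, hence two-valued. Once a residue
  \<open>a\<close> is known to occur \<open>m\<close> times, \<open>m\<close> terms of this residue
  form a block, whose complement contains \<open>a\<close> another \<open>m - 1\<close> times. The
  lemma serves twice: for a block joined to the remainder of a block decomposition, and for
  \<open>L = 2 * m\<close>.\<close>

lemma inverse_EGZ_disjoint_blocks:
  assumes m: "m \<ge> 2" and inv: "inverse_EGZ m" and size: "size W + 2 = 3 * m"
    and disj: "\<And>U. U \<subseteq># W \<Longrightarrow> size U = m \<Longrightarrow> int m dvd (\<Sum>x\<in>#U. x) \<Longrightarrow> \<not> block_in m (W - U)"
  obtains a b where "residues_mod m W = replicate_mset (2 * m - 1) a + replicate_mset (m - 1) b"
proof -
  have form: "\<exists>a b. residues_mod m (W - U) = replicate_mset (m - 1) a + replicate_mset (m - 1) b \<and> a \<noteq> b"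
    if U: "U \<subseteq># W" "size U = m" "int m dvd (\<Sum>x\<in>#U. x)" for U
  proof -
    have "size (W - U) + 2 = 2 * m" using size_block_complement[OF U(1,2)] size m by simp
    then obtain a b where ab: "residues_mod m (W - U) = replicate_mset (m - 1) a + replicate_mset (m - 1) b"
      using inv disj[OF U] unfolding inverse_EGZ_def by blast
    then show ?thesis using two_valued_neq[OF m disj[OF U] ab] by blast
  qed
  have split: "residues_mod m W = residues_mod m U + residues_mod m (W - U)" if "U \<subseteq># W" for U
    using that by (metis image_mset_union subset_mset.add_diff_inverse)
  \<comment> \<open>If a block \<open>U\<close> avoids both residues of its complement, a term
    \<open>c\<close> of \<open>U\<close> together with the complement contains a block
    \<open>V\<close> through \<open>c\<close>. Multiplicities in the complement of \<open>V\<close>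
    force the rest of \<open>V\<close> to be constant, of residue \<open>e\<close> say; as
    \<open>m\<close> divides \<open>c + (m - 1) * e\<close>, the residues of \<open>c\<close> and
    \<open>e\<close> agree after all.\<close>
  have meets: "a \<in># residues_mod m U \<or> b \<in># residues_mod m U"
    if U: "U \<subseteq># W" "size U = m" "int m dvd (\<Sum>x\<in>#U. x)"
      and ab: "residues_mod m (W - U) = replicate_mset (m - 1) a + replicate_mset (m - 1) b" for U a b
  proof (rule ccontr)
    assume none: "\<not> ?thesis"
    have "a \<noteq> b" by (rule two_valued_neq[OF m disj[OF U] ab])
    have "U \<noteq> {#}" using U(2) m by auto
    then obtain c where c: "c \<in># U" by blast
    have "size (W - U) + 2 = 2 * m" using size_block_complement[OF U(1,2)] size m by simp
    then have "block_in m (add_mset c (W - U))" using m by (intro EGZ) auto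
    then obtain V where V: "V \<subseteq># add_mset c (W - U)" "size V = m" "int m dvd (\<Sum>x\<in>#V. x)"
      unfolding zero_sum_sub_def by blast
    have "c \<in># V"
    proof (rule ccontr)
      assume "c \<notin># V"
      then have "V \<subseteq># W - U" using V(1) by (metis diff_single_trivial subset_eq_diff_conv add_mset_add_single)
      then have "block_in m (W - U)" using V(2,3) unfolding zero_sum_sub_def by blast
      then show False using disj[OF U] by blast
    qed
    then obtain V' where V': "V = add_mset c V'" by (metis insert_DiffM)
    have V'sub: "V' \<subseteq># W - U" using V(1) unfolding V' by simp
    then have "residues_mod m V' \<subseteq># replicate_mset (m - 1) a + replicate_mset (m - 1) b"
      unfolding ab[symmetric] by (rule image_mset_subseteq_mono)
    then obtain i j where ij: "i \<le> m - 1" "j \<le> m - 1"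
      "residues_mod m V' = replicate_mset i a + replicate_mset j b" by (rule sub_replicate_two)
    have "size V' = i + j" using arg_cong[OF ij(3), of size] by simp
    then have sum: "i + j = m - 1" using V(2) V' by simp
    have "{#c#} + V' \<subseteq># U + (W - U)" using c V'sub by (intro subset_mset.add_mono) auto
    then have VW: "V \<subseteq># W" unfolding V' using U(1) by simp
    obtain x y where xy: "residues_mod m (W - V) = replicate_mset (m - 1) x + replicate_mset (m - 1) y" "x \<noteq> y"
      using form[OF VW V(2,3)] by blast
    have counts: "count (residues_mod m W) d = count (residues_mod m V) d + count (residues_mod m (W - V)) d" for d
      using split[OF VW] by simp
    have cnt: "count (residues_mod m (W - V)) d \<in> {0, m - 1}" for d using xy by auto
    have "c mod int m \<in># residues_mod m U" using c by simp
    then have cab: "c mod int m \<noteq> a" "c mod int m \<noteq> b" using none by auto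
    have "count (residues_mod m W) a = m - 1" "count (residues_mod m W) b = m - 1"
      using none ab \<open>a \<noteq> b\<close> split[OF U(1)] by (auto simp: count_eq_zero_iff)
    moreover have "count (residues_mod m V) a = i" "count (residues_mod m V) b = j"
      unfolding V' using ij(3) cab \<open>a \<noteq> b\<close> by auto
    ultimately have "i = 0 \<or> i = m - 1" using counts[of a] cnt[of a] ij by auto
    then have "residues_mod m V' = replicate_mset (m - 1) a \<or> residues_mod m V' = replicate_mset (m - 1) b"
      using sum ij(3) by auto
    then obtain e where e: "e \<in> {a, b}" "residues_mod m V' = replicate_mset (m - 1) e" by blast
    have "[(\<Sum>x\<in>#V'. x) = int (size V') * e] (mod int m)"
    proof (rule sum_mset_cong_const)
      fix x assume "x \<in># V'"
      then have "x mod int m \<in># residues_mod m V'" by simp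
      then have "x mod int m = e" unfolding e(2) by (auto split: if_splits)
      then show "[x = e] (mod int m)" unfolding cong_def by auto
    qed
    then have "[c + (\<Sum>x\<in>#V'. x) = c + int (m - 1) * e] (mod int m)"
      using sum \<open>size V' = i + j\<close> by (simp add: cong_add)
    then have "int m dvd c + int (m - 1) * e" using V(3) unfolding V' by (simp add: cong_dvd_iff)
    moreover have "c + int (m - 1) * e = c - e + int m * e" using m by (simp add: of_nat_diff algebra_simps)
    ultimately have "int m dvd c - e" by (metis dvd_add_left_iff dvd_triv_left)
    then have "c mod int m = e mod int m" by (simp add: mod_eq_dvd_iff)
    moreover have "e mod int m = e"
    proof -
      have "e \<in># residues_mod m V'" using e(2) m by auto
      then show ?thesis by auto
    qed
    ultimately show False using e(1) cab by auto
  qed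
  \<comment> \<open>By \<open>meets\<close> a block raises the multiplicity \<open>m - 1\<close> of
    one of the two residues of its complement.\<close>
  have "\<exists>a. count (residues_mod m W) a \<ge> m"
  proof -
    have "block_in m W" using m size by (intro EGZ) auto
    then obtain U where U: "U \<subseteq># W" "size U = m" "int m dvd (\<Sum>x\<in>#U. x)"
      unfolding zero_sum_sub_def by blast
    obtain a b where ab: "residues_mod m (W - U) = replicate_mset (m - 1) a + replicate_mset (m - 1) b" "a \<noteq> b"
      using form[OF U] by blast
    have "count (residues_mod m U) a \<ge> 1 \<or> count (residues_mod m U) b \<ge> 1" using meets[OF U ab(1)]
      by (metis count_greater_eq_one_iff)
    moreover have "count (residues_mod m W) a = count (residues_mod m U) a + (m - 1)"
      "count (residues_mod m W) b = count (residues_mod m U) b + (m - 1)" using split[OF U(1)] ab by auto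
    ultimately have "m \<le> count (residues_mod m W) a \<or> m \<le> count (residues_mod m W) b" by linarith
    then show ?thesis by blast
  qed
  then obtain a where a: "count (residues_mod m W) a \<ge> m" by blast
  have "replicate_mset m a \<subseteq># residues_mod m W" using a by (simp add: count_le_replicate_mset_subset_eq)
  then obtain U where U: "U \<subseteq># W" "residues_mod m U = replicate_mset m a"
    using sub_mset_image_mset[of "replicate_mset m a" "\<lambda>x. x mod int m" W] by blast
  have sizeU: "size U = m" using arg_cong[OF U(2), of size] by simp
  have "[(\<Sum>x\<in>#U. x) = int (size U) * a] (mod int m)"
  proof (rule sum_mset_cong_const)
    fix x assume "x \<in># U"
    then have "x mod int m \<in># residues_mod m U" by simp
    then have "x mod int m = a" unfolding U(2) by (auto split: if_splits)
    then show "[x = a] (mod int m)" unfolding cong_def by auto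
  qed
  then have dvdU: "int m dvd (\<Sum>x\<in>#U. x)" using sizeU by (simp add: cong_dvd_iff)
  obtain x y where xy: "residues_mod m (W - U) = replicate_mset (m - 1) x + replicate_mset (m - 1) y" "x \<noteq> y"
    using form[OF U(1) sizeU dvdU] by blast
  have "x = a \<or> y = a" using meets[OF U(1) sizeU dvdU xy(1)] unfolding U(2) by (auto split: if_splits)
  moreover have "replicate_mset m a + replicate_mset (m - 1) a = replicate_mset (2 * m - 1) a"
    using m by (intro multiset_eqI) auto
  ultimately show ?thesis using that[of a x] that[of a y] split[OF U(1)] U(2) xy(1)
    by (auto simp: ac_simps)
qed

text \<open>The residue \<open>v\<close> is the one that \<open>V\<close> lacks once: its
  multiplicity in \<open>V\<close> is \<open>k - 2\<close>. For \<open>k = 2\<close> this is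
  \<open>0\<close> and \<open>V\<close> is a single residue; the range conditions then make
  \<open>v\<close> the other residue modulo 2.\<close>

lemma complement_two_valued:
  fixes V :: "int multiset"
  assumes "k \<ge> 2" "set_mset V \<subseteq> {0..<int k}" "v \<in> {0..<int k}" "v' \<in> {0..<int k}"
    and "add_mset v V = replicate_mset (k - 1) s + replicate_mset (k - 1) t" "s \<noteq> t"
    and "add_mset v' V = replicate_mset (k - 1) s' + replicate_mset (k - 1) t'" "s' \<noteq> t'"
  shows "v = v'"
proof (rule ccontr)
  assume neq: "v \<noteq> v'"
  have *: False if st: "v = s" "add_mset v V = replicate_mset (k - 1) s + replicate_mset (k - 1) t" "s \<noteq> t"
    for s t
  proof -
    have c: "count (add_mset v V) d = (if d = s \<or> d = t then k - 1 else 0)" for d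
      using st(2,3) by auto
    have c': "count (add_mset v' V) d \<in> {0, k - 1}" for d using assms(7,8) by auto
    have cs: "count V s = k - 2" using c[of s] st(1) by simp
    have ct: "count V t = k - 1" using c[of t] st(1,3) by simp
    have "v' \<noteq> t" using c'[of t] ct assms(1) by auto
    have "count (add_mset v' V) v' = 1" using c[of v'] neq st(1) \<open>v' \<noteq> t\<close> by simp
    then have "k = 2" using c'[of v'] assms(1) by auto
    moreover have "t \<in> {0..<int k}" using ct assms(1,2) by (metis One_nat_def Suc_1 count_eq_zero_iff diff_is_0_eq not_less_eq_eq subsetD)
    ultimately show False using assms(3,4) neq st(1,3) \<open>v' \<noteq> t\<close> by auto
  qed
  have "v \<in># replicate_mset (k - 1) s + replicate_mset (k - 1) t" using assms(5) by (metis union_single_eq_member)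
  then have "v = s \<or> v = t" by (auto split: if_splits)
  then show False using *[of s t] *[of t s] assms(5,6) by (auto simp: add.commute)
qed

text \<open>Cut the sequence into blocks of \<open>p\<close> terms with sum divisible by \<open>p\<close>. The block sums divided by
  \<open>p\<close> form an extremal sequence modulo \<open>k\<close>, which exchanging a term of a block must preserve.\<close>

lemma inverse_EGZ_mult:
  assumes p: "Factorial_Ring.prime p" and k: "k \<ge> 2" and inv: "inverse_EGZ k"
  shows "inverse_EGZ (p * k)"
  unfolding inverse_EGZ_def
proof (intro allI impI)
  fix M :: "int multiset"
  assume size: "size M + 2 = 2 * (p * k)" and noblock: "\<not> block_in (p * k) M"
  have p2: "p \<ge> 2" using p by (rule prime_ge_2_nat)
  have pk: "p * k \<ge> p + 2"
  proof -
    have "p * 2 \<le> p * k" using k by simp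
    then show ?thesis using p2 by linarith
  qed
  define val where "val B = (\<Sum>x\<in>#B. x) div int p" for B :: "int multiset"
  \<comment> \<open>Among \<open>2 * k - 1\<close> blocks the Erdos-Ginzburg-Ziv theorem for the
    quotients finds \<open>k\<close> blocks whose union is a block modulo
    \<open>p * k\<close>.\<close>
  have few: False if "blocks p (\<lambda>x. x) Bs" "\<Sum>\<^sub># Bs \<subseteq># M" "2 * k \<le> size Bs + 1" for Bs
  proof -
    have "zero_sum_sub k k val Bs" using k that(3) by (intro EGZ) auto
    then show False using blocks_zero_sum_sub[of p "\<lambda>x. x" Bs M k k] that noblock
      unfolding val_def by blast
  qed
  have vals: "\<exists>s t. residues_mod k (image_mset val Bs) = replicate_mset (k - 1) s + replicate_mset (k - 1) t \<and> s \<noteq> t"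
    if "blocks p (\<lambda>x. x) Bs" "\<Sum>\<^sub># Bs \<subseteq># M" "size Bs + 2 = 2 * k" for Bs
  proof -
    have nb: "\<not> block_in k (image_mset val Bs)"
    proof
      assume "block_in k (image_mset val Bs)"
      then have "zero_sum_sub k k val Bs" by (rule zero_sum_sub_image)
      then show False using blocks_zero_sum_sub[of p "\<lambda>x. x" Bs M k k] that noblock
        unfolding val_def by blast
    qed
    have "size (image_mset val Bs) + 2 = 2 * k" using that(3) by simp
    then obtain s t where "residues_mod k (image_mset val Bs) = replicate_mset (k - 1) s + replicate_mset (k - 1) t"
      using inv nb unfolding inverse_EGZ_def by blast
    then show ?thesis using two_valued_neq[OF k nb] by blast
  qed
  have ex: "\<exists>Bs. blocks p (\<lambda>x. x) Bs \<and> size Bs = j \<and> \<Sum>\<^sub># Bs \<subseteq># N"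
    if "(j + 1) * p \<le> size N + 1" for j and N :: "int multiset"
    using ex_blocks[of p "\<lambda>x::int. x" j N] prime_block[OF p] that by metis
  have "(2 * k - 2 + 1) * p \<le> size M + 1" using size k p2 by (simp add: algebra_simps diff_mult_distrib)
  then obtain Bs where Bs: "blocks p (\<lambda>x. x) Bs" "size Bs = 2 * k - 2" "\<Sum>\<^sub># Bs \<subseteq># M"
    using ex by blast
  define R where "R = M - \<Sum>\<^sub># Bs"
  have MR: "M = \<Sum>\<^sub># Bs + R" unfolding R_def using Bs(3) by simp
  have "size (\<Sum>\<^sub># Bs) = (2 * k - 2) * p" using blocks_size[OF Bs(1)] Bs(2) by simp
  moreover obtain k0 where "k = k0 + 2" using k by (metis add.commute le_Suc_ex)
  moreover have "size M = size (\<Sum>\<^sub># Bs) + size R" using MR by (metis size_union)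
  ultimately have sizeR: "size R + 2 = 2 * p" using size by (simp add: algebra_simps)
  have nbR: "\<not> block_in p R"
  proof
    assume "block_in p R"
    then obtain B where B: "B \<subseteq># R" "size B = p" "int p dvd (\<Sum>x\<in>#B. x)" unfolding zero_sum_sub_def by blast
    show False by (rule few[of "add_mset B Bs"]) (use B Bs k MR in \<open>auto simp: add.commute\<close>)
  qed
  obtain a b where ab: "residues_mod p R = replicate_mset (p - 1) a + replicate_mset (p - 1) b"
    using inverse_EGZ_prime[OF p] sizeR nbR unfolding inverse_EGZ_def by blast
  have "a \<noteq> b" by (rule two_valued_neq[OF p2 nbR ab])
  \<comment> \<open>Two disjoint blocks inside \<open>B + R\<close> could replace \<open>B\<close>
    and raise the number of blocks to \<open>2 * k - 1\<close>. So the \<open>3 * p - 2\<close>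
    terms of \<open>B + R\<close> have only two residues modulo \<open>p\<close>, and on
    \<open>R\<close> these are \<open>a\<close> and \<open>b\<close>.\<close>
  have block_ab: "set_mset (residues_mod p B) \<subseteq> {a, b}" if B: "B \<in># Bs" for B
  proof -
    obtain Cs where Cs: "Bs = add_mset B Cs" using B by (metis insert_DiffM)
    have "size B = p" using Bs(1) unfolding Cs by simp
    obtain a' b' where ab': "residues_mod p (B + R) = replicate_mset (2 * p - 1) a' + replicate_mset (p - 1) b'"
    proof (rule inverse_EGZ_disjoint_blocks[OF p2 inverse_EGZ_prime[OF p]])
      show "size (B + R) + 2 = 3 * p" using \<open>size B = p\<close> sizeR by simp
      fix U assume U: "U \<subseteq># B + R" "size U = p" "int p dvd (\<Sum>x\<in>#U. x)"
      show "\<not> block_in p (B + R - U)"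
      proof
        assume "block_in p (B + R - U)"
        then obtain V where V: "V \<subseteq># B + R - U" "size V = p" "int p dvd (\<Sum>x\<in>#V. x)"
          unfolding zero_sum_sub_def by blast
        have "V + U \<subseteq># B + R" using V(1) U(1)
          by (metis subset_mset.add_right_mono subset_mset.diff_add)
        then have "\<Sum>\<^sub># (add_mset U (add_mset V Cs)) \<subseteq># M" unfolding MR Cs
          by (simp add: ac_simps)
        moreover have "Suc (size Cs) = 2 * k - 2" using Bs(2) unfolding Cs by simp
        then have "2 * k \<le> size Cs + 3" using k by arith
        ultimately show False using few[of "add_mset U (add_mset V Cs)"] Bs(1) U V unfolding Cs
          by (simp add: eval_nat_numeral)
      qed
    qed
    have "set_mset (residues_mod p R) \<subseteq> set_mset (residues_mod p (B + R))" by auto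
    then have "{a, b} \<subseteq> {a', b'}" unfolding ab ab' using p2 by (auto split: if_splits)
    then have "{a', b'} = {a, b}" using \<open>a \<noteq> b\<close> by auto
    moreover have "set_mset (residues_mod p B) \<subseteq> set_mset (residues_mod p (B + R))" by auto
    ultimately show ?thesis unfolding ab' by (auto split: if_splits)
  qed
  have M_ab: "x mod int p \<in> {a, b}" if "x \<in># M" for x
  proof (cases "x \<in># R")
    case True
    then have "x mod int p \<in># residues_mod p R" by simp
    then show ?thesis unfolding ab by (auto split: if_splits)
  next
    case False
    then have "x \<in># \<Sum>\<^sub># Bs" using that MR by (metis union_iff)
    then obtain B where "B \<in># Bs" "x \<in># B" by blast
    then show ?thesis using block_ab[of B] by auto
  qed
  define cl where "cl c = filter_mset (\<lambda>x. x mod int p = c) M" for c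
  have M_cl: "M = cl a + cl b"
  proof -
    have "cl b = filter_mset (\<lambda>x. x mod int p \<noteq> a) M" unfolding cl_def
      using M_ab \<open>a \<noteq> b\<close> by (intro filter_mset_cong) auto
    then show ?thesis unfolding cl_def using multiset_partition by metis
  qed
  \<comment> \<open>With \<open>p - 1\<close> further terms \<open>Z\<close> of the class, both
    \<open>x\<close> and \<open>y\<close> complete \<open>Z\<close> to a block. The same
    \<open>2 * k - 3\<close> blocks \<open>Cs\<close> extend either one to an extremal family, so
    the two quotients agree modulo \<open>k\<close>.\<close>
  have swap: "[x = y] (mod int (p * k))" if xy: "{#x, y#} \<subseteq># cl c" and big: "size (cl c) \<ge> p + 1" for x y c
  proof -
    have "p - 1 \<le> size (cl c - {#x, y#})" using size_Diff_submset[OF xy] big by simp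
    then obtain Z where Z: "Z \<subseteq># cl c - {#x, y#}" "size Z = p - 1" by (rule ex_sub_mset_size)
    have "Z + {#x, y#} \<subseteq># cl c - {#x, y#} + {#x, y#}" using Z(1) by (intro subset_mset.add_right_mono)
    then have "Z + {#x, y#} \<subseteq># cl c" unfolding subset_mset.diff_add[OF xy] .
    moreover have "cl c \<subseteq># M" unfolding cl_def by simp
    ultimately have ZM: "Z + {#x, y#} \<subseteq># M" by (rule subset_mset.order_trans)
    have resid_c: "[z = c] (mod int p)" if "z \<in># Z + {#x, y#}" for z
      using mset_subset_eqD[OF \<open>Z + {#x, y#} \<subseteq># cl c\<close> that] unfolding cl_def cong_def by auto
    have blk: "int p dvd (\<Sum>x\<in>#add_mset z Z. x)" if "z \<in># {#x, y#}" for z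
    proof -
      have "[(\<Sum>x\<in>#add_mset z Z. x) = int (size (add_mset z Z)) * c] (mod int p)"
        by (rule sum_mset_cong_const) (use resid_c that in auto)
      then show ?thesis using Z(2) p2 by (simp add: cong_dvd_iff)
    qed
    define N where "N = M - (Z + {#x, y#})"
    have MN: "M = N + Z + {#x, y#}" unfolding N_def add.assoc by (rule subset_mset.diff_add[OF ZM, symmetric])
    have "size N + p + 3 = 2 * (p * k)" using size Z(2) p2 MN by simp
    moreover obtain k0 where "k = k0 + 2" using k by (metis add.commute le_Suc_ex)
    ultimately have "(2 * k - 3 + 1) * p \<le> size N + 1" using p2 by (simp add: algebra_simps)
    then obtain Cs where Cs: "blocks p (\<lambda>x. x) Cs" "size Cs = 2 * k - 3" "\<Sum>\<^sub># Cs \<subseteq># N"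
      using ex by blast
    define V where "V = residues_mod k (image_mset val Cs)"
    have two: "\<exists>s t. add_mset (val (add_mset z Z) mod int k) V
        = replicate_mset (k - 1) s + replicate_mset (k - 1) t \<and> s \<noteq> t" if "z \<in># {#x, y#}" for z
    proof -
      have "\<Sum>\<^sub># (add_mset (add_mset z Z) Cs) \<subseteq># M"
      proof -
        have "\<Sum>\<^sub># Cs + (Z + {#z#}) \<subseteq># N + (Z + {#x, y#})"
          by (intro subset_mset.add_mono Cs(3)) (use that in auto)
        then show ?thesis unfolding MN by (simp add: ac_simps)
      qed
      then have "\<exists>s t. residues_mod k (image_mset val (add_mset (add_mset z Z) Cs))
          = replicate_mset (k - 1) s + replicate_mset (k - 1) t \<and> s \<noteq> t"
        by (intro vals) (use blk[OF that] Z(2) p2 Cs k in auto)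
      then show ?thesis unfolding V_def by simp
    qed
    obtain s t where st: "add_mset (val (add_mset x Z) mod int k) V
        = replicate_mset (k - 1) s + replicate_mset (k - 1) t" "s \<noteq> t" using two[of x] by auto
    obtain s' t' where st': "add_mset (val (add_mset y Z) mod int k) V
        = replicate_mset (k - 1) s' + replicate_mset (k - 1) t'" "s' \<noteq> t'" using two[of y] by auto
    have "val (add_mset x Z) mod int k = val (add_mset y Z) mod int k"
      by (rule complement_two_valued[OF k _ _ _ st st']) (use k in \<open>auto simp: V_def\<close>)
    then have "int k dvd val (add_mset x Z) - val (add_mset y Z)" by (simp add: mod_eq_dvd_iff)
    then have "int p * int k dvd int p * (val (add_mset x Z) - val (add_mset y Z))" by simp
    moreover have "int p * val (add_mset x Z) = x + (\<Sum>x\<in>#Z. x)" "int p * val (add_mset y Z) = y + (\<Sum>x\<in>#Z. x)"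
      unfolding val_def using blk[of x] blk[of y] by simp_all
    ultimately show ?thesis by (simp add: cong_iff_dvd_diff right_diff_distrib)
  qed
  have const: "\<exists>d. residues_mod (p * k) (cl c) = replicate_mset (size (cl c)) d \<and> size (cl c) \<le> p * k - 1"
    if big: "size (cl c) \<ge> p + 1" for c
  proof -
    have "cl c \<noteq> {#}" using big by auto
    then obtain x where x: "x \<in># cl c" by blast
    have "y mod int (p * k) = x mod int (p * k)" if "y \<in># cl c" for y
    proof (cases "x = y")
      case False
      then have "{#x, y#} \<subseteq># cl c" using x that by (simp add: insert_subset_eq_iff in_diff_count)
      then show ?thesis using swap[OF _ big] unfolding cong_def by simp
    qed simp
    then have "residues_mod (p * k) (cl c) = image_mset (\<lambda>_. x mod int (p * k)) (cl c)"
      by (intro image_mset_cong)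
    then have eq: "residues_mod (p * k) (cl c) = replicate_mset (size (cl c)) (x mod int (p * k))"
      by (simp add: image_mset_const_eq)
    have "\<not> block_in (p * k) (cl c)"
      using noblock zero_sum_sub_mono[of "p * k" "p * k" "\<lambda>x. x" "cl c" M] unfolding cl_def by auto
    then have "size (cl c) < p * k"
      using count_res_ge_imp_block[of "p * k" "cl c" "x mod int (p * k)"] eq by fastforce
    then show ?thesis using eq by auto
  qed
  have sizes: "size (cl a) + size (cl b) + 2 = 2 * (p * k)" using size M_cl by (metis size_union)
  \<comment> \<open>A class with more than \<open>p\<close> terms has at most
    \<open>p * k - 1\<close> of them, which leaves at least \<open>p * k - 1 \<ge> p + 1\<close> for
    the other; two smaller classes would be too short together.\<close>
  have big: "size (cl a) \<ge> p + 1" "size (cl b) \<ge> p + 1"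
    using const[of a] const[of b] sizes pk by force+
  obtain d e where de: "residues_mod (p * k) (cl a) = replicate_mset (size (cl a)) d" "size (cl a) \<le> p * k - 1"
     "residues_mod (p * k) (cl b) = replicate_mset (size (cl b)) e" "size (cl b) \<le> p * k - 1"
    using const big by blast
  have "size (cl a) = p * k - 1" "size (cl b) = p * k - 1" using sizes de(2,4) pk by linarith+
  moreover have "residues_mod (p * k) M = residues_mod (p * k) (cl a) + residues_mod (p * k) (cl b)"
    by (subst M_cl) (rule image_mset_union)
  ultimately show "\<exists>a b. residues_mod (p * k) M = replicate_mset (p * k - 1) a + replicate_mset (p * k - 1) b"
    using de by auto
qed

theorem inverse_EGZ:
  assumes "m \<ge> 2" shows "inverse_EGZ m"
  using assms
proof (induction m rule: less_induct)
  case (less m)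
  obtain p where p: "Factorial_Ring.prime p" "p dvd m"
    using prime_factor_nat[of m] less.prems by auto
  then obtain k where k: "m = p * k" by (auto elim: dvdE)
  have "k > 0" using k less.prems by (cases k) auto
  show ?case
  proof (cases "k = 1")
    case True
    then show ?thesis using inverse_EGZ_prime[OF p(1)] k by simp
  next
    case False
    then have "k \<ge> 2" using \<open>k > 0\<close> by simp
    moreover have "k < m" using k prime_gt_1_nat[OF p(1)] \<open>k > 0\<close> by simp
    ultimately show ?thesis using less.IH inverse_EGZ_mult[OF p(1)] k by simp
  qed
qed

section \<open>Extremal sequences modulo \<open>m\<close> for zero sums of length \<open>m\<close>
  or \<open>2 m\<close>\<close>

lemma cong_sum_res: "[(\<Sum>x\<in>#U. x) = (\<Sum>x\<in>#residues_mod m U. x)] (mod int m)"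
proof (induction U)
  case (add x U)
  have "[x + (\<Sum>x\<in>#U. x) = x mod int m + (\<Sum>x\<in>#residues_mod m U. x)] (mod int m)"
    by (intro cong_add add.IH) (simp add: cong_def)
  then show ?case by simp
qed simp

text \<open>A selection with \<open>j\<close> terms of residue \<open>b\<close> has sum
  \<open>L * a - (a - b) * j\<close>, so \<open>m\<close> would divide \<open>j\<close>. But
  \<open>L\<close> terms need at least one \<open>b\<close>, and only \<open>m - 1\<close> are
  available.\<close>

lemma extremal_no_zero_sum:
  assumes "residues_mod m A = replicate_mset (L - 1) a + replicate_mset (m - 1) b"
    and "coprime (a - b) (int m)" "m dvd L" "L > 0"
  shows "\<not> zero_sum_sub m L (\<lambda>x. x) A"
proof
  assume "zero_sum_sub m L (\<lambda>x. x) A"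
  then obtain U where U: "U \<subseteq># A" "size U = L" "int m dvd (\<Sum>x\<in>#U. x)"
    unfolding zero_sum_sub_def by blast
  have "residues_mod m U \<subseteq># replicate_mset (L - 1) a + replicate_mset (m - 1) b"
    using image_mset_subseteq_mono[OF U(1)] unfolding assms(1)[symmetric] .
  then obtain i j where ij: "i \<le> L - 1" "j \<le> m - 1" "residues_mod m U = replicate_mset i a + replicate_mset j b"
    by (rule sub_replicate_two)
  have L: "i + j = L" using arg_cong[OF ij(3), of size] U(2) by simp
  have "int m dvd (\<Sum>x\<in>#residues_mod m U. x)" using cong_sum_res[of U m] U(3) cong_dvd_iff by blast
  then have "int m dvd int i * a + int j * b" unfolding ij(3) by (simp add: sum_mset_replicate_mset)
  moreover have "int i * a + int j * b = int L * a - (a - b) * int j"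
    unfolding L[symmetric] by (simp add: algebra_simps)
  moreover have "int m dvd int L * a" using assms(3) by simp
  ultimately have "int m dvd (a - b) * int j" by (metis dvd_diff_right_iff dvd_diffD dvd_diff_commute dvd_minus_iff diff_diff_eq2 dvd_diff add_diff_cancel_left')
  then have "m dvd j" using assms(2) by (metis coprime_commute coprime_dvd_mult_right_iff int_dvd_int_iff)
  then show False using ij(1,2) L assms(4) by (auto dest: dvd_imp_le)
qed

text \<open>For \<open>L = 2 * m\<close> two disjoint blocks would form a zero sum of length
  \<open>L\<close>, so \<open>inverse_EGZ_disjoint_blocks\<close> applies.\<close>

lemma extremal_abelian:
  assumes m: "m \<ge> 2" and L: "L = m \<or> L = 2 * m" and size: "size A + 2 = L + m"
    and noz: "\<not> zero_sum_sub m L (\<lambda>x. x) A"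
  obtains a b where "residues_mod m A = replicate_mset (L - 1) a + replicate_mset (m - 1) b"
    "coprime (a - b) (int m)"
proof -
  have "\<exists>a b. residues_mod m A = replicate_mset (L - 1) a + replicate_mset (m - 1) b"
  proof (cases "L = m")
    case True
    then show ?thesis using inverse_EGZ[OF m] size noz unfolding inverse_EGZ_def by simp
  next
    case False
    then have L: "L = 2 * m" using L by simp
    have "\<not> block_in m (A - U)" if U: "U \<subseteq># A" "size U = m" "int m dvd (\<Sum>x\<in>#U. x)" for U
    proof
      assume "block_in m (A - U)"
      then obtain V where V: "V \<subseteq># A - U" "size V = m" "int m dvd (\<Sum>x\<in>#V. x)"
        unfolding zero_sum_sub_def by blast
      have "V + U \<subseteq># A - U + U" using V(1) by (rule subset_mset.add_right_mono)
      then have "V + U \<subseteq># A" unfolding subset_mset.diff_add[OF U(1)] .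
      moreover have "int m dvd (\<Sum>x\<in>#V + U. x)" using U(3) V(3) by simp
      ultimately show False using noz U(2) V(2) L unfolding zero_sum_sub_def
        by (metis mult_2 size_union)
    qed
    then obtain a b where "residues_mod m A = replicate_mset (2 * m - 1) a + replicate_mset (m - 1) b"
      using inverse_EGZ_disjoint_blocks[OF m inverse_EGZ[OF m], of A] size L by auto
    then show ?thesis using L by blast
  qed
  then obtain a b where ab: "residues_mod m A = replicate_mset (L - 1) a + replicate_mset (m - 1) b" by blast
  have "coprime (a - b) (int m)"
  proof (rule ccontr)
    assume ncop: "\<not> ?thesis"
    \<comment> \<open>For \<open>g > 1\<close>, exchanging \<open>k = m / g\<close> copies of
      \<open>a\<close> for \<open>b\<close> changes the sum by a multiple of \<open>m\<close>; since
      \<open>2 * k \<le> m\<close>, enough copies of \<open>b\<close> exist.\<close>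
    define g where "g = nat (gcd (a - b) (int m))"
    have g: "int g = gcd (a - b) (int m)" unfolding g_def by simp
    have "g dvd m" using g by (metis gcd_dvd2 int_dvd_int_iff)
    then obtain k where k: "m = g * k" by blast
    have "g \<noteq> 1" using g ncop by (auto simp: coprime_iff_gcd_eq_1)
    have "k > 0" "g > 0" using k m by (auto intro: Nat.gr0I)
    then have "g \<ge> 2" using \<open>g \<noteq> 1\<close> by simp
    then have "2 * k \<le> m" using k by simp
    then have "k \<le> m - 1" "L - k \<le> L - 1" "k \<le> L" using \<open>k > 0\<close> L m by auto
    then have "replicate_mset (L - k) a + replicate_mset k b \<subseteq># residues_mod m A" unfolding ab
      by (intro subset_mset.add_mono) (simp_all add: count_le_replicate_mset_subset_eq[symmetric])
    then obtain U where U: "U \<subseteq># A" "residues_mod m U = replicate_mset (L - k) a + replicate_mset k b"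
      by (rule sub_mset_image_mset)
    have sizeU: "size U = L" using arg_cong[OF U(2), of size] \<open>k \<le> L\<close> by simp
    have "(\<Sum>x\<in>#residues_mod m U. x) = int (L - k) * a + int k * b" unfolding U(2) by (simp add: sum_mset_replicate_mset)
    also have "\<dots> = int L * a - int k * (a - b)" using \<open>k \<le> L\<close> by (simp add: of_nat_diff algebra_simps)
    finally have eq: "(\<Sum>x\<in>#residues_mod m U. x) = int L * a - int k * (a - b)" .
    have "int g dvd a - b" using g by simp
    then have "int m dvd int k * (a - b)" unfolding k by (simp add: mult.commute)
    moreover have "int m dvd int L * a" using L by auto
    ultimately have "int m dvd (\<Sum>x\<in>#residues_mod m U. x)" unfolding eq by (rule dvd_diff[rotated])
    then have "int m dvd (\<Sum>x\<in>#U. x)" using cong_sum_res[of U m] cong_dvd_iff by blast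
    then show False using noz U(1) sizeU unfolding zero_sum_sub_def by blast
  qed
  then show ?thesis using that ab by blast
qed

section \<open>Signed zero sums\<close>

text \<open>The target \<open>d\<close> will be minus the contribution of two chosen terms
  \<open>\<alpha>^b \<tau>\<close>, which is why the length \<open>L - 2\<close> occurs
  below.\<close>

definition signed_sub :: "nat \<Rightarrow> nat \<Rightarrow> int \<Rightarrow> int multiset \<Rightarrow> bool" where
  "signed_sub m k d A \<longleftrightarrow> (\<exists>U V. U + V \<subseteq># A \<and> size U + size V = k \<and>
     int m dvd (\<Sum>x\<in>#U. x) - (\<Sum>x\<in>#V. x) - d)"

lemma signed_subI:
  assumes "V \<subseteq># W" "W \<subseteq># A" "size W = k" "int m dvd (\<Sum>x\<in>#W. x) - 2 * (\<Sum>x\<in>#V. x) - d"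
  shows "signed_sub m k d A"
proof -
  have W: "W = (W - V) + V" using assms(1) by simp
  then have "(\<Sum>x\<in>#W. x) = (\<Sum>x\<in>#W - V. x) + (\<Sum>x\<in>#V. x)"
    by (metis image_mset_union sum_mset.union)
  moreover have "size (W - V) + size V = k" using W assms(3) by (metis size_union)
  ultimately show ?thesis unfolding signed_sub_def using assms(2,4) W
    by (intro exI[of _ "W - V"] exI[of _ V]) (simp add: algebra_simps)
qed

text \<open>Flipping the signs on \<open>V\<close> changes the sum by twice the sum of
  \<open>V\<close>; once the parity is right, residues modulo \<open>n\<close> control the signed
  sum modulo \<open>2 * n\<close>.\<close>

lemma signed_sub_all_residues:
  assumes "all_residues n (\<lambda>x. x) F" "F \<subseteq># W" "W \<subseteq># A" "size W = k" "even ((\<Sum>x\<in>#W. x) - d)"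
  shows "signed_sub (2 * n) k d A"
proof -
  obtain r where r: "(\<Sum>x\<in>#W. x) - d = 2 * r" using assms(5) by blast
  obtain V where V: "V \<subseteq># F" "int n dvd (\<Sum>x\<in>#V. x) - r" using assms(1) unfolding all_residues_def by blast
  have "2 * int n dvd 2 * ((\<Sum>x\<in>#V. x) - r)" using V(2) by (rule mult_dvd_mono[OF dvd_refl])
  then have "int (2 * n) dvd 2 * ((\<Sum>x\<in>#V. x) - r)" by simp
  then have "int (2 * n) dvd - (2 * ((\<Sum>x\<in>#V. x) - r))" by (subst dvd_minus_iff)
  moreover have "- (2 * ((\<Sum>x\<in>#V. x) - r)) = (\<Sum>x\<in>#W. x) - 2 * (\<Sum>x\<in>#V. x) - d" using r by simp
  ultimately have "int (2 * n) dvd (\<Sum>x\<in>#W. x) - 2 * (\<Sum>x\<in>#V. x) - d" by metis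
  then show ?thesis using V(1) assms(2-4) by (intro signed_subI[of V W]) auto
qed

text \<open>One of \<open>u\<close> and \<open>v\<close> gives the sum the parity of
  \<open>d\<close>, while \<open>F\<close> stays inside the common part \<open>W\<close>.\<close>

lemma signed_sub_parity_switch:
  assumes "all_residues n (\<lambda>x. x) F" "F \<subseteq># W" "add_mset u W \<subseteq># A" "add_mset v W \<subseteq># A"
    "size W + 1 = k" "odd (u - v)"
  shows "signed_sub (2 * n) k d A"
proof (cases "even ((\<Sum>x\<in>#add_mset u W. x) - d)")
  case True
  then show ?thesis using assms subset_mset.order_trans[OF assms(2), of "add_mset u W"]
    by (intro signed_sub_all_residues[of n F "add_mset u W"]) auto
next
  case False
  then have "even ((\<Sum>x\<in>#add_mset v W. x) - d)" using assms(6) by auto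
  then show ?thesis using assms subset_mset.order_trans[OF assms(2), of "add_mset v W"]
    by (intro signed_sub_all_residues[of n F "add_mset v W"]) auto
qed

text \<open>On a residue class modulo \<open>q\<close> only the quotients
  \<open>(x - c) div q\<close> modulo \<open>k\<close> matter, so \<open>L + k - 1\<close> terms do
  the work of \<open>L + q * k - 1\<close>; the constants contribute \<open>L * c\<close>, a
  multiple of \<open>q * k\<close>.\<close>

lemma residue_class_zero_sum:
  assumes "\<And>x. x \<in># B \<Longrightarrow> [x = c] (mod int q)" and "q * k dvd L" "k > 0" "L + k \<le> size B + 1"
  shows "zero_sum_sub (q * k) L (\<lambda>x. x) B"
proof -
  have "k dvd L" using assms(2) dvd_mult_right by blast
  then obtain U where U: "U \<subseteq># B" "size U = L" "int k dvd (\<Sum>x\<in>#U. (x - c) div int q)"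
    using EGZ[OF assms(3) _ assms(4), of "\<lambda>x. (x - c) div int q"] unfolding zero_sum_sub_def by blast
  have "(\<Sum>x\<in>#U. x) = int (size U) * c + int q * (\<Sum>x\<in>#U. (x - c) div int q)"
    if "\<And>x. x \<in># U \<Longrightarrow> [x = c] (mod int q)" for U
    using that
  proof (induction U)
    case (add x U)
    have "int q dvd x - c" using add.prems[of x] by (simp add: cong_iff_dvd_diff)
    then have "x = c + int q * ((x - c) div int q)" by simp
    then show ?case using add by (simp add: algebra_simps)
  qed simp
  then have "(\<Sum>x\<in>#U. x) = int L * c + int q * (\<Sum>x\<in>#U. (x - c) div int q)"
    using U assms(1) mset_subset_eqD by metis
  moreover have "int (q * k) dvd int L * c" using assms(2) by (metis dvd_mult2 int_dvd_int_iff)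
  moreover have "int (q * k) dvd int q * (\<Sum>x\<in>#U. (x - c) div int q)" using U(3) by simp
  ultimately show ?thesis unfolding zero_sum_sub_def using U(1,2)
    by (intro exI[of _ U]) (simp only: dvd_add simp_thms)
qed

lemma size_filter_complement:
  "size (filter_mset P M) + size (filter_mset (\<lambda>x. \<not> P x) M) = size M"
  by (metis multiset_partition size_union)

lemma sum_mset_parity:
  "(\<And>x. x \<in># B \<Longrightarrow> even (x::int)) \<Longrightarrow> even (\<Sum>x\<in>#B. x)"
  by (rule dvd_sum_mset)

text \<open>Flipping signs moves a sum by even amounts only, so once the terms are spread over all proper
  subgroups the parity of \<open>d\<close> is the remaining obstacle. The delicate cases are a single odd term, which
  must be left out if \<open>d\<close> is even, and exactly \<open>n - 1\<close> terms that are not divisible by \<open>n\<close>, where two terms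
  differing by an odd multiple of \<open>n\<close> replace a missing sign.\<close>

theorem zero_sum_or_signed_sub:
  assumes "n \<ge> 2" "2 * n dvd L" "L > 0" "L + n \<le> size A + 1"
  shows "zero_sum_sub (2 * n) L (\<lambda>x. x) A \<or> signed_sub (2 * n) (L - 2) d A"
  using assms
proof (induction n arbitrary: A d rule: less_induct)
  case (less n)
  note n2 = less.prems(1) and dvdL = less.prems(2) and sizeA = less.prems(4)
  have L2n: "L \<ge> 2 * n" using dvdL less.prems(3) by (rule dvd_imp_le)
  define out where "out q B = size (filter_mset (\<lambda>x. \<not> int q dvd x) B)" for q and B :: "int multiset"
  show ?case
  proof (subst disj_commute, rule disjCI)
    assume noz: "\<not> zero_sum_sub (2 * n) L (\<lambda>x. x) A"
    \<comment> \<open>If few terms lie outside the multiples of \<open>q\<close>, the multiples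
      alone contain a zero sum of length \<open>L\<close>. This is the source of every lower bound
      on \<open>out q A\<close>.\<close>
    have inside: False if "q * k = 2 * n" "k > 0" "L + k + out q A \<le> size A + 1" for q k
    proof -
      define B where "B = filter_mset (\<lambda>x. int q dvd x) A"
      have "size B + out q A = size A" unfolding B_def out_def by (rule size_filter_complement)
      then have "zero_sum_sub (q * k) L (\<lambda>x. x) B"
        using that dvdL by (intro residue_class_zero_sum[where c = 0]) (auto simp: B_def cong_0_iff)
      then show False using noz zero_sum_sub_mono[of "2 * n" L "\<lambda>x. x" B A] that(1)
        unfolding B_def by simp
    qed
    \<comment> \<open>For \<open>n = q * k\<close> the inequality
      \<open>(q - 2) * (k - 1) \<ge> 0\<close> makes \<open>inside\<close> applicable if the bound
      fails.\<close>
    have spreadA: "q \<le> out q A + 1" if "q dvd n" "q \<ge> 2" for q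
    proof (rule ccontr)
      assume "\<not> ?thesis"
      then have o: "out q A + 2 \<le> q" by simp
      from that(1) obtain k where k: "n = q * k" by blast
      have "k > 0" using k n2 by (cases k) auto
      moreover obtain q' where "q = q' + 2" using le_Suc_ex[OF \<open>q \<ge> 2\<close>] by (metis add.commute)
      moreover obtain k' where "k = k' + 1" using \<open>k > 0\<close> by (metis Suc_eq_plus1 gr0_implies_Suc)
      ultimately have "q + 2 * k \<le> n + 2" unfolding k by (simp add: algebra_simps)
      then have "L + 2 * k + out q A \<le> size A + 1" using o sizeA by linarith
      then show False using inside[of q "2 * k"] k \<open>k > 0\<close> by simp
    qed
    \<comment> \<open>For \<open>2 < q < n\<close> the product \<open>(q - 2) * (k - 1)\<close> is
      positive, which gains one more term. The excluded values \<open>2\<close> and \<open>n\<close>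
      lead to the two delicate cases.\<close>
    have spreadA': "q \<le> out q A" if "q dvd n" "q \<ge> 2" "q \<noteq> 2" "q \<noteq> n" for q
    proof (rule ccontr)
      assume "\<not> ?thesis"
      then have o: "out q A + 1 \<le> q" by simp
      from that(1) obtain k where k: "n = q * k" by blast
      have "k \<noteq> 0" using k n2 by (cases k) auto
      moreover have "k \<noteq> 1" using k that(4) by auto
      ultimately have "k \<ge> 2" by simp
      moreover have "q \<ge> 3" using that(2,3) by simp
      ultimately obtain q' k' where "q = q' + 3" "k = k' + 2" by (metis add.commute le_Suc_ex)
      then have "q + 2 * k \<le> n + 1" unfolding k by (simp add: algebra_simps)
      then have "L + 2 * k + out q A \<le> size A + 1" using o sizeA by linarith
      then show False using inside[of q "2 * k"] k \<open>k \<ge> 2\<close> by simp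
    qed
    have not_const: "\<exists>x. x \<in># A \<and> odd (x - c)" for c
    proof (rule ccontr)
      assume "\<not> ?thesis"
      then have "zero_sum_sub (2 * n) L (\<lambda>x. x) A"
        using dvdL n2 sizeA by (intro residue_class_zero_sum[where c = c]) (auto simp: cong_iff_dvd_diff)
      then show False using noz by blast
    qed
    have spreadD: "\<exists>F. F \<subseteq># D \<and> all_residues n (\<lambda>x. x) F \<and> size F + 1 \<le> n"
      if "\<And>q. q dvd n \<Longrightarrow> q \<ge> 2 \<Longrightarrow> q \<le> out q D + 1" for D
      using spread_imp_all_residues[of n "\<lambda>x. x" D] that n2 unfolding spread_def out_def by auto
    have special: "signed_sub (2 * n) (L - 2) d A" if "even n" "n \<noteq> 2" "out 2 A = 1"
    proof -
      have n4: "n \<ge> 4" using that n2 by presburger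
      from that(3) obtain w where w: "filter_mset (\<lambda>x. \<not> int 2 dvd x) A = {#w#}"
        using size_1_singleton_mset unfolding out_def by blast
      define A' where "A' = filter_mset (\<lambda>x. int 2 dvd x) A"
      have A: "A = add_mset w A'"
        using multiset_partition[of A "\<lambda>x. int 2 dvd x"] unfolding A'_def w by simp
      have "w \<in># filter_mset (\<lambda>x. \<not> int 2 dvd x) A" unfolding w by simp
      then have odd_w: "odd w" by simp
      have A'_even: "even x" if "x \<in># A'" for x using that unfolding A'_def by simp
      show ?thesis
      proof (cases "even d")
        case False
        obtain F where F: "F \<subseteq># A" "all_residues n (\<lambda>x. x) F" "size F + 1 \<le> n"
          using spreadD[of A] spreadA by auto
        have F': "F - {#w#} \<subseteq># A'" using F(1) unfolding A by (simp add: subset_eq_diff_conv)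
        moreover have "size (F - {#w#}) \<le> L - 3" "L - 3 \<le> size A'"
          using size_Diff1_le[of F w] F(3) L2n n2 sizeA A by auto
        ultimately obtain W where W: "F - {#w#} \<subseteq># W" "W \<subseteq># A'" "size W = L - 3"
          by (rule ex_sub_mset_between)
        have "F \<subseteq># add_mset w W" using W(1) by (simp add: subset_eq_diff_conv)
        moreover have "add_mset w W \<subseteq># A" using W(2) unfolding A by simp
        moreover have "size (add_mset w W) = L - 2" using W(3) L2n n2 by simp
        moreover have "even (\<Sum>x\<in>#W. x)"
          using W(2) A'_even by (intro sum_mset_parity) (meson mset_subset_eqD)
        then have "even ((\<Sum>x\<in>#add_mset w W. x) - d)" using odd_w False by simp
        ultimately show ?thesis using signed_sub_all_residues[OF F(2)] by blast
      next
        case True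
        \<comment> \<open>Without the odd term everything, including \<open>d\<close>, can be
          halved, and the claim for \<open>n / 2\<close> applies.\<close>
        from that(1) obtain k where k: "n = 2 * k" by blast
        define H where "H = image_mset (\<lambda>x. x div 2) A'"
        have A'H: "A' = image_mset (\<lambda>x. 2 * x) H"
        proof -
          have "image_mset (\<lambda>x. 2 * (x div 2)) A' = image_mset (\<lambda>x. x) A'"
            using A'_even by (intro image_mset_cong) simp
          then show ?thesis unfolding H_def by (simp add: multiset.map_comp comp_def)
        qed
        have sub: "image_mset (\<lambda>x. 2 * x) U \<subseteq># A" if "U \<subseteq># H" for U
          using image_mset_subseteq_mono[OF that, of "\<lambda>x. 2 * x"] unfolding A'H[symmetric] A
          by (metis mset_subset_eq_add_right add_mset_add_single subset_mset.order_trans mset_subset_eq_add_left)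
        have sum2: "(\<Sum>x\<in>#image_mset (\<lambda>x. 2 * x) U. x) = 2 * (\<Sum>x\<in>#U. x)" for U :: "int multiset"
          by (induction U) auto
        have "zero_sum_sub (2 * k) L (\<lambda>x. x) H \<or> signed_sub (2 * k) (L - 2) (d div 2) H"
        proof (rule less.IH)
          show "2 * k dvd L" using dvdL k by (metis dvd_mult_right)
          show "L + k \<le> size H + 1" using sizeA A k n4 unfolding H_def by simp
        qed (use k n4 less.prems(3) in auto)
        then show ?thesis
        proof
          assume "zero_sum_sub (2 * k) L (\<lambda>x. x) H"
          then obtain U where U: "U \<subseteq># H" "size U = L" "int (2 * k) dvd (\<Sum>x\<in>#U. x)"
            unfolding zero_sum_sub_def by blast
          have "2 * int (2 * k) dvd 2 * (\<Sum>x\<in>#U. x)" using U(3) by (rule mult_dvd_mono[OF dvd_refl])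
          then have "zero_sum_sub (2 * n) L (\<lambda>x. x) A" unfolding zero_sum_sub_def
            using sub[OF U(1)] U(2) sum2[of U] k
            by (intro exI[of _ "image_mset (\<lambda>x. 2 * x) U"]) auto
          then show ?thesis using noz by blast
        next
          assume "signed_sub (2 * k) (L - 2) (d div 2) H"
          then obtain U V where UV: "U + V \<subseteq># H" "size U + size V = L - 2"
            "int (2 * k) dvd (\<Sum>x\<in>#U. x) - (\<Sum>x\<in>#V. x) - d div 2"
            unfolding signed_sub_def by blast
          have "2 * int (2 * k) dvd 2 * ((\<Sum>x\<in>#U. x) - (\<Sum>x\<in>#V. x) - d div 2)"
            using UV(3) by (rule mult_dvd_mono[OF dvd_refl])
          moreover have "2 * (d div 2) = d" using True by simp
          ultimately show ?thesis unfolding signed_sub_def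
            using sub[OF UV(1)] UV(2) sum2[of U] sum2[of V] k
            by (intro exI[of _ "image_mset (\<lambda>x. 2 * x) U"] exI[of _ "image_mset (\<lambda>x. 2 * x) V"])
              (auto simp: right_diff_distrib)
        qed
      qed
    qed
    show "signed_sub (2 * n) (L - 2) d A"
    proof (cases "out n A + 1 = n")
      case nn: True
      define B Q where "B = filter_mset (\<lambda>x. int n dvd x) A" and "Q = filter_mset (\<lambda>x. \<not> int n dvd x) A"
      have A: "A = Q + B" unfolding Q_def B_def by simp
      have sizeQ: "size Q + 1 = n" using nn unfolding Q_def out_def .
      have sizeB: "L \<le> size B" using sizeA A sizeQ by simp
      have B_dvd: "int n dvd x" if "x \<in># B" for x using that unfolding B_def by simp
      have outQ: "out q Q = out q A" if "q dvd n" for q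
      proof -
        have "filter_mset (\<lambda>x. \<not> int q dvd x) B = {#}"
          using B_dvd that by (intro filter_mset_emptyI) (meson dvd_trans int_dvd_int_iff)
        then show ?thesis unfolding out_def A by simp
      qed
      \<comment> \<open>If all terms of \<open>B\<close> were congruent modulo \<open>2 * n\<close>,
        any \<open>L\<close> of them would form a zero sum.\<close>
      obtain g g' where g: "{#g, g'#} \<subseteq># B" "\<not> int (2 * n) dvd g - g'"
      proof -
        have "B \<noteq> {#}" using sizeB less.prems(3) by auto
        then obtain g' where g': "g' \<in># B" by blast
        have "\<exists>g. g \<in># B \<and> \<not> [g = g'] (mod int (2 * n))"
        proof (rule ccontr)
          assume "\<not> ?thesis"
          then have "zero_sum_sub (2 * n) L (\<lambda>x. x) B"
            by (intro const_imp_zero_sum_sub[where c = g']) (use dvdL sizeB in auto)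
          then show False using noz zero_sum_sub_mono[of "2 * n" L "\<lambda>x. x" B A] A by simp
        qed
        then obtain g where gB: "g \<in># B" "\<not> [g = g'] (mod int (2 * n))" by blast
        then have "g \<noteq> g'" by auto
        then have "{#g, g'#} \<subseteq># B" using gB(1) g' by (simp add: insert_subset_eq_iff in_diff_count)
        then show ?thesis using that gB(2) by (simp add: cong_iff_dvd_diff)
      qed
      have gB: "g \<in># B" "g' \<in># B" using g(1) by (auto dest: mset_subset_eqD)
      obtain s where s: "g - g' = int n * s" "odd s"
      proof -
        have "int n dvd g - g'" using B_dvd gB by (intro dvd_diff)
        then obtain s where "g - g' = int n * s" by blast
        moreover have "odd s" using g(2) calculation by auto
        ultimately show ?thesis using that by blast
      qed
      define B' where "B' = B - {#g, g'#}"
      have B': "B = B' + {#g, g'#}" unfolding B'_def by (rule subset_mset.diff_add[OF g(1), symmetric])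
      show ?thesis
      proof (cases "odd n")
        case True
        obtain F where F: "F \<subseteq># Q" "all_residues n (\<lambda>x. x) F" "size F + 1 \<le> n"
          using spreadD[of Q] spreadA outQ by auto
        have "F \<subseteq># Q + B'" using F(1) by (simp add: subset_mset.add_increasing2)
        moreover have "size F \<le> L - 3" "L - 3 \<le> size (Q + B')"
          using F(3) L2n n2 sizeQ sizeB B' by auto
        ultimately obtain W where W: "F \<subseteq># W" "W \<subseteq># Q + B'" "size W = L - 3"
          by (rule ex_sub_mset_between)
        have "W + {#g#} \<subseteq># Q + B' + {#g, g'#}" "W + {#g'#} \<subseteq># Q + B' + {#g, g'#}"
          by (intro subset_mset.add_mono W; simp)+
        then have "add_mset g W \<subseteq># A" "add_mset g' W \<subseteq># A" unfolding A B' by (simp_all add: add.assoc)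
        moreover have "odd (g - g')" using s True by simp
        moreover have "size W + 1 = L - 2" using W(3) L2n n2 by simp
        ultimately show ?thesis using signed_sub_parity_switch[OF F(2) W(1)] by blast
      next
        case False
        have B_even: "even x" if "x \<in># B" for x
          using B_dvd[OF that] False dvd_trans[of 2 "int n" x] by simp
        show ?thesis
        proof (cases "even ((\<Sum>x\<in>#Q. x) - d)")
          case True
          obtain F where F: "F \<subseteq># Q" "all_residues n (\<lambda>x. x) F"
            using spreadD[of Q] spreadA outQ by auto
          obtain V where V: "V \<subseteq># B" "size V = L - 2 - size Q"
          proof -
            have "L - 2 - size Q \<le> size B" using sizeB by simp
            then show ?thesis using ex_sub_mset_size that by blast
          qed
          have "even (\<Sum>x\<in>#V. x)" using V(1) B_even by (intro sum_mset_parity) (meson mset_subset_eqD)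
          then have "even ((\<Sum>x\<in>#Q + V. x) - d)" using True by simp
          moreover have "size (Q + V) = L - 2" using V(2) sizeQ L2n n2 by simp
          moreover have "Q + V \<subseteq># A" unfolding A using V(1) by simp
          moreover have "F \<subseteq># Q + V" using F(1) by (simp add: subset_mset.add_increasing2)
          ultimately show ?thesis using signed_sub_all_residues[OF F(2)] by blast
        next
          case odd_d: False
          obtain w where w: "w \<in># Q" "odd w"
            using not_const[of 0] B_even A by auto
          define Q' where "Q' = Q - {#w#}"
          have Q': "Q = add_mset w Q'" unfolding Q'_def using w(1) by simp
          \<comment> \<open>A phantom term \<open>h = n / 2\<close> replaces \<open>w\<close> among
            the weights: flipping its sign would change the sum by \<open>n\<close> modulo
            \<open>2 * n\<close>, and exchanging \<open>g\<close> for \<open>g'\<close> has the same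
            effect.\<close>
          define h where "h = int n div 2"
          have h: "2 * h = int n" unfolding h_def using False by simp
          show ?thesis
          proof (cases "n \<noteq> 2 \<and> out 2 A = 1")
            case True
            then show ?thesis using special False by blast
          next
            case no2: False
            obtain F where F: "F \<subseteq># add_mset h Q'" "all_residues n (\<lambda>x. x) F"
            proof -
              have "q \<le> out q (add_mset h Q') + 1" if q: "q dvd n" "q \<ge> 2" for q
              proof (cases "q = n")
                case True
                have "\<not> int n dvd h"
                proof
                  assume "int n dvd h"
                  then have "int n \<le> h" using h n2 by (intro zdvd_imp_le) auto
                  then show False using h n2 by simp
                qed
                moreover have "\<not> int n dvd x" if "x \<in># Q'" for x
                proof -
                  have "x \<in># Q" using that unfolding Q' by simp
                  then show ?thesis unfolding Q_def by simp
                qed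
                then have "filter_mset (\<lambda>x. \<not> int n dvd x) Q' = Q'" by (intro filter_mset_allI)
                ultimately have "out n (add_mset h Q') = size Q' + 1" unfolding out_def by simp
                then show ?thesis using sizeQ Q' True by simp
              next
                case False
                then have "q \<le> out q Q" using spreadA'[of q] q spreadA[of q] no2 outQ[of q] by fastforce
                then have "q \<le> out q Q' + 1" unfolding Q' out_def by (auto split: if_splits)
                then show ?thesis unfolding out_def by (auto split: if_splits)
              qed
              then show ?thesis using spreadD that by blast
            qed
            obtain V where V: "V \<subseteq># B'" "size V = L - 3 - size Q'"
            proof -
              have "L - 3 - size Q' \<le> size B'" using sizeB B' by simp
              then show ?thesis using ex_sub_mset_size that by blast
            qed
            define W where "W = Q' + V"
            have sizeW: "size W + 1 = L - 2" unfolding W_def using V(2) sizeQ Q' L2n n2 by simp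
            have "W + {#g#} \<subseteq># Q' + B' + {#g, g'#}" "W + {#g'#} \<subseteq># Q' + B' + {#g, g'#}"
              unfolding W_def by (intro subset_mset.add_mono V; simp)+
            then have WA: "add_mset g W \<subseteq># A" "add_mset g' W \<subseteq># A" unfolding A B' Q'
              by (auto intro: subset_mset.order_trans simp: ac_simps)
            have "even (\<Sum>x\<in>#V. x)" using V(1) B_even B' by (intro sum_mset_parity) (metis mset_subset_eqD union_iff)
            moreover have "even g" using B_even gB by blast
            moreover have "odd ((\<Sum>x\<in>#Q'. x) + w - d)" using odd_d Q' by (simp add: algebra_simps)
            ultimately have "even ((\<Sum>x\<in>#add_mset g W. x) - d)" unfolding W_def using w(2) by simp
            then obtain r where r: "(\<Sum>x\<in>#add_mset g W. x) - d = 2 * r" by blast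
            obtain Z where Z: "Z \<subseteq># F" "int n dvd (\<Sum>x\<in>#Z. x) - r"
              using F(2) unfolding all_residues_def by blast
            obtain t where t: "(\<Sum>x\<in>#Z. x) - r = int n * t" using Z(2) by blast
            have ZQ: "Z \<subseteq># add_mset h Q'" using Z(1) F(1) by (rule subset_mset.order_trans)
            show ?thesis
            proof (cases "Z \<subseteq># Q'")
              case True
              have "Z \<subseteq># add_mset g W" unfolding W_def using True
                by (metis add_mset_add_single add.assoc subset_mset.add_increasing2 subset_mset.zero_le)
              moreover have "(\<Sum>x\<in>#add_mset g W. x) - 2 * (\<Sum>x\<in>#Z. x) - d = int (2 * n) * (- t)"
                using r t by (simp add: algebra_simps)
              ultimately show ?thesis using WA(1) sizeW
                by (intro signed_subI[of Z "add_mset g W"]) auto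
            next
              case False
              have "h \<in># Z"
              proof (rule ccontr)
                assume "h \<notin># Z"
                then show False using False ZQ by (metis add_mset_add_single diff_single_trivial subset_eq_diff_conv)
              qed
              then obtain Z' where Z': "Z = add_mset h Z'" by (metis insert_DiffM)
              have "Z' \<subseteq># Q'" using ZQ Z' by simp
              then have "Z' \<subseteq># add_mset g' W" unfolding W_def
                by (metis add_mset_add_single add.assoc subset_mset.add_increasing2 subset_mset.zero_le)
              moreover obtain u where "s = 2 * u + 1" using s(2) by (elim oddE)
              then have "(\<Sum>x\<in>#add_mset g' W. x) - 2 * (\<Sum>x\<in>#Z'. x) - d = int (2 * n) * (- t - u)"
                using r t s(1) h Z' by (simp add: algebra_simps)
              ultimately show ?thesis using WA(2) sizeW
                by (intro signed_subI[of Z' "add_mset g' W"]) auto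
            qed
          qed
        qed
      qed
    next
      case nn: False
      show ?thesis
      proof (cases "even n \<and> n \<noteq> 2 \<and> out 2 A = 1")
        case True
        then show ?thesis using special by blast
      next
        case no2: False
        \<comment> \<open>With both delicate cases excluded there is one term to spare at every
          divisor, so \<open>w\<close> can be taken away without losing the spread.\<close>
        have strong: "q \<le> out q A" if "q dvd n" "q \<ge> 2" for q
          using spreadA'[OF that] spreadA[OF that] nn no2 that by fastforce
        define par where "par b = filter_mset (\<lambda>x. even x = b) A" for b
        have "par False = filter_mset (\<lambda>x. \<not> (even x = True)) A" unfolding par_def by simp
        then have sizes: "size (par True) + size (par False) = size A"
          using size_filter_complement[of "\<lambda>x. even x = True" A] unfolding par_def by simp
        \<comment> \<open>\<open>b\<close> is the more frequent parity. \<open>F\<close> is too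
          short to use up its terms, so some \<open>r\<close> of this parity stays free for the
          exchange with \<open>w\<close>.\<close>
        obtain b where b: "size A \<le> 2 * size (par b)"
          using sizes by (metis le_cases mult_2 add_le_mono nat_le_linear)
        obtain w where w: "w \<in># A" "even w \<noteq> b"
          using not_const[of 0] not_const[of 1] by (cases b) auto
        define A' where "A' = A - {#w#}"
        have A: "A = add_mset w A'" unfolding A'_def using w(1) by simp
        have "q \<le> out q A' + 1" if "q dvd n" "q \<ge> 2" for q
          using strong[OF that] unfolding A out_def by (auto split: if_splits)
        then obtain F where F: "F \<subseteq># A'" "all_residues n (\<lambda>x. x) F" "size F + 1 \<le> n"
          using spreadD[of A'] by blast
        have "size F < size (par b)" using b F(3) sizeA L2n by linarith
        then obtain r where r: "count F r < count (par b) r" using size_lt_imp_ex_count_lt by blast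
        then have "even r = b" unfolding par_def by (auto split: if_splits)
        then have "r \<noteq> w" using w(2) by auto
        have "count F r < count A' r" using r \<open>r \<noteq> w\<close> unfolding par_def A by (auto split: if_splits)
        then have FA: "add_mset r F \<subseteq># A'" using F(1)
          by (auto simp: subseteq_mset_def Suc_le_eq)
        define A'' where "A'' = A' - {#r#}"
        have "r \<in># A'" using FA by (auto dest: mset_subset_eqD)
        then have A': "A' = add_mset r A''" unfolding A''_def by simp
        have "F \<subseteq># A''" using FA A' by simp
        moreover have "size F \<le> L - 3" "L - 3 \<le> size A''" using F(3) L2n n2 sizeA A A' by auto
        ultimately obtain W where W: "F \<subseteq># W" "W \<subseteq># A''" "size W = L - 3"
          by (rule ex_sub_mset_between)
        have "add_mset r W \<subseteq># A" "add_mset w W \<subseteq># A" using W(2) unfolding A A'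
          by (auto intro: subset_mset.order_trans)
        moreover have "odd (r - w)" using \<open>even r = b\<close> w(2) by auto
        moreover have "size W + 1 = L - 2" using W(3) L2n n2 by simp
        ultimately show ?thesis using signed_sub_parity_switch[OF F(2) W(1)] by blast
      qed
    qed
  qed
qed

section \<open>Sequences over a dicyclic group as pairs\<close>

abbreviation tau_count :: "(bool \<times> int) multiset \<Rightarrow> nat" where
  "tau_count M \<equiv> size (filter_mset fst M)"

abbreviation alpha_part :: "(bool \<times> int) multiset \<Rightarrow> int multiset" where
  "alpha_part M \<equiv> image_mset snd (filter_mset (\<lambda>g. \<not> fst g) M)"

text \<open>The pairs \<open>(False, a)\<close> and \<open>(True, b)\<close> stand for \<open>\<alpha>\<^sup>a\<close> and \<open>\<alpha>\<^sup>b \<tau>\<close>. The exponents in \<open>U\<close> are taken with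
  sign \<open>+\<close>, those in \<open>V\<close> with sign \<open>-\<close>, and \<open>\<tau>\<^sup>2 = \<alpha>\<^sup>n\<close> contributes \<open>n\<close> for each pair of terms \<open>\<alpha>\<^sup>b \<tau>\<close>.\<close>

definition signed_product_one :: "nat \<Rightarrow> nat \<Rightarrow> (bool \<times> int) multiset \<Rightarrow> bool" where
  "signed_product_one n L M \<longleftrightarrow> zero_sum_sub (2 * n) L (\<lambda>x. x) (alpha_part M) \<or>
     (\<exists>U V. U + V \<subseteq># M \<and> size U + size V = L \<and> tau_count U = tau_count V \<and> tau_count U > 0 \<and>
        int (2 * n) dvd (\<Sum>g\<in>#U. snd g) - (\<Sum>g\<in>#V. snd g) + int n * int (tau_count U))"

type_synonym elt_pair = "(bool \<times> int) \<times> (bool \<times> int)"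

text \<open>For two powers of \<open>\<alpha>\<close> this is their contribution with opposite
  signs; for two other terms it is the exponent of their product, as
  \<open>\<alpha>^b \<tau> \<alpha>^c \<tau> = \<alpha>^(b - c + n)\<close>.\<close>

definition wt :: "nat \<Rightarrow> elt_pair \<Rightarrow> int" where
  "wt n p = snd (fst p) - snd (snd p) + (if fst (fst p) then int n else 0)"

abbreviation members :: "('b \<times> 'b) multiset \<Rightarrow> 'b multiset" where
  "members Q \<equiv> image_mset fst Q + image_mset snd Q"

lemma members_mono: "Q \<subseteq># Q' \<Longrightarrow> members Q \<subseteq># members Q'"
  by (intro subset_mset.add_mono image_mset_subseteq_mono)

text \<open>First members get sign plus and second members sign minus; as the members of a pair have
  the same type, the signs on the terms \<open>\<alpha>^b \<tau>\<close> are balanced.\<close>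

lemma signed_product_one_pairs:
  assumes "members Q \<subseteq># M" "2 * size Q = L" and "\<And>p. p \<in># Q \<Longrightarrow> fst (fst p) = fst (snd p)"
    and "p \<in># Q" "fst (fst p)" "int (2 * n) dvd (\<Sum>p\<in>#Q. wt n p)"
  shows "signed_product_one n L M"
proof -
  have "(\<Sum>p\<in>#Q. wt n p) = (\<Sum>g\<in>#image_mset fst Q. snd g) - (\<Sum>g\<in>#image_mset snd Q. snd g)
      + int n * int (tau_count (image_mset fst Q))" for Q
    by (induction Q) (auto simp: wt_def algebra_simps)
  moreover have "tau_count (image_mset fst Q) = tau_count (image_mset snd Q)"
    using assms(3) by (induction Q) auto
  moreover have "fst p \<in># filter_mset fst (image_mset fst Q)" using assms(4,5) by simp
  then have "tau_count (image_mset fst Q) > 0" by (metis empty_not_add_mset gr0I multi_member_split size_eq_0_iff_empty)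
  ultimately show ?thesis unfolding signed_product_one_def using assms(1,2,6)
    by (intro disjI2 exI[of _ "image_mset fst Q"] exI[of _ "image_mset snd Q"]) auto
qed

text \<open>A new term either finds a partner of its key in the remainder or joins the remainder, so
  no key is left over twice.\<close>

lemma pair_up:
  obtains Q R where "M = members Q + R" "\<And>p. p \<in># Q \<Longrightarrow> \<kappa> (fst p) = \<kappa> (snd p)"
    "\<And>c. count (image_mset \<kappa> R) c \<le> 1"
proof (induction M arbitrary: thesis)
  case empty
  show ?case by (rule empty[of "{#}" "{#}"]) auto
next
  case (add x M)
  obtain Q R where QR: "M = members Q + R" "\<And>p. p \<in># Q \<Longrightarrow> \<kappa> (fst p) = \<kappa> (snd p)"
    "\<And>c. count (image_mset \<kappa> R) c \<le> 1" using add.IH by blast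
  show ?case
  proof (cases "\<exists>r. r \<in># R \<and> \<kappa> r = \<kappa> x")
    case True
    then obtain r R' where r: "\<kappa> r = \<kappa> x" "R = add_mset r R'" by (metis insert_DiffM)
    show ?thesis
    proof (rule add.prems[of "add_mset (x, r) Q" R'])
      show "count (image_mset \<kappa> R') c \<le> 1" for c
        using QR(3)[of c] unfolding r(2) by (auto split: if_splits)
    qed (use QR r in auto)
  next
    case False
    show ?thesis
    proof (rule add.prems[of Q "add_mset x R"])
      show "count (image_mset \<kappa> (add_mset x R)) c \<le> 1" for c
      proof (cases "c = \<kappa> x")
        case True
        then have "c \<notin># image_mset \<kappa> R" using False by auto
        then show ?thesis using True by (simp add: count_eq_zero_iff)
      qed (use QR(3)[of c] in simp)
    qed (use QR in auto)
  qed
qed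

section \<open>Many terms \<open>\<alpha>^b \<tau>\<close>: leftover residues and exchange of
  pairs\<close>

lemma size_distinct:
  assumes "\<And>c. count Y c \<le> 1"
  shows "size Y = card (set_mset Y)"
proof -
  have "count Y c = 1" if "c \<in># Y" for c
    using assms[of c] that by (metis count_greater_eq_one_iff le_antisym)
  then show ?thesis by (simp add: size_multiset_overloaded_eq)
qed

text \<open>If \<open>x\<close> sits in a pair, its partner moves to the remainder; at most this one
  pair is lost.\<close>

lemma split_off_member:
  assumes "x \<in># members P + R"
  obtains P' R' where "P' \<subseteq># P" "size P \<le> size P' + 1" "members P + R = members P' + add_mset x R'"
proof (cases "x \<in># R")
  case True
  then show ?thesis using that[of P "R - {#x#}"] by simp
next
  case False
  then obtain e where e: "e \<in># P" "fst e = x \<or> snd e = x" using assms by auto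
  obtain P' where P': "P = add_mset e P'" using e(1) by (metis insert_DiffM)
  show ?thesis
  proof (cases "fst e = x")
    case True
    then show ?thesis using that[of P' "add_mset (snd e) R"] P' by simp
  next
    case False
    then show ?thesis using that[of P' "add_mset (fst e) R"] P' e(2) by (simp add: add_mset_commute)
  qed
qed

text \<open>\<open>Z\<close> lacks at most one residue, so it meets its shift by
  \<open>\<delta>\<close> as soon as \<open>2 * (n - 1) > n\<close>, that is, for
  \<open>n \<ge> 3\<close>.\<close>

lemma ex_difference:
  assumes "Z \<subseteq> {0..<int n}" "n \<le> card Z + 1" "n \<ge> 3"
  obtains i where "i \<in> Z" "(i + \<delta>) mod int n \<in> Z"
proof -
  have "\<exists>i\<in>Z. (i + \<delta>) mod int n \<in> Z"
  proof (rule ccontr)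
    assume none: "\<not> ?thesis"
    have fin: "finite Z" using assms(1) finite_subset by blast
    have "inj_on (\<lambda>i. (i + \<delta>) mod int n) Z"
    proof (rule inj_onI)
      fix i j assume ij: "i \<in> Z" "j \<in> Z" "(i + \<delta>) mod int n = (j + \<delta>) mod int n"
      then have "int n dvd i - j" by (simp add: mod_eq_dvd_iff)
      then have "i mod int n = j mod int n" by (simp add: mod_eq_dvd_iff)
      moreover have "i \<in> {0..<int n}" "j \<in> {0..<int n}" using ij assms(1) by blast+
      ultimately show "i = j" by simp
    qed
    then have "card Z = card ((\<lambda>i. (i + \<delta>) mod int n) ` Z)" by (simp add: card_image)
    also have "\<dots> \<le> card ({0..<int n} - Z)" using none assms(3) by (intro card_mono) auto
    also have "\<dots> = n - card Z" using assms(1) fin by (simp add: card_Diff_subset)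
    finally show False using assms(2,3) by linarith
  qed
  then show ?thesis using that by blast
qed

text \<open>Both summands are odd multiples of \<open>n\<close>.\<close>

lemma dvd_double_add:
  fixes a b :: int
  assumes "int n dvd a" "int n dvd b" "\<not> int (2 * n) dvd a" "\<not> int (2 * n) dvd b"
  shows "int (2 * n) dvd a + b"
proof -
  obtain s t where st: "a = int n * s" "b = int n * t" using assms(1,2) by blast
  have "odd s" "odd t" using assms(3,4) unfolding st by auto
  then have "2 dvd s + t" by simp
  then show ?thesis unfolding st by (metis distrib_left mult_dvd_mono dvd_refl of_nat_mult mult.commute of_nat_numeral)
qed

lemma sum_wt_dvd:
  assumes "\<And>p. p \<in># Q \<Longrightarrow> int n dvd wt n p"
  shows "int n dvd (\<Sum>p\<in>#Q. wt n p)"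
  using assms by (rule dvd_sum_mset)

lemma sum_wt_const:
  assumes "\<And>p. p \<in># Q \<Longrightarrow> int (2 * n) dvd wt n p - c" "int n dvd c" "even (size Q)"
  shows "int (2 * n) dvd (\<Sum>p\<in>#Q. wt n p)"
proof -
  have "[(\<Sum>p\<in>#Q. wt n p) = int (size Q) * c] (mod int (2 * n))"
    by (rule sum_mset_cong_const) (use assms(1) in \<open>auto simp: cong_iff_dvd_diff\<close>)
  moreover obtain k where "size Q = 2 * k" using assms(3) by blast
  ultimately show ?thesis using assms(2) by (simp add: cong_dvd_iff mult.assoc)
qed

text \<open>Exchanging one pair of a selection for a pair of the other type toggles its weight
  between \<open>0\<close> and \<open>n\<close> modulo \<open>2 n\<close>.\<close>

lemma signed_product_one_pairs_switch:
  assumes "members (add_mset e Q) \<subseteq># M" "members (add_mset e' Q) \<subseteq># M" "2 * size Q + 2 = L"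
    and "\<And>p. p \<in># add_mset e (add_mset e' Q) \<Longrightarrow> fst (fst p) = fst (snd p)"
    and "t \<in># Q" "fst (fst t)" "int n dvd (\<Sum>p\<in>#Q. wt n p)" "int n dvd wt n e" "int n dvd wt n e'"
    and "\<not> int (2 * n) dvd wt n e - wt n e'"
  shows "signed_product_one n L M"
proof (cases "int (2 * n) dvd (\<Sum>p\<in>#add_mset e Q. wt n p)")
  case True
  then show ?thesis using assms by (intro signed_product_one_pairs[of "add_mset e Q" M L t n]) auto
next
  case False
  have "\<not> int (2 * n) dvd wt n e' - wt n e" using assms(10) dvd_diff_commute by blast
  then have "int (2 * n) dvd (\<Sum>p\<in>#add_mset e Q. wt n p) + (wt n e' - wt n e)"
    using False assms(7-9) by (intro dvd_double_add) auto
  then have "int (2 * n) dvd (\<Sum>p\<in>#add_mset e' Q. wt n p)" by (simp add: algebra_simps)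
  then show ?thesis using assms by (intro signed_product_one_pairs[of "add_mset e' Q" M L t n]) auto
qed

lemma size_distinct_residues:
  assumes "\<And>c. count (image_mset (\<lambda>g. (fst g, snd g mod int n)) R) c \<le> 1"
    and "S = filter_mset (\<lambda>g. fst g = b) R" "n > 0"
  shows "size S = card ((\<lambda>g. snd g mod int n) ` set_mset S)"
    and "(\<lambda>g. snd g mod int n) ` set_mset S \<subseteq> {0..<int n}" and "size S \<le> n"
proof -
  have "count (image_mset (\<lambda>g. snd g mod int n) S) c \<le> 1" for c
  proof -
    have "count (image_mset (\<lambda>g. snd g mod int n) S) c = count (image_mset (\<lambda>g. (fst g, snd g mod int n)) R) (b, c)"
      unfolding assms(2) by (induction R) auto
    then show ?thesis using assms(1) by metis
  qed
  from size_distinct[OF this] show sz: "size S = card ((\<lambda>g. snd g mod int n) ` set_mset S)" by simp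
  show sub: "(\<lambda>g. snd g mod int n) ` set_mset S \<subseteq> {0..<int n}" using assms(3) by auto
  show "size S \<le> n" unfolding sz using card_mono[OF _ sub] by simp
qed

text \<open>The residues fill all but at most one class modulo \<open>n\<close>, so the difference
  \<open>\<delta>\<close> occurs; as \<open>\<delta>\<close> is not divisible by \<open>n\<close>,
  it occurs between two different terms.\<close>

lemma ex_shift_pair:
  assumes "size S = card ((\<lambda>g. snd g mod int n) ` set_mset S)" "n \<le> size S + 1" "n \<ge> 3"
    and "\<not> int n dvd \<delta>"
  obtains h h' where "{#h, h'#} \<subseteq># S" "int n dvd snd h' - snd h - \<delta>"
proof -
  define Z where "Z = (\<lambda>g. snd g mod int n) ` set_mset S"
  have "Z \<subseteq> {0..<int n}" "n \<le> card Z + 1" using assms(1-3) unfolding Z_def by auto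
  then obtain i where i: "i \<in> Z" "(i + \<delta>) mod int n \<in> Z" using assms(3) by (rule ex_difference)
  obtain h where h: "h \<in># S" "i = snd h mod int n" using i(1) unfolding Z_def by blast
  obtain h' where h': "h' \<in># S" "(i + \<delta>) mod int n = snd h' mod int n" using i(2) unfolding Z_def by blast
  have "snd h' mod int n = (snd h + \<delta>) mod int n" using h'(2) h(2) by (simp add: mod_add_left_eq)
  then have dvd: "int n dvd snd h' - snd h - \<delta>" by (simp add: mod_eq_dvd_iff algebra_simps)
  have "h \<noteq> h'" using dvd assms(4) by auto
  then have "{#h, h'#} \<subseteq># S" using h(1) h'(1) by (simp add: insert_subset_eq_iff in_diff_count)
  then show ?thesis using that dvd by blast
qed

lemma taus_members:
  "(\<And>p. p \<in># Q \<Longrightarrow> fst (fst p) = fst (snd p)) \<Longrightarrow>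
    tau_count (members Q) = 2 * size (filter_mset (\<lambda>p. fst (fst p)) Q)"
  by (induction Q) auto

text \<open>At most \<open>n\<close> terms of each type stay unpaired, which leaves at least
  \<open>L / 2\<close> pairs, and \<open>4 dvd L\<close> makes the number \<open>L / 2\<close> even,
  so that pairs of equal weight cancel. The difficulty is to keep a pair of terms
  \<open>\<alpha>^b \<tau>\<close> in the selection while two pairs of different weight are
  available for the exchange.\<close>

theorem signed_product_one_many_taus:
  assumes n3: "n \<ge> 3" and L4: "4 dvd L" and Ln: "2 * n dvd L" "L > 0"
    and sizeM: "size M + 1 = L + 2 * n" and many: "tau_count M \<ge> n + 1"
  shows "signed_product_one n L M"
proof -
  define \<kappa> where "\<kappa> g = (fst g, snd g mod int n)" for g :: "bool \<times> int"
  obtain N where N: "L = 2 * N" "even N"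
  proof -
    obtain k where "L = 4 * k" using L4 by blast
    then show ?thesis using that[of "2 * k"] by simp
  qed
  have "n \<le> N" using dvd_imp_le[OF Ln] N by simp
  then have N4: "N \<ge> 4" using n3 N(2) by presburger
  obtain Q R where M: "M = members Q + R" and Q\<kappa>: "\<And>p. p \<in># Q \<Longrightarrow> \<kappa> (fst p) = \<kappa> (snd p)"
    and R1: "\<And>c. count (image_mset \<kappa> R) c \<le> 1" using pair_up[where M = M and \<kappa> = \<kappa>] by blast
  have Qfst: "fst (fst p) = fst (snd p)" if "p \<in># Q" for p using Q\<kappa>[OF that] unfolding \<kappa>_def by simp
  have Qwt: "int n dvd wt n p" if "p \<in># Q" for p
    using Q\<kappa>[OF that] unfolding \<kappa>_def wt_def by (auto simp: mod_eq_dvd_iff)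
  define RA where "RA = filter_mset (\<lambda>g. fst g = False) R"
  define RT where "RT = filter_mset (\<lambda>g. fst g = True) R"
  have R: "R = RA + RT" unfolding RA_def RT_def by simp
  have n0: "n > 0" using n3 by simp
  note RT_dist = size_distinct_residues[OF R1[unfolded \<kappa>_def] RT_def n0]
  note RA_dist = size_distinct_residues[OF R1[unfolded \<kappa>_def] RA_def n0]
  have tausM: "tau_count M = 2 * size (filter_mset (\<lambda>p. fst (fst p)) Q) + size RT"
    unfolding M using taus_members[of Q] Qfst unfolding RT_def by simp
  have "filter_mset (\<lambda>p. fst (fst p)) Q \<noteq> {#}" using tausM many RT_dist(3) by force
  then obtain t where "t \<in># filter_mset (\<lambda>p. fst (fst p)) Q" by blast
  then have t: "t \<in># Q" "fst (fst t)" by auto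
  have sizeQR: "2 * size Q + size R + 1 = L + 2 * n" using sizeM unfolding M by simp
  have PN: "N \<le> size Q" using sizeQR RA_dist(3) RT_dist(3) N unfolding R by simp
  obtain Q' where Q': "Q = add_mset t Q'" using t(1) by (metis insert_DiffM)
  have const: "signed_product_one n L M"
    if P: "P \<subseteq># Q" "N \<le> size P" "t1 \<in># P" "fst (fst t1)" and c: "\<And>p. p \<in># P \<Longrightarrow> int (2 * n) dvd wt n p - wt n t1" for P t1
  proof -
    have "{#t1#} \<subseteq># P" using P(3) by simp
    then obtain C where C: "{#t1#} \<subseteq># C" "C \<subseteq># P" "size C = N"
      using ex_sub_mset_between[of "{#t1#}" P N] P(2) N4 by auto
    have CQ: "C \<subseteq># Q" using C(2) P(1) by (rule subset_mset.order_trans)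
    have "t1 \<in># C" using C(1) by simp
    moreover have "t1 \<in># Q" using P(1,3) by (rule mset_subset_eqD)
    ultimately show ?thesis using P(4) C CQ N members_mono[OF CQ] Qfst mset_subset_eqD[OF CQ] c mset_subset_eqD[OF C(2)] Qwt
      by (intro signed_product_one_pairs[of C M L t1 n] sum_wt_const[where c = "wt n t1"])
        (auto simp: M subset_mset.add_increasing2)
  qed
  show ?thesis
  proof (cases "\<forall>e\<in>#Q'. int (2 * n) dvd wt n e - wt n t")
    case True
    then show ?thesis using PN t by (intro const[of Q t]) (auto simp: Q')
  next
    case False
    then obtain e where e: "e \<in># Q'" "\<not> int (2 * n) dvd wt n e - wt n t" by blast
    obtain Q'' where Q'': "Q' = add_mset e Q''" using e(1) by (metis insert_DiffM)
    show ?thesis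
    proof (cases "size Q = N")
      case True
      \<comment> \<open>There is no spare pair, but both types of leftover terms miss at most one
        residue. A difference \<open>1\<close> in either type gives two new pairs of total weight
        divisible by \<open>n\<close>; they take the place of \<open>x\<close> and of one of
        \<open>t\<close> and \<open>e\<close>, which can now be exchanged.\<close>
      have "size RA + size RT + 1 = 2 * n" using sizeQR True N unfolding R by simp
      then have sz: "n \<le> size RA + 1" "n \<le> size RT + 1" using RA_dist(3) RT_dist(3) by linarith+
      have "\<not> int n dvd 1" using n3 by simp
      then obtain a a' where a: "{#a, a'#} \<subseteq># RA" "int n dvd snd a' - snd a - 1"
        using ex_shift_pair[OF RA_dist(1) sz(1) n3] by blast
      obtain b b' where b: "{#b, b'#} \<subseteq># RT" "int n dvd snd b' - snd b - 1"
        using ex_shift_pair[OF RT_dist(1) sz(2) n3 \<open>\<not> int n dvd 1\<close>] by blast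
      have mem: "a \<in># RA" "a' \<in># RA" "b \<in># RT" "b' \<in># RT" using a(1) b(1) by (auto dest: mset_subset_eqD)
      then have fsts: "\<not> fst a" "\<not> fst a'" "fst b" "fst b'" unfolding RA_def RT_def by auto
      obtain x Q3 where Q3: "Q'' = add_mset x Q3"
        using True Q' Q'' N4 by (cases Q'') auto
      define C where "C = {#(a', a), (b, b')#} + Q3"
      have "members Q3 + {#a, a'#} + {#b, b'#} \<subseteq># members Q3 + RA + RT"
        by (intro subset_mset.add_mono a b) simp_all
      then have sub: "members C + members {#t, e, x#} \<subseteq># M" unfolding M R Q' Q'' Q3 C_def
        by (simp add: ac_simps)
      have "wt n (a', a) + wt n (b, b') = (snd a' - snd a - 1) - (snd b' - snd b - 1) + int n"
        using fsts unfolding wt_def by simp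
      then have "int n dvd wt n (a', a) + wt n (b, b')"
        using dvd_add[OF dvd_diff[OF a(2) b(2)] dvd_refl] by metis
      then have "int n dvd (\<Sum>p\<in>#C. wt n p)"
        using sum_wt_dvd[of Q3 n] Qwt unfolding C_def Q' Q'' Q3 by (auto simp: add.assoc[symmetric])
      then show ?thesis
      proof (rule signed_product_one_pairs_switch[of t C M e L "(b, b')" n, rotated 6])
        show "members (add_mset t C) \<subseteq># M" "members (add_mset e C) \<subseteq># M"
          using sub by (auto intro: subset_mset.order_trans[rotated] simp: subset_mset.add_increasing2 ac_simps)
        show "2 * size C + 2 = L" using True N unfolding C_def Q' Q'' Q3 by simp
        show "fst (fst p) = fst (snd p)" if "p \<in># add_mset t (add_mset e C)" for p
        proof -
          have "p \<in># Q \<or> p = (a', a) \<or> p = (b, b')" using that unfolding C_def Q' Q'' Q3 by auto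
          then show ?thesis using Qfst[of p] fsts by auto
        qed
        show "\<not> int (2 * n) dvd wt n t - wt n e" using e(2) dvd_diff_commute by blast
      qed (use fsts Qwt Q' Q'' in \<open>auto simp: C_def\<close>)
    next
      case neqN: False
      then have sizeQ': "N \<le> size Q'" using PN Q' by simp
      have Q'Q: "Q' \<subseteq># Q" unfolding Q' by simp
      show ?thesis
      proof (cases "\<exists>e1 e2. {#e1, e2#} \<subseteq># Q' \<and> \<not> int (2 * n) dvd wt n e1 - wt n e2")
        case True
        then obtain e1 e2 where e12: "{#e1, e2#} \<subseteq># Q'" "\<not> int (2 * n) dvd wt n e1 - wt n e2" by blast
        have "N - 2 \<le> size (Q' - {#e1, e2#})" using sizeQ' e12(1) by (simp add: size_Diff_submset)
        then obtain C where C: "C \<subseteq># Q' - {#e1, e2#}" "size C = N - 2" by (rule ex_sub_mset_size)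
        have "C + {#e1, e2#} \<subseteq># Q' - {#e1, e2#} + {#e1, e2#}" using C(1) by (rule subset_mset.add_right_mono)
        then have "C + {#e1, e2#} \<subseteq># Q'" unfolding subset_mset.diff_add[OF e12(1)] .
        then have CQ: "add_mset t C + {#e1, e2#} \<subseteq># Q" unfolding Q' by (simp add: add_mset_commute)
        have inQ: "p \<in># Q" if "p \<in># add_mset t C + {#e1, e2#}" for p using mset_subset_eqD[OF CQ that] .
        have sub: "members (add_mset t C + {#e1, e2#}) \<subseteq># M"
          using members_mono[OF CQ] unfolding M by (rule subset_mset.add_increasing2[rotated]) simp
        show ?thesis
        proof (rule signed_product_one_pairs_switch[of e1 "add_mset t C" M e2 L t n])
          show "members (add_mset e1 (add_mset t C)) \<subseteq># M" "members (add_mset e2 (add_mset t C)) \<subseteq># M"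
            by (rule subset_mset.order_trans[OF members_mono sub]; simp)+
          show "2 * size (add_mset t C) + 2 = L" using C(2) N N4 by simp
          show "int n dvd (\<Sum>p\<in>#add_mset t C. wt n p)" by (rule sum_wt_dvd) (use inQ Qwt in auto)
        qed (use t e12(2) inQ Qwt Qfst in auto)
      next
        case False
        have same: "int (2 * n) dvd wt n e1 - wt n e2" if "e1 \<in># Q'" "e2 \<in># Q'" for e1 e2
        proof (cases "e1 = e2")
          case False
          then have "{#e1, e2#} \<subseteq># Q'" using that by (simp add: insert_subset_eq_iff in_diff_count)
          then show ?thesis using \<open>\<not> (\<exists>e1 e2. _ e1 e2)\<close> by blast
        qed simp
        show ?thesis
        proof (cases "\<exists>t1. t1 \<in># Q' \<and> fst (fst t1)")
          case True
          then show ?thesis using const[OF Q'Q sizeQ'] same by blast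
        next
          case noT: False
          have noT': "\<not> fst g" if g: "g \<in># members Q' + RA" for g
          proof (cases "g \<in># RA")
            case False
            then obtain p where p: "p \<in># Q'" "g = fst p \<or> g = snd p" using g by auto
            then have "p \<in># Q" using Q' by simp
            then show ?thesis using noT Qfst[of p] p by metis
          qed (simp add: RA_def)
          \<comment> \<open>As \<open>t\<close> is the only pair of its type, at least
            \<open>n - 1\<close> terms \<open>\<alpha>^b \<tau>\<close> are left over, with distinct
            residues modulo \<open>n\<close>.\<close>
          have "filter_mset (\<lambda>p. fst (fst p)) Q = {#t#}" using noT unfolding Q' using t(2)
            by (auto intro!: filter_mset_emptyI)
          then have "n \<le> size RT + 1" using tausM many by simp
          show ?thesis
          proof (cases "\<forall>a\<in>#members Q' + RA. \<forall>a'\<in>#members Q' + RA. int n dvd snd a' - snd a")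
            case True
            \<comment> \<open>If all powers of \<open>\<alpha>\<close> agree modulo
              \<open>n\<close>, the exponents in a pair add up to its weight plus
              \<open>2 * c\<close> modulo \<open>2 * n\<close>, so \<open>N\<close> pairs give a
              zero sum among the powers of \<open>\<alpha>\<close>.\<close>
            obtain C where C: "C \<subseteq># Q'" "size C = N" using ex_sub_mset_size[OF sizeQ'] .
            have inQ': "p \<in># Q'" if "p \<in># C" for p using mset_subset_eqD[OF C(1) that] .
            define c where "c = snd (snd e)"
            have "int (2 * n) dvd snd (fst p) + snd (snd p) - (2 * c + wt n p)" if "p \<in># C" for p
            proof -
              have "p \<in># Q'" using inQ'[OF that] .
              then have "snd p \<in># members Q' + RA" "snd e \<in># members Q' + RA" using e(1) by auto
              then have "int n dvd snd (snd p) - c" unfolding c_def using True by blast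
              then have "2 * int n dvd 2 * (snd (snd p) - c)" by (rule mult_dvd_mono[OF dvd_refl])
              moreover have "\<not> fst (fst p)" using noT \<open>p \<in># Q'\<close> by blast
              ultimately show ?thesis unfolding wt_def by (simp add: algebra_simps)
            qed
            then have d1: "int (2 * n) dvd (\<Sum>p\<in>#C. snd (fst p) + snd (snd p)) - (int (size C) * (2 * c) + (\<Sum>p\<in>#C. wt n p))"
            proof (induction C)
              case (add p C)
              have "int (2 * n) dvd (snd (fst p) + snd (snd p) - (2 * c + wt n p)) +
                ((\<Sum>p\<in>#C. snd (fst p) + snd (snd p)) - (int (size C) * (2 * c) + (\<Sum>p\<in>#C. wt n p)))"
                by (intro dvd_add add.IH add.prems) auto
              then show ?case by (simp add: algebra_simps)
            qed simp
            have d2: "int (2 * n) dvd int (size C) * (2 * c)"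
            proof -
              have "int (2 * n) dvd int L * c" using Ln(1) by (intro dvd_mult2) (simp only: int_dvd_int_iff)
              then show ?thesis unfolding C(2) N(1) by (simp add: ac_simps)
            qed
            have d3: "int (2 * n) dvd (\<Sum>p\<in>#C. wt n p)"
              by (rule sum_wt_const[where c = "wt n e"]) (use inQ' same e(1) Qwt Q'Q N C in \<open>auto simp: Q'\<close>)
            have dvd: "int (2 * n) dvd (\<Sum>p\<in>#C. snd (fst p) + snd (snd p))"
              using dvd_add[OF d1 dvd_add[OF d2 d3]] by (simp only: diff_add_cancel)
            have "filter_mset (\<lambda>g. \<not> fst g) (members C) = members C"
            proof (rule filter_mset_allI)
              fix g assume "g \<in># members C"
              then obtain p where p: "p \<in># C" "g = fst p \<or> g = snd p" by auto
              then have "p \<in># Q'" "p \<in># Q" using inQ' by (simp_all add: Q')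
              then show "\<not> fst g" using noT Qfst[of p] p(2) by blast
            qed
            moreover have "members C \<subseteq># M"
              unfolding M using members_mono[OF subset_mset.order_trans[OF C(1) Q'Q]]
              by (simp add: subset_mset.add_increasing2)
            ultimately have sub: "image_mset snd (members C) \<subseteq># alpha_part M"
              by (metis image_mset_subseteq_mono multiset_filter_mono)
            have "(\<Sum>x\<in>#image_mset snd (members C). x) = (\<Sum>p\<in>#C. snd (fst p) + snd (snd p))"
              by (induction C) auto
            then have "zero_sum_sub (2 * n) L (\<lambda>x. x) (alpha_part M)" unfolding zero_sum_sub_def
              using sub dvd C(2) N by (intro exI[of _ "image_mset snd (members C)"]) auto
            then show ?thesis unfolding signed_product_one_def by blast
          next
            case False
            \<comment> \<open>The difference of \<open>a'\<close> and \<open>a\<close> modulo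
              \<open>n\<close> is matched by one in \<open>RT\<close>. The two pairs formed in this
              way leave room for an exchange of \<open>t\<close> and \<open>x\<close>, whose weights
              differ.\<close>
            then obtain a a' where a: "a \<in># members Q' + RA" "a' \<in># members Q' + RA" "\<not> int n dvd snd a' - snd a"
              by blast
            obtain P1 R1 where P1: "P1 \<subseteq># Q'" "size Q' \<le> size P1 + 1" "members Q' + RA = members P1 + add_mset a R1"
              using split_off_member[OF a(1)] .
            have "a' \<in># members P1 + R1" using a(2,3) unfolding P1(3) by auto
            then obtain P2 R2 where P2: "P2 \<subseteq># P1" "size P1 \<le> size P2 + 1" "members P1 + R1 = members P2 + add_mset a' R2"
              by (rule split_off_member)
            have split: "members Q' + RA = members P2 + {#a, a'#} + R2" using P1(3) P2(3) by simp
            obtain b b' where b: "{#b, b'#} \<subseteq># RT" "int n dvd snd b' - snd b - (snd a' - snd a)"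
              using ex_shift_pair[OF RT_dist(1) \<open>n \<le> size RT + 1\<close> n3 a(3)] .
            have "b \<in># RT" "b' \<in># RT" using b(1) by (auto dest: mset_subset_eqD)
            then have fstb: "fst b" "fst b'" unfolding RT_def by auto
            have fsta: "\<not> fst a" "\<not> fst a'" using a(1,2) noT' by blast+
            have "N - 2 \<le> size P2" using P1(2) P2(2) sizeQ' by simp
            then obtain C where C: "C \<subseteq># P2" "size C = N - 2" by (rule ex_sub_mset_size)
            obtain x C' where x: "C = add_mset x C'" using C(2) N4 by (cases C) auto
            have "C \<subseteq># Q'" using C(1) P2(1) P1(1) by (meson subset_mset.order_trans)
            then have inQ': "p \<in># Q'" if "p \<in># C" for p using that by (meson mset_subset_eqD)
            have xQ: "x \<in># Q'" using inQ'[of x] x by simp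
            then have xwt: "int n dvd wt n x" using Qwt[of x] Q' by simp
            define D where "D = {#(a', a), (b, b')#} + C'"
            have "members C + {#a, a'#} + {#b, b'#} \<subseteq># (members P2 + {#a, a'#} + R2) + RT"
              by (intro subset_mset.add_mono b subset_mset.add_increasing2[OF subset_mset.zero_le] image_mset_subseteq_mono C) simp_all
            then have "members C + {#a, a'#} + {#b, b'#} + members {#t#} \<subseteq># M" unfolding M Q' R split[symmetric]
              by (simp add: ac_simps)
            moreover have "members (add_mset t (add_mset x D)) = members C + {#a, a'#} + {#b, b'#} + members {#t#}"
              unfolding D_def x by (intro multiset_eqI) simp
            ultimately have sub: "members (add_mset t (add_mset x D)) \<subseteq># M" by metis
            have "wt n (a', a) + wt n (b, b') = - (snd b' - snd b - (snd a' - snd a)) + int n"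
              using fsta fstb unfolding wt_def by simp
            then have "int n dvd wt n (a', a) + wt n (b, b')"
              using dvd_add[OF iffD2[OF dvd_minus_iff b(2)] dvd_refl] by metis
            then have "int n dvd (\<Sum>p\<in>#D. wt n p)"
              using sum_wt_dvd[of C' n] inQ' Qwt unfolding D_def Q' x by (auto simp: add.assoc[symmetric])
            then show ?thesis
            proof (rule signed_product_one_pairs_switch[of t D M x L "(b, b')" n, rotated 6])
              show "members (add_mset t D) \<subseteq># M" "members (add_mset x D) \<subseteq># M"
                by (rule subset_mset.order_trans[OF members_mono sub]; simp)+
              show "2 * size D + 2 = L" using C(2) N N4 x unfolding D_def by simp
              show "fst (fst p) = fst (snd p)" if "p \<in># add_mset t (add_mset x D)" for p
              proof -
                have "p \<in># Q \<or> p = (a', a) \<or> p = (b, b')" using that inQ'[of p] unfolding D_def Q' x by auto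
                then show ?thesis using Qfst[of p] fsta fstb by auto
              qed
              have "int (2 * n) dvd wt n e - wt n x" using same[OF e(1) xQ] .
              then show "\<not> int (2 * n) dvd wt n t - wt n x"
                using e(2) dvd_diff[of "int (2 * n)" "wt n e - wt n x" "wt n t - wt n x"] by auto
            qed (use fstb Qwt[OF t(1)] xwt in \<open>simp_all add: D_def\<close>)
          qed
        qed
      qed
    qed
  qed
qed

section \<open>At least two terms \<open>\<alpha>^b \<tau>\<close>\<close>

lemma size_alpha_part: "size (alpha_part M) + tau_count M = size M"
  using size_filter_complement[of fst M] by simp

lemma signed_product_one_mono:
  assumes "signed_product_one n L M" "M \<subseteq># M'"
  shows "signed_product_one n L M'"
  using assms(1) unfolding signed_product_one_def
proof (elim disjE exE conjE)
  assume "zero_sum_sub (2 * n) L (\<lambda>x. x) (alpha_part M)"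
  moreover have "alpha_part M \<subseteq># alpha_part M'"
    using assms(2) by (intro image_mset_subseteq_mono multiset_filter_mono)
  ultimately show "zero_sum_sub (2 * n) L (\<lambda>x. x) (alpha_part M') \<or>
     (\<exists>U V. U + V \<subseteq># M' \<and> size U + size V = L \<and> tau_count U = tau_count V \<and> tau_count U > 0 \<and>
        int (2 * n) dvd (\<Sum>g\<in>#U. snd g) - (\<Sum>g\<in>#V. snd g) + int n * int (tau_count U))"
    using zero_sum_sub_mono by blast
qed (use assms(2) subset_mset.order_trans in blast)

text \<open>At most \<open>n\<close> terms \<open>\<alpha>^b \<tau>\<close> leave
  \<open>L + n - 1\<close> powers of \<open>\<alpha>\<close>. Two of those terms, \<open>b\<close>
  and \<open>b'\<close>, enter with opposite signs, and \<open>L - 2\<close> signed powers of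
  \<open>\<alpha>\<close> cancel \<open>snd b - snd b' + n\<close>.\<close>

lemma signed_product_one_few_taus:
  assumes n2: "n \<ge> 2" and Ln: "2 * n dvd L" "L > 0"
    and sizeM: "L + 2 * n \<le> size M + 1" and tau_count: "2 \<le> tau_count M" "tau_count M \<le> n"
  shows "signed_product_one n L M"
proof -
  have sizeA: "L + n \<le> size (alpha_part M) + 1" using size_alpha_part[of M] sizeM tau_count(2) by linarith
  obtain S where S: "S \<subseteq># filter_mset fst M" "size S = 2" using ex_sub_mset_size[OF tau_count(1)] .
  obtain b S' where S': "S = add_mset b S'" "size S' = 1"
    using size_eq_Suc_imp_eq_union[of S 1] S(2) by auto
  obtain b' where b': "S' = {#b'#}" using S'(2) size_1_singleton_mset by blast
  have b: "{#b, b'#} \<subseteq># filter_mset fst M" using S(1) S'(1) b' by simp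
  then have "b \<in># filter_mset fst M" "b' \<in># filter_mset fst M" by (auto dest: mset_subset_eqD)
  then have fstb: "fst b" "fst b'" by auto
  define d where "d = - (snd b - snd b' + int n)"
  consider "zero_sum_sub (2 * n) L (\<lambda>x. x) (alpha_part M)" | "signed_sub (2 * n) (L - 2) d (alpha_part M)"
    using zero_sum_or_signed_sub[OF n2 Ln sizeA] by blast
  then show ?thesis
  proof cases
    case 2
    then obtain U V where UV: "U + V \<subseteq># alpha_part M" "size U + size V = L - 2"
      "int (2 * n) dvd (\<Sum>x\<in>#U. x) - (\<Sum>x\<in>#V. x) - d" unfolding signed_sub_def by blast
    define U' where "U' = add_mset b (image_mset (Pair False) U)"
    define V' where "V' = add_mset b' (image_mset (Pair False) V)"
    have "image_mset (Pair False) (alpha_part M) = filter_mset (\<lambda>g. \<not> fst g) M"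
      by (induction M) auto
    then have "image_mset (Pair False) (U + V) \<subseteq># filter_mset (\<lambda>g. \<not> fst g) M"
      using image_mset_subseteq_mono[OF UV(1), of "Pair False"] by simp
    then have "image_mset (Pair False) (U + V) + {#b, b'#} \<subseteq># filter_mset (\<lambda>g. \<not> fst g) M + filter_mset fst M"
      using b by (rule subset_mset.add_mono)
    then have "U' + V' \<subseteq># M" unfolding U'_def V'_def by (simp add: add_mset_commute)
    moreover have "size U' + size V' = L"
      using UV(2) dvd_imp_le[OF Ln] n2 unfolding U'_def V'_def by simp
    moreover have "filter_mset fst (image_mset (Pair False) W) = {#}" for W :: "int multiset"
      by (rule filter_mset_emptyI) auto
    then have taus1: "tau_count U' = 1" "tau_count V' = 1" unfolding U'_def V'_def using fstb by simp_all
    moreover have "(\<Sum>g\<in>#U'. snd g) - (\<Sum>g\<in>#V'. snd g) + int n * int (tau_count U')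
        = (\<Sum>x\<in>#U. x) - (\<Sum>x\<in>#V. x) - d"
      unfolding taus1 unfolding U'_def V'_def d_def by (simp add: multiset.map_comp comp_def)
    ultimately show ?thesis unfolding signed_product_one_def using UV(3) by (intro disjI2 exI[of _ U'] exI[of _ V']) simp
  qed (simp add: signed_product_one_def)
qed

text \<open>The case of many terms \<open>\<alpha>^b \<tau>\<close> asks for an exact length, so
  \<open>M\<close> is cut down to \<open>L + 2 * n - 1\<close> terms, two of them of this
  type.\<close>

theorem signed_product_one_two_taus:
  assumes "n \<ge> 3" "4 dvd L" "2 * n dvd L" "L > 0" "L + 2 * n \<le> size M + 1" "tau_count M \<ge> 2"
  shows "signed_product_one n L M"
proof -
  obtain S where S: "S \<subseteq># filter_mset fst M" "size S = 2" using ex_sub_mset_size[OF assms(6)] .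
  have "S \<subseteq># M" using S(1) multiset_filter_subset by (rule subset_mset.order_trans)
  moreover have "size S \<le> L + 2 * n - 1" "L + 2 * n - 1 \<le> size M" using S(2) assms(1,4,5) by auto
  ultimately obtain M' where M': "S \<subseteq># M'" "M' \<subseteq># M" "size M' = L + 2 * n - 1"
    by (rule ex_sub_mset_between)
  have "filter_mset fst S = S" using S(1) by (intro filter_mset_allI) (auto dest: mset_subset_eqD)
  then have "S \<subseteq># filter_mset fst M'" using multiset_filter_mono[OF M'(1), of fst] by simp
  then have two: "tau_count M' \<ge> 2" using S(2) size_mset_mono by metis
  have "signed_product_one n L M'"
  proof (cases "tau_count M' \<le> n")
    case True
    then show ?thesis using assms M'(3) two by (intro signed_product_one_few_taus) auto
  next
    case False
    then show ?thesis using assms M'(3) by (intro signed_product_one_many_taus) auto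
  qed
  then show ?thesis using M'(2) by (rule signed_product_one_mono)
qed

text \<open>For \<open>n = 2\<close> the four classes are the cosets of the centre:
  \<open>(False, 0)\<close> is the centre itself, and each other class consists of the two
  generators of a cyclic subgroup of order 4.\<close>

definition class_size :: "bool \<Rightarrow> int \<Rightarrow> (bool \<times> int) multiset \<Rightarrow> nat" where
  "class_size b r M = size (filter_mset (\<lambda>g. fst g = b \<and> snd g mod 2 = r) M)"

lemma class_size_pos_imp_ex:
  assumes "class_size b r M > 0"
  obtains g where "g \<in># M" "fst g = b" "snd g mod 2 = r"
proof -
  have "filter_mset (\<lambda>g. fst g = b \<and> snd g mod 2 = r) M \<noteq> {#}"
    using assms unfolding class_size_def by (metis size_empty less_irrefl)
  then obtain g where "g \<in># filter_mset (\<lambda>g. fst g = b \<and> snd g mod 2 = r) M" by blast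
  then show ?thesis using that[of g] by simp
qed

text \<open>The four classes serve as keys, so at most four terms stay without partner, and a class
  with two terms must contribute a pair.\<close>

lemma pair_up_parity:
  obtains Q R where "M = members Q + R"
    "\<And>p. p \<in># Q \<Longrightarrow> fst (fst p) = fst (snd p) \<and> snd (fst p) mod 2 = snd (snd p) mod 2"
    "size R \<le> 4" "\<And>b r. class_size b r M \<ge> 2 \<Longrightarrow> \<exists>p\<in>#Q. fst (fst p) = b \<and> snd (fst p) mod 2 = r"
proof -
  define \<kappa> where "\<kappa> g = (fst g, snd g mod 2)" for g :: "bool \<times> int"
  obtain Q R where M: "M = members Q + R" and Q: "\<And>p. p \<in># Q \<Longrightarrow> \<kappa> (fst p) = \<kappa> (snd p)"
    and R: "\<And>c. count (image_mset \<kappa> R) c \<le> 1"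
    using pair_up[where M = M and \<kappa> = \<kappa>] by blast
  have "set_mset (image_mset \<kappa> R) \<subseteq> UNIV \<times> {0, 1}" unfolding \<kappa>_def by auto
  then have "card (set_mset (image_mset \<kappa> R)) \<le> card ((UNIV :: bool set) \<times> {0, 1 :: int})"
    by (intro card_mono) auto
  then have "size R \<le> 4" using size_distinct[OF R] by simp
  moreover have "\<exists>p\<in>#Q. fst (fst p) = b \<and> snd (fst p) mod 2 = r" if "class_size b r M \<ge> 2" for b r
  proof (rule ccontr)
    assume none: "\<not> ?thesis"
    then have "filter_mset (\<lambda>g. fst g = b \<and> snd g mod 2 = r) (members Q) = {#}"
      using Q unfolding \<kappa>_def by (intro filter_mset_emptyI) force
    then have "class_size b r M = class_size b r R" unfolding class_size_def M by simp
    also have "\<dots> = count (image_mset \<kappa> R) (b, r)" unfolding class_size_def \<kappa>_def by (induction R) auto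
    finally show False using R[of "(b, r)"] that by simp
  qed
  ultimately show ?thesis using that[OF M] Q unfolding \<kappa>_def by auto
qed

text \<open>In the quaternion group two elements of different classes modulo the centre anticommute
  unless one of them is central, so swapping two neighbours changes the sign of a product.\<close>

theorem signed_product_one_quaternion:
  assumes L: "4 dvd L" "L > 0" and sizeM: "L + 4 \<le> size M + 1" and tau_count: "tau_count M \<ge> 2"
    and max: "class_size True 0 M \<le> class_size False 1 M" "class_size True 1 M \<le> class_size False 1 M"
  shows "signed_product_one 2 L M"
proof -
  obtain N where N: "L = 2 * N" "even N" "N \<ge> 2"
  proof -
    obtain k where "L = 4 * k" using L(1) by blast
    then show ?thesis using that[of "2 * k"] L(2) by simp
  qed
  show ?thesis
  proof (cases "class_size True 0 M \<ge> 2 \<or> class_size True 1 M \<ge> 2")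
    case True
    then obtain r where r: "class_size True r M \<ge> 2" by blast
    \<comment> \<open>The maximality of the class of \<open>\<alpha>\<close> supplies a pair of odd
      powers of \<open>\<alpha>\<close>, the means for a change of sign.\<close>
    have i2: "class_size False 1 M \<ge> 2" using True max by linarith
    obtain Q R where M: "M = members Q + R"
      and Q: "\<And>p. p \<in># Q \<Longrightarrow> fst (fst p) = fst (snd p) \<and> snd (fst p) mod 2 = snd (snd p) mod 2"
      and R: "size R \<le> 4" and ex: "\<And>b r. class_size b r M \<ge> 2 \<Longrightarrow> \<exists>p\<in>#Q. fst (fst p) = b \<and> snd (fst p) mod 2 = r"
      using pair_up_parity[of M] by blast
    obtain t where t: "t \<in># Q" "fst (fst t)" using ex[OF r] by blast
    obtain e where e: "e \<in># Q" "\<not> fst (fst e)" "snd (fst e) mod 2 = 1" using ex[OF i2] by blast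
    have "L + 4 \<le> 2 * size Q + size R + 1" using sizeM unfolding M by simp
    then have NQ: "N \<le> size Q" using R N(1) by presburger
    have "t \<noteq> e" using t e by auto
    then have "{#t, e#} \<subseteq># Q" using t e by (simp add: insert_subset_eq_iff in_diff_count)
    then obtain C where C: "{#t, e#} \<subseteq># C" "C \<subseteq># Q" "size C = N"
      using ex_sub_mset_between[of "{#t, e#}" Q N] NQ N(3) by auto
    obtain D where D: "C = add_mset t (add_mset e D)" using C(1) by (metis add_mset_add_single subset_mset.add_diff_inverse union_mset_add_mset_left empty_neutral(1))
    have CQ: "p \<in># Q" if "p \<in># C" for p using mset_subset_eqD[OF C(2) that] .
    have subM: "members C \<subseteq># M" unfolding M using members_mono[OF C(2)] by (simp add: subset_mset.add_increasing2)
    have even: "2 dvd wt 2 p" if "p \<in># C" for p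
      using Q[OF CQ[OF that]] unfolding wt_def by (auto simp: mod_eq_dvd_iff)
    then have "int 2 dvd (\<Sum>p\<in>#C. wt 2 p)" by (intro dvd_sum_mset) simp
    show ?thesis
    proof (cases "int (2 * 2) dvd (\<Sum>p\<in>#C. wt 2 p)")
      case True
      then show ?thesis using t C N Q CQ subM by (intro signed_product_one_pairs[of C M L t 2]) (auto simp: D)
    next
      case False
      have odd: "snd (snd e) mod 2 = 1" and nf: "\<not> fst (snd e)" using Q[OF e(1)] e by auto
      \<comment> \<open>The sum is \<open>2\<close> modulo \<open>4\<close>. Moving the odd exponent
        \<open>snd (snd e)\<close> from the minus to the plus side corrects it and keeps the signs
        on the terms \<open>\<alpha>^b \<tau>\<close> balanced.\<close>
      define U V where "U = add_mset (snd e) (image_mset fst C)" and "V = image_mset snd (add_mset t D)"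
      have UV: "U + V = members C" unfolding U_def V_def D by simp
      have "\<forall>p\<in>#C. fst (fst p) = fst (snd p)" using Q CQ by blast
      then have "tau_count (image_mset fst C) = tau_count (image_mset snd C)" by (induction C) auto
      then have tausUV: "tau_count U = tau_count V" unfolding U_def V_def D using nf by simp
      have "tau_count U > 0" unfolding U_def D using t(2) by simp
      have sum: "(\<Sum>p\<in>#P. wt 2 p) = (\<Sum>g\<in>#image_mset fst P. snd g) - (\<Sum>g\<in>#image_mset snd P. snd g)
          + 2 * int (tau_count (image_mset fst P))" for P
        by (induction P) (auto simp: wt_def algebra_simps)
      have "(\<Sum>g\<in>#U. snd g) - (\<Sum>g\<in>#V. snd g) + 2 * int (tau_count U) = (\<Sum>p\<in>#C. wt 2 p) + 2 * snd (snd e)"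
        unfolding sum unfolding U_def V_def D using nf by simp
      moreover have "int (2 * 2) dvd (\<Sum>p\<in>#C. wt 2 p) + 2 * snd (snd e)"
      proof (rule dvd_double_add[OF \<open>int 2 dvd (\<Sum>p\<in>#C. wt 2 p)\<close> _ False])
        show "\<not> int (2 * 2) dvd 2 * snd (snd e)" using odd by simp presburger
      qed simp
      moreover have "size U + size V = L"
        using arg_cong[OF UV, of size] C(3) N(1) by simp
      ultimately show ?thesis unfolding signed_product_one_def using UV subM tausUV \<open>tau_count U > 0\<close>
        by (intro disjI2 exI[of _ U] exI[of _ V]) auto
    qed
  next
    case False
    have "tau_count M = class_size True 0 M + class_size True 1 M"
    proof (induction M)
      case (add g M)
      have "snd g mod 2 = 0 \<or> snd g mod 2 = 1" by presburger
      then show ?case using add by (auto simp: class_size_def)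
    qed (simp add: class_size_def)
    then have t01: "class_size True 0 M > 0" "class_size True 1 M > 0" "tau_count M = 2" using False tau_count by linarith+
    show ?thesis
    proof (cases "class_size False 0 M > 0 \<and> class_size False 1 M > 0")
      case True
      obtain j where j: "j \<in># M" "fst j" "snd j mod 2 = 0" by (rule class_size_pos_imp_ex[OF t01(1)]) simp
      obtain k where k: "k \<in># M" "fst k" "snd k mod 2 = 1" by (rule class_size_pos_imp_ex[OF t01(2)]) simp
      obtain a0 where a0: "a0 \<in># M" "\<not> fst a0" "snd a0 mod 2 = 0" by (rule class_size_pos_imp_ex[OF conjunct1[OF True]]) simp
      obtain a1 where a1: "a1 \<in># M" "\<not> fst a1" "snd a1 mod 2 = 1" by (rule class_size_pos_imp_ex[OF conjunct2[OF True]]) simp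
      \<comment> \<open>One term of each class is set aside. Exchanging \<open>j\<close> and
        \<open>k\<close> changes the weight by \<open>2 * (snd j - snd k)\<close>, which is
        \<open>2\<close> modulo \<open>4\<close>.\<close>
      have "distinct [a0, a1, j, k]" using j k a0 a1 by auto
      then have sub: "{#a0, a1, j, k#} \<subseteq># M" using j(1) k(1) a0(1) a1(1)
        by (simp add: insert_subset_eq_iff in_diff_count)
      define M' where "M' = M - {#a0, a1, j, k#}"
      have M: "M = M' + {#a0, a1, j, k#}" unfolding M'_def by (rule subset_mset.diff_add[OF sub, symmetric])
      obtain Q R where QR: "M' = members Q + R"
        and Q: "\<And>p. p \<in># Q \<Longrightarrow> fst (fst p) = fst (snd p) \<and> snd (fst p) mod 2 = snd (snd p) mod 2"
        and R: "size R \<le> 4"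
        and "\<And>b r. class_size b r M' \<ge> 2 \<Longrightarrow> \<exists>p\<in>#Q. fst (fst p) = b \<and> snd (fst p) mod 2 = r"
        using pair_up_parity[of M'] by blast
      have "L + 4 \<le> 2 * size Q + size R + 5" using sizeM unfolding M QR by simp
      then have "N - 2 \<le> size Q" using R N(1) by presburger
      then obtain C where C: "C \<subseteq># Q" "size C = N - 2" by (rule ex_sub_mset_size)
      have CQ: "p \<in># Q" if "p \<in># C" for p using mset_subset_eqD[OF C(1) that] .
      have subM: "members C + {#a0, a1, j, k#} \<subseteq># M" unfolding M QR
        by (intro subset_mset.add_right_mono subset_mset.order_trans[OF members_mono[OF C(1)]]) simp
      have "2 dvd wt 2 p" if "p \<in># C" for p
        using Q[OF CQ[OF that]] unfolding wt_def by (auto simp: mod_eq_dvd_iff)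
      then have evenC: "2 dvd (\<Sum>p\<in>#C. wt 2 p)" by (rule dvd_sum_mset)
      have *: "signed_product_one 2 L M" if "{x, y} = {j, k}" "x \<noteq> y" "4 dvd (\<Sum>p\<in>#C. wt 2 p) + (snd a0 - snd a1 + snd x - snd y + 2)" for x y
      proof (rule signed_product_one_pairs[of "add_mset (x, y) (add_mset (a0, a1) C)" M L "(x, y)" 2])
        have xy: "fst x" "fst y" using that(1) j(2) k(2) by (auto simp: doubleton_eq_iff)
        show "members (add_mset (x, y) (add_mset (a0, a1) C)) \<subseteq># M"
          using subM that(1,2) by (auto simp: doubleton_eq_iff add_mset_commute)
        show "2 * size (add_mset (x, y) (add_mset (a0, a1) C)) = L" using C(2) N by simp
        show "fst (fst p) = fst (snd p)" if "p \<in># add_mset (x, y) (add_mset (a0, a1) C)" for p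
          using that xy a0(2) a1(2) Q[of p] CQ[of p] by auto
        show "int (2 * 2) dvd (\<Sum>p\<in>#add_mset (x, y) (add_mset (a0, a1) C). wt 2 p)"
          using that(3) xy a0(2) a1(2) by (simp add: wt_def algebra_simps)
      qed (use that j k in \<open>auto simp: doubleton_eq_iff\<close>)
      have "4 dvd (\<Sum>p\<in>#C. wt 2 p) + (snd a0 - snd a1 + snd j - snd k + 2) \<or>
          4 dvd (\<Sum>p\<in>#C. wt 2 p) + (snd a0 - snd a1 + snd k - snd j + 2)"
        using evenC a0(3) a1(3) j(3) k(3) by presburger
      moreover have "j \<noteq> k" using j(3) k(3) by auto
      ultimately show ?thesis using *[of j k] *[of k j] by auto
    next
      case False
      \<comment> \<open>The powers of \<open>\<alpha>\<close> lie in one class, and there are at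
        least \<open>L + 1\<close> of them.\<close>
      then have "class_size False (1 - 1) M = 0 \<or> class_size False (1 - 0) M = 0" by simp
      then obtain c :: int where c: "c \<in> {0, 1}" "class_size False (1 - c) M = 0" by blast
      have "[x = c] (mod int 2)" if x: "x \<in># alpha_part M" for x
      proof -
        have "x mod 2 \<noteq> 1 - c"
        proof
          assume "x mod 2 = 1 - c"
          then have "(False, x) \<in># filter_mset (\<lambda>g. fst g = False \<and> snd g mod 2 = 1 - c) M" using x by auto
          then show False using c(2) unfolding class_size_def by auto
        qed
        then show ?thesis using c(1) unfolding cong_def by auto
      qed
      moreover have "L + 2 \<le> size (alpha_part M) + 1" using size_alpha_part[of M] sizeM t01(3) by linarith
      ultimately have "zero_sum_sub (2 * 2) L (\<lambda>x. x) (alpha_part M)"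
        using L(1) by (intro residue_class_zero_sum[where c = c]) auto
      then show ?thesis unfolding signed_product_one_def by blast
    qed
  qed
qed

section \<open>Presentations of dicyclic groups\<close>

lemma word_cong_context:
  assumes "word_cong R u v"
  shows "word_cong R (x @ u @ y) (x @ v @ y)"
  using assms
proof induction
  case (cancel u c b v)
  show ?case using word_cong.cancel[of R "x @ u" c b "v @ y"] by simp
next
  case (relation l r u v)
  then show ?case using word_cong.relation[of l r R "x @ u" "v @ y"] by simp
qed (auto intro: word_cong.intros)

lemma word_cong_Cons: "word_cong R u v \<Longrightarrow> word_cong R (l # u) (l # v)"
  using word_cong_context[of R u v "[l]" "[]"] by simp

lemma word_cong_append: "word_cong R u v \<Longrightarrow> word_cong R (x @ u) (x @ v)"
  using word_cong_context[of R u v x "[]"] by simp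

lemma word_cong_cancel: "word_cong R ((c, b) # (c, \<not> b) # v) v"
  using word_cong.cancel[of R "[]" c b v] by simp

lemma word_cong_relation: "(l, r) \<in> R \<Longrightarrow> word_cong R (l @ v) (r @ v)"
  using word_cong.relation[of l r R "[]" v] by simp

context group
begin

lemma eval_word_closed: "range f \<subseteq> carrier G \<Longrightarrow> eval_word G f w \<in> carrier G"
  by (induction w) (auto simp: image_subset_iff)

lemma eval_word_append:
  "range f \<subseteq> carrier G \<Longrightarrow> eval_word G f (u @ v) = eval_word G f u \<otimes> eval_word G f v"
  by (induction u) (auto simp: image_subset_iff eval_word_closed m_assoc)

lemma eval_word_replicate:
  assumes "range f \<subseteq> carrier G"
  shows "eval_word G f (replicate k (c, True)) = f c [^] k"
proof (induction k)
  case (Suc k)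
  have "f c \<in> carrier G" using assms by blast
  then show ?case using Suc nat_pow_Suc2[of "f c" k] by simp
qed simp

lemma word_cong_eval:
  assumes "word_cong R u v" "range f \<subseteq> carrier G" "\<And>l r. (l, r) \<in> R \<Longrightarrow> eval_word G f l = eval_word G f r"
  shows "eval_word G f u = eval_word G f v"
  using assms(1)
proof induction
  case (cancel u c b v)
  have "f c \<in> carrier G" using assms(2) by blast
  then have "eval_word G f ([(c, b), (c, \<not> b)] @ v) = eval_word G f v"
    using eval_word_closed[OF assms(2), of v] by (cases b) (auto simp flip: m_assoc)
  then show ?case by (metis eval_word_append[OF assms(2)])
next
  case (relation l r u v)
  then show ?case using assms(3) eval_word_append[OF assms(2)] by metis
qed auto

lemma generate_eval_word:
  assumes "range f \<subseteq> carrier G" "x \<in> generate G (range f)"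
  shows "\<exists>w. x = eval_word G f w"
  using assms(2)
proof induction
  case one
  show ?case by (rule exI[of _ "[]"]) simp
next
  case (incl h)
  then obtain c where "h = f c" by blast
  then show ?case using assms(1) by (intro exI[of _ "[(c, True)]"]) (auto simp: image_subset_iff)
next
  case (inv h)
  then obtain c where "h = f c" by blast
  then show ?case using assms(1) by (intro exI[of _ "[(c, False)]"]) (auto simp: image_subset_iff)
next
  case (eng h1 h2)
  then show ?case using eval_word_append[OF assms(1)] by metis
qed

end

abbreviation alpha_letter :: "dicyclic_gen \<times> bool" where "alpha_letter \<equiv> (Alpha, True)"
abbreviation tau_letter :: "dicyclic_gen \<times> bool" where "tau_letter \<equiv> (Tau, True)"

definition normal_word :: "bool \<times> nat \<Rightarrow> dicyclic_gen gen_word" where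
  "normal_word p = replicate (snd p) alpha_letter @ (if fst p then [tau_letter] else [])"

definition normalisable :: "nat \<Rightarrow> dicyclic_gen gen_word \<Rightarrow> bool" where
  "normalisable n w \<longleftrightarrow> (\<exists>p. snd p < 2 * n \<and> word_cong (dicyclic_relations n) w (normal_word p))"

lemma dicyclic_word_relations:
  shows "word_cong (dicyclic_relations n) (replicate (2 * n) alpha_letter @ v) v"
    and "word_cong (dicyclic_relations n) (tau_letter # tau_letter # v) (replicate n alpha_letter @ v)"
    and "word_cong (dicyclic_relations n) (tau_letter # alpha_letter # v) ((Alpha, False) # tau_letter # v)"
  using word_cong_relation[of _ _ "dicyclic_relations n" v] unfolding dicyclic_relations_def by force+

lemma normalisable_cong:
  "word_cong (dicyclic_relations n) u v \<Longrightarrow> normalisable n v \<Longrightarrow> normalisable n u"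
  unfolding normalisable_def using word_cong.trans by blast

text \<open>Exponents are kept below \<open>2 n\<close> by absorbing or inserting
  \<open>\<alpha>^(2 n)\<close> at the ends of the range.\<close>

lemma normalisable_alpha:
  assumes "normalisable n w" "n > 0"
  shows "normalisable n ((Alpha, b) # w)"
proof -
  let ?R = "dicyclic_relations n"
  obtain p where p: "snd p < 2 * n" "word_cong ?R w (normal_word p)"
    using assms(1) unfolding normalisable_def by blast
  have "normalisable n ((Alpha, b) # normal_word p)"
  proof (cases b)
    case True
    show ?thesis
    proof (cases "Suc (snd p) = 2 * n")
      case True
      have "(Alpha, b) # normal_word p = replicate (2 * n) alpha_letter @ normal_word (fst p, 0)"
        using \<open>b\<close> unfolding normal_word_def True[symmetric] by simp
      then have "word_cong ?R ((Alpha, b) # normal_word p) (normal_word (fst p, 0))"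
        using dicyclic_word_relations(1) by metis
      then show ?thesis unfolding normalisable_def using assms(2) by (intro exI[of _ "(fst p, 0)"]) simp
    next
      case False
      have "(Alpha, b) # normal_word p = normal_word (fst p, Suc (snd p))"
        using \<open>b\<close> unfolding normal_word_def by simp
      then show ?thesis unfolding normalisable_def using False p(1)
        by (intro exI[of _ "(fst p, Suc (snd p))"]) (auto intro: word_cong.refl)
    qed
  next
    case False
    show ?thesis
    proof (cases "snd p")
      case 0
      have "word_cong ?R (replicate (2 * n) alpha_letter @ normal_word p) (normal_word p)"
        by (rule dicyclic_word_relations)
      moreover have "replicate (2 * n) alpha_letter @ normal_word p
          = alpha_letter # normal_word (fst p, 2 * n - 1)"
        using 0 assms(2) unfolding normal_word_def by (cases n) auto
      ultimately have "word_cong ?R ((Alpha, b) # normal_word p)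
          ((Alpha, b) # alpha_letter # normal_word (fst p, 2 * n - 1))"
        by (metis word_cong.sym word_cong_Cons)
      moreover have "word_cong ?R ((Alpha, b) # alpha_letter # normal_word (fst p, 2 * n - 1))
          (normal_word (fst p, 2 * n - 1))"
        using word_cong_cancel[of ?R Alpha b] False by simp
      ultimately show ?thesis unfolding normalisable_def using assms(2)
        by (intro exI[of _ "(fst p, 2 * n - 1)"]) (auto intro: word_cong.trans)
    next
      case (Suc k)
      have "(Alpha, b) # normal_word p = (Alpha, b) # alpha_letter # normal_word (fst p, k)"
        unfolding normal_word_def Suc by simp
      then have "word_cong ?R ((Alpha, b) # normal_word p) (normal_word (fst p, k))"
        using word_cong_cancel[of ?R Alpha b] False by simp
      then show ?thesis unfolding normalisable_def using p(1) Suc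
        by (intro exI[of _ "(fst p, k)"]) simp
    qed
  qed
  then show ?thesis using word_cong_Cons[OF p(2)] normalisable_cong by blast
qed

lemma normalisable_alphas:
  assumes "normalisable n w" "n > 0"
  shows "normalisable n (replicate k (Alpha, b) @ w)"
  using assms by (induction k) (auto intro: normalisable_alpha)

lemma tau_past_alphas:
  "word_cong (dicyclic_relations n) (tau_letter # replicate k alpha_letter @ v)
     (replicate k (Alpha, False) @ tau_letter # v)"
proof (induction k)
  case (Suc k)
  have "word_cong (dicyclic_relations n) (tau_letter # alpha_letter # replicate k alpha_letter @ v)
      ((Alpha, False) # tau_letter # replicate k alpha_letter @ v)"
    by (rule dicyclic_word_relations)
  then show ?case using word_cong_Cons[OF Suc] by (auto intro: word_cong.trans)
qed (auto intro: word_cong.refl)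

lemma normalisable_Nil: "n > 0 \<Longrightarrow> normalisable n []"
  unfolding normalisable_def normal_word_def by (intro exI[of _ "(False, 0)"]) (auto intro: word_cong.refl)

lemma normalisable_tau:
  assumes "normalisable n w" "n > 0"
  shows "normalisable n (tau_letter # w)"
proof -
  let ?R = "dicyclic_relations n"
  obtain p where p: "snd p < 2 * n" "word_cong ?R w (normal_word p)"
    using assms(1) unfolding normalisable_def by blast
  have "normalisable n [tau_letter]"
    unfolding normalisable_def normal_word_def using assms(2)
    by (intro exI[of _ "(True, 0)"]) (auto intro: word_cong.refl)
  moreover have "normalisable n [tau_letter, tau_letter]"
    using dicyclic_word_relations(2)[of n "[]"] normalisable_alphas[OF normalisable_Nil, of n n True] assms(2)
      normalisable_cong by simp
  ultimately have "normalisable n (tau_letter # (if fst p then [tau_letter] else []))" by simp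
  then have "normalisable n (tau_letter # normal_word p)"
    unfolding normal_word_def using tau_past_alphas normalisable_alphas assms(2) normalisable_cong by blast
  then show ?thesis using word_cong_Cons[OF p(2)] normalisable_cong by blast
qed

text \<open>\<open>\<tau>^4 = \<alpha>^(2 n)\<close> is trivial, so \<open>\<tau>^3\<close> stands
  in for the inverse of \<open>\<tau>\<close>.\<close>

lemma normalisable_tau_inverse:
  assumes "normalisable n w" "n > 0"
  shows "normalisable n ((Tau, False) # w)"
proof -
  let ?R = "dicyclic_relations n"
  have "word_cong ?R (tau_letter # tau_letter # tau_letter # tau_letter # w)
      (replicate n alpha_letter @ tau_letter # tau_letter # w)"
    by (rule dicyclic_word_relations)
  moreover have "word_cong ?R (replicate n alpha_letter @ tau_letter # tau_letter # w)
      (replicate n alpha_letter @ replicate n alpha_letter @ w)"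
    by (intro word_cong_append dicyclic_word_relations)
  moreover have "word_cong ?R (replicate n alpha_letter @ replicate n alpha_letter @ w) w"
    using dicyclic_word_relations(1)[of n w] by (simp add: mult_2 replicate_add)
  ultimately have "word_cong ?R w (tau_letter # tau_letter # tau_letter # tau_letter # w)"
    by (meson word_cong.sym word_cong.trans)
  then have "word_cong ?R ((Tau, False) # w) ((Tau, False) # tau_letter # tau_letter # tau_letter # tau_letter # w)"
    by (rule word_cong_Cons)
  moreover have "word_cong ?R ((Tau, False) # tau_letter # tau_letter # tau_letter # tau_letter # w)
      (tau_letter # tau_letter # tau_letter # w)"
    using word_cong_cancel[of ?R Tau False] by simp
  ultimately show ?thesis using assms by (meson normalisable_cong normalisable_tau)
qed

lemma normalisable: "n > 0 \<Longrightarrow> normalisable n w"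
proof (induction w)
  case (Cons l w)
  obtain c b where l: "l = (c, b)" by force
  show ?case unfolding l
    using Cons normalisable_alpha normalisable_tau normalisable_tau_inverse by (cases c; cases b) auto
qed (rule normalisable_Nil)

lemma range_case_dicyclic_gen: "range (case_dicyclic_gen a t) = {a, t}"
proof
  show "range (case_dicyclic_gen a t) \<subseteq> {a, t}" by (auto split: dicyclic_gen.splits)
  show "{a, t} \<subseteq> range (case_dicyclic_gen a t)"
    using rangeI[of "case_dicyclic_gen a t" Alpha] rangeI[of "case_dicyclic_gen a t" Tau] by simp
qed

text \<open>Every word is congruent to one of \<open>4 n\<close> normal words. In a group of order
  \<open>4 n\<close> their values exhaust the carrier and are therefore distinct, so words of equal
  value share their normal word.\<close>

theorem (in group) dicyclic_presentationI:
  assumes n: "n > 0" and \<alpha>: "\<alpha> \<in> carrier G" and \<tau>: "\<tau> \<in> carrier G"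
    and gen: "generate G {\<alpha>, \<tau>} = carrier G" and card: "card (carrier G) = 4 * n"
    and rel: "\<alpha> [^] (2 * n) = \<one>" "\<tau> \<otimes> \<tau> = \<alpha> [^] n" "\<tau> \<otimes> \<alpha> = inv \<alpha> \<otimes> \<tau>"
  shows "dicyclic_presentation n G \<alpha> \<tau>"
proof -
  let ?f = "case_dicyclic_gen \<alpha> \<tau>" and ?R = "dicyclic_relations n"
  have range: "range ?f \<subseteq> carrier G" unfolding range_case_dicyclic_gen using \<alpha> \<tau> by simp
  have sound: "eval_word G ?f u = eval_word G ?f v" if "word_cong ?R u v" for u v
  proof (rule word_cong_eval[OF that range])
    fix l r assume "(l, r) \<in> ?R"
    then show "eval_word G ?f l = eval_word G ?f r"
      unfolding dicyclic_relations_def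
      using rel \<alpha> \<tau> eval_word_replicate[OF range, of _ Alpha] by auto
  qed
  define P where "P = (UNIV :: bool set) \<times> {..<2 * n}"
  have cardP: "card P = 4 * n" "finite P" unfolding P_def by (auto simp: card_cartesian_product)
  have "carrier G \<subseteq> (\<lambda>p. eval_word G ?f (normal_word p)) ` P"
  proof
    fix x assume "x \<in> carrier G"
    then obtain w where w: "x = eval_word G ?f w"
      using generate_eval_word[OF range] gen unfolding range_case_dicyclic_gen by blast
    obtain p where "snd p < 2 * n" "word_cong ?R w (normal_word p)"
      using normalisable[OF n] unfolding normalisable_def by blast
    then show "x \<in> (\<lambda>p. eval_word G ?f (normal_word p)) ` P"
      using sound w unfolding P_def by (intro image_eqI[of _ _ p]) (auto simp: mem_Times_iff)
  qed
  then have "(\<lambda>p. eval_word G ?f (normal_word p)) ` P = carrier G"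
    using eval_word_closed[OF range] by blast
  then have inj: "inj_on (\<lambda>p. eval_word G ?f (normal_word p)) P"
    using cardP card by (intro eq_card_imp_inj_on) auto
  have "word_cong ?R u v" if eq: "eval_word G ?f u = eval_word G ?f v" for u v
  proof -
    obtain p where p: "snd p < 2 * n" "word_cong ?R u (normal_word p)"
      using normalisable[OF n] unfolding normalisable_def by blast
    obtain q where q: "snd q < 2 * n" "word_cong ?R v (normal_word q)"
      using normalisable[OF n] unfolding normalisable_def by blast
    have "p = q" using inj_onD[OF inj] sound[OF p(2)] sound[OF q(2)] eq p(1) q(1)
      unfolding P_def by (auto simp: mem_Times_iff)
    then show ?thesis using p(2) q(2) word_cong.sym word_cong.trans by blast
  qed
  then show ?thesis unfolding dicyclic_presentation_def has_presentation_def
    using is_group range gen sound unfolding range_case_dicyclic_gen by blast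
qed

text \<open>Right multiplication by a letter on the normal forms \<open>\<alpha>\<^sup>a\<close> and \<open>\<alpha>\<^sup>a \<tau>\<close>, encoded as
  \<open>(False, a)\<close> and \<open>(True, a)\<close>: this model shows that no further relations hold.\<close>

definition act :: "nat \<Rightarrow> bool \<times> int \<Rightarrow> dicyclic_gen \<times> bool \<Rightarrow> bool \<times> int" where
  "act n x l = (case fst l of
      Alpha \<Rightarrow> (fst x, snd x + (if snd l \<noteq> fst x then 1 else - 1))
    | Tau \<Rightarrow> (if snd l then (\<not> fst x, if fst x then snd x + int n else snd x)
              else (\<not> fst x, if fst x then snd x else snd x - int n)))"

definition same_elt :: "nat \<Rightarrow> bool \<times> int \<Rightarrow> bool \<times> int \<Rightarrow> bool" where
  "same_elt n x y \<longleftrightarrow> fst x = fst y \<and> int (2 * n) dvd snd x - snd y"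

lemma same_elt_refl: "same_elt n x x" and same_elt_sym: "same_elt n x y \<Longrightarrow> same_elt n y x"
  and same_elt_trans: "same_elt n x y \<Longrightarrow> same_elt n y z \<Longrightarrow> same_elt n x z"
  unfolding same_elt_def using dvd_diff_commute dvd_add[of "int (2 * n)" "snd x - snd y" "snd y - snd z"] by auto

lemma act_same_elt: "same_elt n x y \<Longrightarrow> same_elt n (foldl (act n) x w) (foldl (act n) y w)"
proof (induction w arbitrary: x y)
  case (Cons l w)
  have "same_elt n (act n x l) (act n y l)"
    using Cons.prems unfolding same_elt_def act_def by (cases "fst l") auto
  then show ?case using Cons.IH by simp
qed simp

lemma act_replicate_alpha:
  "foldl (act n) x (replicate k alpha_letter) = (fst x, snd x + (if fst x then - int k else int k))"
  by (induction k arbitrary: x) (auto simp: act_def)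

text \<open>Both sides of each relation act alike on all normal forms. Hence the action tells normal
  forms apart in a group known by its presentation alone.\<close>

lemma word_cong_act:
  assumes "word_cong (dicyclic_relations n) u v"
  shows "same_elt n (foldl (act n) x u) (foldl (act n) x v)"
  using assms
proof (induction arbitrary: x)
  case (cancel u c b v)
  have "foldl (act n) y [(c, b), (c, \<not> b)] = y" for y
    by (cases y; cases c; cases b) (auto simp: act_def)
  then show ?case by (simp add: same_elt_refl)
next
  case (relation l r u v)
  have "same_elt n (foldl (act n) y l) (foldl (act n) y r)" for y
    using relation unfolding dicyclic_relations_def
    by (cases y) (auto simp: act_replicate_alpha same_elt_def act_def)
  then show ?case using act_same_elt by simp
qed (blast intro: same_elt_refl same_elt_sym same_elt_trans)+

section \<open>Products in a dicyclic group\<close>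

lemma mset_image_mset_list:
  assumes "mset xs = image_mset f M"
  obtains ys where "mset ys = M" "map f ys = xs"
  using assms
proof (induction xs arbitrary: M thesis)
  case Nil
  then show ?case by simp
next
  case (Cons x xs)
  obtain y M' where "M = add_mset y M'" "f y = x" "image_mset f M' = mset xs"
    using msed_map_invR[of f M x "mset xs"] Cons.prems(2) by auto
  moreover obtain ys where "mset ys = M'" "map f ys = xs" using Cons.IH[of M'] calculation(3) by metis
  ultimately show ?case using Cons.prems(1)[of "y # ys"] by simp
qed

lemma dvd_mod_minus: "m dvd a mod m - (a :: int)"
  by (metis dvd_diff_commute dvd_minus_mod)

text \<open>Exponents are left unreduced; \<open>same_elt\<close> identifies them modulo
  \<open>2 n\<close>.\<close>

definition mul :: "nat \<Rightarrow> bool \<times> int \<Rightarrow> bool \<times> int \<Rightarrow> bool \<times> int" where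
  "mul n p q = (fst p \<noteq> fst q,
     if fst p then snd p - snd q + (if fst q then int n else 0) else snd p + snd q)"

lemma foldr_mul_alphas:
  assumes "\<And>p. p \<in> set xs \<Longrightarrow> \<not> fst p"
  shows "foldr (mul n) xs p = (fst p, sum_list (map snd xs) + snd p)"
  using assms by (induction xs) (auto simp: mul_def)

lemma fst_foldr_mul: "fst (foldr (mul n) xs (False, 0)) = odd (length (filter fst xs))"
  by (induction xs) (auto simp: mul_def)

lemma foldr_mul_tau_pairs:
  assumes "length bs = length cs" "\<And>p. p \<in> set bs \<union> set cs \<Longrightarrow> fst p"
  shows "foldr (mul n) (concat (map2 (\<lambda>b c. [b, c]) bs cs)) (False, 0)
    = (False, sum_list (map snd bs) - sum_list (map snd cs) + int n * int (length bs))"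
  using assms by (induction bs cs rule: list_induct2) (auto simp: mul_def algebra_simps)

lemma mset_concat_pairs:
  "length bs = length cs \<Longrightarrow> mset (concat (map2 (\<lambda>b c. [b, c]) bs cs)) = mset bs + mset cs"
  by (induction bs cs rule: list_induct2) auto

locale dicyclic_presented = group G for G (structure) +
  fixes n :: nat and \<alpha> \<tau>
  assumes n2: "n \<ge> 2" and pres: "dicyclic_presentation n G \<alpha> \<tau>"
begin

abbreviation gens :: "dicyclic_gen \<Rightarrow> 'a" where "gens \<equiv> case_dicyclic_gen \<alpha> \<tau>"

lemma gens_range: "range gens \<subseteq> carrier G" and gens_generate: "generate G {\<alpha>, \<tau>} = carrier G"
  and eval_eq_iff: "eval_word G gens u = eval_word G gens v \<longleftrightarrow> word_cong (dicyclic_relations n) u v"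
  using pres unfolding dicyclic_presentation_def has_presentation_def range_case_dicyclic_gen by auto

lemma \<alpha>_closed [simp]: "\<alpha> \<in> carrier G" and \<tau>_closed [simp]: "\<tau> \<in> carrier G"
  using gens_range unfolding range_case_dicyclic_gen by auto

lemma eval_alphas: "eval_word G gens (replicate k alpha_letter) = \<alpha> [^] k"
  using eval_word_replicate[OF gens_range, of k Alpha] by simp

lemma alpha_power: "\<alpha> [^] (2 * n) = \<one>"
proof -
  have "word_cong (dicyclic_relations n) (replicate (2 * n) alpha_letter @ []) []"
    by (rule dicyclic_word_relations)
  then show ?thesis using eval_eq_iff[of "replicate (2 * n) alpha_letter" "[]"] eval_alphas by simp
qed

lemma tau_square: "\<tau> \<otimes> \<tau> = \<alpha> [^] n"
proof -
  have "word_cong (dicyclic_relations n) [tau_letter, tau_letter] (replicate n alpha_letter @ [])"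
    by (rule dicyclic_word_relations)
  then show ?thesis using eval_eq_iff[of "[tau_letter, tau_letter]" "replicate n alpha_letter"] eval_alphas by simp
qed

lemma tau_alpha: "\<tau> \<otimes> \<alpha> = inv \<alpha> \<otimes> \<tau>"
proof -
  have "word_cong (dicyclic_relations n) [tau_letter, alpha_letter] [(Alpha, False), tau_letter]"
    by (rule dicyclic_word_relations)
  then show ?thesis using eval_eq_iff[of "[tau_letter, alpha_letter]" "[(Alpha, False), tau_letter]"] by simp
qed

lemma alpha_int_power_add: "\<alpha> [^] (a + b :: int) = \<alpha> [^] a \<otimes> \<alpha> [^] b"
  by (simp add: int_pow_mult)

lemma tau_alpha_nat: "\<tau> \<otimes> \<alpha> [^] int k = \<alpha> [^] (- int k) \<otimes> \<tau>"
proof (induction k)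
  case (Suc k)
  have "\<alpha> [^] (- 1 :: int) \<otimes> \<alpha> [^] (1 :: int) = \<one>" using alpha_int_power_add[of "- 1" 1] by simp
  then have inv: "inv \<alpha> = \<alpha> [^] (- 1 :: int)" by (intro inv_equality) (auto simp: int_pow_1)
  have "\<tau> \<otimes> \<alpha> [^] int (Suc k) = \<tau> \<otimes> \<alpha> [^] int k \<otimes> \<alpha>"
    using alpha_int_power_add[of "int k" 1] by (simp add: int_pow_1 m_assoc add.commute)
  also have "\<dots> = \<alpha> [^] (- int k) \<otimes> (\<tau> \<otimes> \<alpha>)" unfolding Suc by (simp add: m_assoc)
  also have "\<dots> = \<alpha> [^] (- int k) \<otimes> \<alpha> [^] (- 1 :: int) \<otimes> \<tau>" unfolding tau_alpha inv by (simp add: m_assoc)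
  also have "\<alpha> [^] (- int k) \<otimes> \<alpha> [^] (- 1 :: int) = \<alpha> [^] (- int k + - 1)"
    by (rule alpha_int_power_add[symmetric])
  also have "- int k + - 1 = - int (Suc k)" by simp
  finally show ?case .
qed simp

lemma alpha_power_cong:
  assumes "int (2 * n) dvd a - b"
  shows "\<alpha> [^] a = \<alpha> [^] b"
proof -
  obtain k where k: "a - b = int (2 * n) * k" using assms by blast
  have "\<alpha> [^] int (2 * n) = \<one>" using alpha_power by (simp only: int_pow_int)
  then have "\<alpha> [^] (a - b) = \<one>" unfolding k using int_pow_pow[of \<alpha> "int (2 * n)" k] by simp
  then show ?thesis using alpha_int_power_add[of "a - b" b] by simp
qed

text \<open>Reduction modulo \<open>2 n\<close> makes the exponent nonnegative, where induction is
  possible.\<close>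

lemma tau_alpha_int: "\<tau> \<otimes> \<alpha> [^] a = \<alpha> [^] (- a :: int) \<otimes> \<tau>"
proof -
  define k where "k = nat (a mod int (2 * n))"
  have k: "int k = a mod int (2 * n)" unfolding k_def using n2 by simp
  have "\<alpha> [^] a = \<alpha> [^] int k" unfolding k
    by (rule alpha_power_cong) (metis dvd_diff_commute dvd_mod_minus)
  moreover have "\<alpha> [^] (- a) = \<alpha> [^] (- int k)" unfolding k
    by (rule alpha_power_cong) (use dvd_mod_minus[of "int (2 * n)" a] in simp)
  ultimately show ?thesis using tau_alpha_nat by simp
qed

definition el :: "bool \<times> int \<Rightarrow> 'a" where
  "el p = (if fst p then \<alpha> [^] snd p \<otimes> \<tau> else \<alpha> [^] snd p)"

lemma el_closed [simp]: "el p \<in> carrier G" unfolding el_def by simp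

lemma el_mult: "el p \<otimes> el q = el (mul n p q)"
proof (cases "fst p")
  case True
  have "\<alpha> [^] snd p \<otimes> \<tau> \<otimes> \<alpha> [^] snd q = \<alpha> [^] snd p \<otimes> (\<tau> \<otimes> \<alpha> [^] snd q)" by (simp add: m_assoc)
  also have "\<dots> = \<alpha> [^] (snd p - snd q) \<otimes> \<tau>"
    unfolding tau_alpha_int using alpha_int_power_add[of "snd p" "- snd q"] by (simp add: m_assoc)
  finally have *: "\<alpha> [^] snd p \<otimes> \<tau> \<otimes> \<alpha> [^] snd q = \<alpha> [^] (snd p - snd q) \<otimes> \<tau>" .
  have "\<alpha> [^] snd p \<otimes> \<tau> \<otimes> (\<alpha> [^] snd q \<otimes> \<tau>) = \<alpha> [^] (snd p - snd q) \<otimes> (\<tau> \<otimes> \<tau>)"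
    using * by (simp add: m_assoc[symmetric])
  also have "\<dots> = \<alpha> [^] (snd p - snd q + int n)"
    unfolding tau_square alpha_int_power_add by (simp add: int_pow_int)
  finally show ?thesis using * True unfolding el_def mul_def by auto
next
  case False
  then show ?thesis unfolding el_def mul_def by (simp add: alpha_int_power_add m_assoc)
qed

lemma el_one: "el (False, 0) = \<one>" unfolding el_def by simp

text \<open>Equal elements have congruent normal words, and these act on \<open>(False, 0)\<close>
  by producing \<open>p\<close> and \<open>q\<close> themselves, with exponents reduced modulo
  \<open>2 n\<close>.\<close>

lemma el_eq_iff: "el p = el q \<longleftrightarrow> same_elt n p q"
proof
  assume "same_elt n p q"
  then show "el p = el q" unfolding same_elt_def el_def using alpha_power_cong[of "snd p" "snd q"] by simp
next
  assume eq: "el p = el q"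
  define w where "w p = normal_word (fst p, nat (snd p mod int (2 * n)))" for p :: "bool \<times> int"
  have ev: "eval_word G gens (w p) = el p" for p
  proof -
    have "\<alpha> [^] nat (snd p mod int (2 * n)) = \<alpha> [^] int (nat (snd p mod int (2 * n)))"
      by (simp add: int_pow_int)
    also have "\<dots> = \<alpha> [^] snd p" using dvd_mod_minus[of "int (2 * n)" "snd p"] n2 by (intro alpha_power_cong) simp
    finally show ?thesis unfolding w_def normal_word_def el_def
      by (simp add: eval_word_append[OF gens_range] eval_alphas)
  qed
  have act: "foldl (act n) (False, 0) (w p) = (fst p, snd p mod int (2 * n))" for p
    unfolding w_def normal_word_def using n2 by (cases p) (auto simp: act_replicate_alpha act_def)
  have "word_cong (dicyclic_relations n) (w p) (w q)" using eq ev eval_eq_iff by metis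
  from word_cong_act[OF this, of "(False, 0)"] have "same_elt n (fst p, snd p mod int (2 * n)) (fst q, snd q mod int (2 * n))"
    unfolding act .
  then show "same_elt n p q" unfolding same_elt_def by (simp flip: mod_eq_dvd_iff)
qed

lemma carrier_eq: "carrier G = range el"
proof
  show "carrier G \<subseteq> range el"
  proof
    fix x assume "x \<in> carrier G"
    then have "x \<in> generate G {\<alpha>, \<tau>}" unfolding gens_generate .
    then show "x \<in> range el"
    proof induction
      case one
      show ?case using el_one by (metis rangeI)
    next
      case (incl h)
      then have "h = el (False, 1) \<or> h = el (True, 0)" unfolding el_def by (auto simp: int_pow_1)
      then show ?case by blast
    next
      case (inv h)
      then have h: "h = el (False, 1) \<or> h = el (True, 0)" unfolding el_def by (auto simp: int_pow_1)
      have "el (False, - 1) \<otimes> el (False, 1) = \<one>" "el (True, int n) \<otimes> el (True, 0) = \<one>"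
        unfolding el_mult unfolding mul_def el_one[symmetric] el_eq_iff same_elt_def by auto
      then have "inv (el (False, 1)) = el (False, - 1)" "inv (el (True, 0)) = el (True, int n)"
        by (auto intro: inv_equality)
      then show ?case using h by auto
    next
      case (eng h1 h2)
      then show ?case using el_mult by blast
    qed
  qed
qed auto

lemma el_reduce: "el (b, a mod int (2 * n)) = el (b, a)"
  unfolding el_eq_iff same_elt_def using dvd_mod_minus by simp

lemma order_eq: "order G = 4 * n"
proof -
  have "carrier G = el ` (UNIV \<times> {0..<int (2 * n)})"
  proof
    show "carrier G \<subseteq> el ` (UNIV \<times> {0..<int (2 * n)})"
    proof
      fix x assume "x \<in> carrier G"
      then obtain b a where "x = el (b, a)" unfolding carrier_eq by force
      then show "x \<in> el ` (UNIV \<times> {0..<int (2 * n)})"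
        using n2 by (intro image_eqI[of _ _ "(b, a mod int (2 * n))"]) (auto simp: el_reduce simp del: of_nat_mult)
    qed
  qed auto
  moreover have "inj_on el (UNIV \<times> {0..<int (2 * n)})"
  proof (rule inj_onI)
    fix p q assume pq: "p \<in> UNIV \<times> {0..<int (2 * n)}" "q \<in> UNIV \<times> {0..<int (2 * n)}" "el p = el q"
    then have "fst p = fst q" "snd p mod int (2 * n) = snd q mod int (2 * n)"
      unfolding el_eq_iff same_elt_def by (auto simp: mod_eq_dvd_iff)
    then show "p = q" using pq(1,2) by (cases p; cases q) auto
  qed
  ultimately show ?thesis unfolding order_def by (simp add: card_image card_cartesian_product)
qed

lemma foldr_el: "foldr (\<otimes>) (map el xs) \<one> = el (foldr (mul n) xs (False, 0))"
  by (induction xs) (auto simp: el_one el_mult)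

lemma product_one_el:
  "product_one G (image_mset el M) \<longleftrightarrow>
    (\<exists>xs. mset xs = M \<and> same_elt n (foldr (mul n) xs (False, 0)) (False, 0))"
proof
  assume "product_one G (image_mset el M)"
  then obtain xs where xs: "mset xs = image_mset el M" "foldr (\<otimes>) xs \<one> = \<one>" unfolding product_one_def by blast
  obtain ys where ys: "mset ys = M" "map el ys = xs" using mset_image_mset_list[OF xs(1)] .
  have "el (foldr (mul n) ys (False, 0)) = el (False, 0)" using foldr_el[of ys] xs(2) ys(2) el_one by simp
  then show "\<exists>xs. mset xs = M \<and> same_elt n (foldr (mul n) xs (False, 0)) (False, 0)"
    using ys(1) unfolding el_eq_iff by blast
next
  assume "\<exists>xs. mset xs = M \<and> same_elt n (foldr (mul n) xs (False, 0)) (False, 0)"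
  then obtain xs where xs: "mset xs = M" "el (foldr (mul n) xs (False, 0)) = el (False, 0)"
    unfolding el_eq_iff by blast
  then show "product_one G (image_mset el M)"
    unfolding product_one_def using foldr_el[of xs] el_one
    by (intro exI[of _ "map el xs"]) simp
qed

lemma alpha_part_product_one:
  assumes "zero_sum_sub (2 * n) L (\<lambda>x. x) (alpha_part M)"
  shows "has_product_one_subseq G L (image_mset el M)"
proof -
  have "zero_sum_sub (2 * n) L snd (filter_mset (\<lambda>g. \<not> fst g) M)"
    using zero_sum_sub_image[OF assms] .
  then obtain U where U: "U \<subseteq># filter_mset (\<lambda>g. \<not> fst g) M" "size U = L" "int (2 * n) dvd (\<Sum>g\<in>#U. snd g)"
    unfolding zero_sum_sub_def by blast
  obtain xs where xs: "mset xs = U" using ex_mset by blast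
  have "\<not> fst p" if "p \<in> set xs" for p
    using that U(1) xs by (metis (mono_tags, lifting) mem_Collect_eq mset_subset_eqD set_mset_filter set_mset_mset)
  then have "foldr (mul n) xs (False, 0) = (False, sum_list (map snd xs))" by (subst foldr_mul_alphas) auto
  moreover have "sum_list (map snd xs) = (\<Sum>g\<in>#U. snd g)" unfolding xs[symmetric] by (simp flip: sum_mset_sum_list)
  ultimately have "product_one G (image_mset el U)"
    unfolding product_one_el using U(3) xs by (intro exI[of _ xs]) (simp add: same_elt_def)
  moreover have "U \<subseteq># M" using U(1) multiset_filter_subset by (rule subset_mset.order_trans)
  then have "image_mset el U \<subseteq># image_mset el M" by (rule image_mset_subseteq_mono)
  ultimately show ?thesis unfolding has_product_one_subseq_def using U(2)
    by (intro exI[of _ "image_mset el U"]) simp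
qed

text \<open>The first list of \<open>\<alpha>\<close>-powers stands before the first \<open>\<tau>\<close>, the second one between the first
  two, so that the exponents of the latter enter with a minus sign.\<close>

lemma signed_product_one_product_one:
  assumes "signed_product_one n L M"
  shows "has_product_one_subseq G L (image_mset el M)"
  using assms unfolding signed_product_one_def
proof (elim disjE exE conjE)
  fix U V
  assume UV: "U + V \<subseteq># M" "size U + size V = L" "tau_count U = tau_count V" "tau_count U > 0"
    "int (2 * n) dvd (\<Sum>g\<in>#U. snd g) - (\<Sum>g\<in>#V. snd g) + int n * int (tau_count U)"
  have split: "\<exists>as b bs. W = mset as + mset (b # bs) \<and> (\<forall>p\<in>set as. \<not> fst p) \<and> (\<forall>p\<in>set (b # bs). fst p) \<and>
      length (b # bs) = tau_count W" if "tau_count W > 0" for W :: "(bool \<times> int) multiset"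
  proof -
    obtain as where as: "mset as = filter_mset (\<lambda>g. \<not> fst g) W" using ex_mset by blast
    obtain bs where bs: "mset bs = filter_mset fst W" using ex_mset by blast
    have "length bs = tau_count W" using arg_cong[OF bs, of size] by simp
    then have "bs \<noteq> []" using that by (metis less_irrefl list.size(3))
    then obtain b bs' where b: "bs = b # bs'" by (cases bs) auto
    have "W = mset as + mset bs" unfolding as bs by simp
    moreover have "\<forall>p\<in>set as. \<not> fst p" using arg_cong[OF as, of set_mset] by auto
    moreover have "\<forall>p\<in>set bs. fst p" using arg_cong[OF bs, of set_mset] by auto
    ultimately show ?thesis using \<open>length bs = tau_count W\<close> unfolding b by blast
  qed
  obtain us b bs where U: "U = mset us + mset (b # bs)" "\<forall>p\<in>set us. \<not> fst p" "\<forall>p\<in>set (b # bs). fst p"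
      "length (b # bs) = tau_count U" using split[OF UV(4)] by blast
  obtain vs c cs where V: "V = mset vs + mset (c # cs)" "\<forall>p\<in>set vs. \<not> fst p" "\<forall>p\<in>set (c # cs). fst p"
      "length (c # cs) = tau_count V" using split[of V] UV(3,4) by auto
  have len: "length bs = length cs" using U(4) V(4) UV(3) by simp
  define xs where "xs = us @ b # vs @ c # concat (map2 (\<lambda>b c. [b, c]) bs cs)"
  have "mset xs = U + V" unfolding xs_def U(1) V(1) using mset_concat_pairs[OF len] by simp
  have sums: "(\<Sum>g\<in>#U. snd g) = sum_list (map snd us) + snd b + sum_list (map snd bs)"
    "(\<Sum>g\<in>#V. snd g) = sum_list (map snd vs) + snd c + sum_list (map snd cs)"
    unfolding U(1) V(1) by (simp_all flip: sum_mset_sum_list)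
  have pairs: "foldr (mul n) (concat (map2 (\<lambda>b c. [b, c]) bs cs)) (False, 0)
      = (False, sum_list (map snd bs) - sum_list (map snd cs) + int n * int (length bs))"
    by (rule foldr_mul_tau_pairs[OF len]) (use U(3) V(3) in auto)
  have "foldr (mul n) xs (False, 0) = (False, (\<Sum>g\<in>#U. snd g) - (\<Sum>g\<in>#V. snd g) + int n * int (tau_count U))"
    unfolding xs_def sums U(4)[symmetric] using U(2,3) V(2,3)
    by (simp add: foldr_mul_alphas pairs mul_def algebra_simps)
  then have "product_one G (image_mset el (U + V))"
    unfolding product_one_el using UV(5) \<open>mset xs = U + V\<close> by (intro exI[of _ xs]) (simp add: same_elt_def)
  moreover have "image_mset el (U + V) \<subseteq># image_mset el M" using UV(1) by (rule image_mset_subseteq_mono)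
  moreover have "size (image_mset el (U + V)) = L" using UV(2) by simp
  ultimately show ?thesis unfolding has_product_one_subseq_def by blast
qed (rule alpha_part_product_one)

text \<open>Parity keeps the only term \<open>\<alpha>^b \<tau>\<close> out of the selection, and
  the order of powers of \<open>\<alpha>\<close> is irrelevant.\<close>

lemma product_one_few_taus:
  assumes "has_product_one_subseq G L (image_mset el M)" "tau_count M \<le> 1"
  shows "zero_sum_sub (2 * n) L (\<lambda>x. x) (alpha_part M)"
proof -
  obtain T where T: "T \<subseteq># image_mset el M" "size T = L" "product_one G T"
    using assms(1) unfolding has_product_one_subseq_def by blast
  obtain U where U: "U \<subseteq># M" "image_mset el U = T" using sub_mset_image_mset[OF T(1)] .
  obtain xs where xs: "mset xs = U" "same_elt n (foldr (mul n) xs (False, 0)) (False, 0)"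
    using T(3) unfolding U(2)[symmetric] product_one_el by blast
  have "tau_count U = length (filter fst xs)" unfolding xs(1)[symmetric] by (simp flip: mset_filter)
  moreover have "even (length (filter fst xs))" using xs(2) unfolding same_elt_def fst_foldr_mul by simp
  moreover have "tau_count U \<le> tau_count M" by (intro size_mset_mono multiset_filter_mono U(1))
  ultimately have "length (filter fst xs) = 0" using assms(2) by (metis One_nat_def dvd_0_right le_antisym le_trans not_less_eq_eq odd_one le_0_eq)
  then have nf: "\<not> fst p" if "p \<in> set xs" for p using that by (auto simp: filter_empty_conv)
  then have "foldr (mul n) xs (False, 0) = (False, sum_list (map snd xs))" by (subst foldr_mul_alphas) auto
  moreover have "sum_list (map snd xs) = (\<Sum>g\<in>#U. snd g)" unfolding xs(1)[symmetric] by (simp flip: sum_mset_sum_list)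
  ultimately have "int (2 * n) dvd (\<Sum>x\<in>#image_mset snd U. x)" using xs(2) unfolding same_elt_def by simp
  moreover have "filter_mset (\<lambda>g. \<not> fst g) U = U" using nf xs(1) by (intro filter_mset_allI) (metis set_mset_mset)
  then have "image_mset snd U \<subseteq># alpha_part M"
    using U(1) by (metis image_mset_subseteq_mono multiset_filter_mono)
  moreover have "size (image_mset snd U) = L" using U(2) T(2) by auto
  ultimately show ?thesis unfolding zero_sum_sub_def by blast
qed

lemma ex_image_el:
  assumes "set_mset S \<subseteq> carrier G"
  obtains M where "S = image_mset el M"
proof -
  have "\<exists>M. S = image_mset el M" using assms
  proof (induction S)
    case (add x S)
    then obtain M p where "S = image_mset el M" "x = el p" unfolding carrier_eq by auto
    then show ?case by (intro exI[of _ "add_mset p M"]) simp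
  qed simp
  then show ?thesis using that by blast
qed

end

section \<open>Extremal sequences over a dicyclic group\<close>

text \<open>The families for general \<open>n\<close> in one formula: \<open>L = 2 * n\<close> is
  the case of the exponent for even \<open>n\<close>, \<open>L = 4 * n\<close> that of the group
  order. For \<open>n = 2\<close> it covers the first exceptional family.\<close>

definition extremal_form :: "('a, 'b) monoid_scheme \<Rightarrow> nat \<Rightarrow> nat \<Rightarrow> 'a \<Rightarrow> 'a \<Rightarrow> 'a multiset \<Rightarrow> bool" where
  "extremal_form G n L \<alpha> \<tau> S \<longleftrightarrow>
    (\<exists>r1\<in>{0..2 * n - 1}. \<exists>r2\<in>{0..2 * n - 1}. \<exists>r3\<in>{0..2 * n - 1}.
       gcd (int r1 - int r2) (2 * int n) = 1 \<and>
       S = replicate_mset (L - 1) (\<alpha> [^]\<^bsub>G\<^esub> r1) + replicate_mset (2 * n - 1) (\<alpha> [^]\<^bsub>G\<^esub> r2)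
           + {#\<alpha> [^]\<^bsub>G\<^esub> r3 \<otimes>\<^bsub>G\<^esub> \<tau>#})"

context dicyclic_presented
begin

lemma el_nat: "el (False, int r) = \<alpha> [^] r" "el (True, int r) = \<alpha> [^] r \<otimes> \<tau>"
  unfolding el_def by (simp_all add: int_pow_int)

lemma extremal_form_no_product_one:
  assumes ext: "extremal_form G n L \<alpha> \<tau> S" and L: "2 * n dvd L" "L > 0"
  shows "size S + 1 = L + 2 * n" "set_mset S \<subseteq> carrier G" "\<not> has_product_one_subseq G L S"
proof -
  obtain r1 r2 r3 where r: "r1 \<in> {0..2 * n - 1}" "r2 \<in> {0..2 * n - 1}" "r3 \<in> {0..2 * n - 1}"
    "gcd (int r1 - int r2) (2 * int n) = 1"
    "S = replicate_mset (L - 1) (\<alpha> [^] r1) + replicate_mset (2 * n - 1) (\<alpha> [^] r2) + {#\<alpha> [^] r3 \<otimes> \<tau>#}"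
    using ext[unfolded extremal_form_def] by (elim bexE conjE) (rule that)
  show "size S + 1 = L + 2 * n" unfolding r(5) using L n2 by simp
  show "set_mset S \<subseteq> carrier G" unfolding r(5) by (auto split: if_splits)
  define M where "M = replicate_mset (L - 1) (False, int r1) + replicate_mset (2 * n - 1) (False, int r2) + {#(True, int r3)#}"
  have S: "S = image_mset el M" unfolding r(5) M_def by (simp add: el_nat)
  have "filter_mset fst (replicate_mset k (False, x)) = {#}" for k and x :: int by (induction k) auto
  then have tau_count: "tau_count M \<le> 1" unfolding M_def by simp
  have "filter_mset (\<lambda>g. \<not> fst g) (replicate_mset k (False, x)) = replicate_mset k (False, x)" for k and x :: int
    by (induction k) auto
  then have alpha: "alpha_part M = replicate_mset (L - 1) (int r1) + replicate_mset (2 * n - 1) (int r2)"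
    unfolding M_def by simp
  have "r1 < 2 * n" "r2 < 2 * n" using r(1,2) n2 by auto
  then have "residues_mod (2 * n) (alpha_part M) = replicate_mset (L - 1) (int r1) + replicate_mset (2 * n - 1) (int r2)"
    unfolding alpha by simp
  moreover have "coprime (int r1 - int r2) (int (2 * n))" using r(4) by (simp add: coprime_iff_gcd_eq_1)
  ultimately have "\<not> zero_sum_sub (2 * n) L (\<lambda>x. x) (alpha_part M)"
    using L by (intro extremal_no_zero_sum)
  then show "\<not> has_product_one_subseq G L S" unfolding S using product_one_few_taus tau_count by blast
qed

text \<open>The Erdos-Ginzburg-Ziv theorem bounds the number of powers of \<open>\<alpha>\<close> by
  \<open>L + 2 * n - 2\<close>; the given length then forces exactly one further term and an
  extremal sequence modulo \<open>2 * n\<close>.\<close>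

lemma few_taus_extremal_form:
  assumes L: "L = 2 * n \<or> L = 4 * n" and S: "S = image_mset el M" and tau_count: "tau_count M \<le> 1"
    and size: "L + 2 * n \<le> size S + 1" and no: "\<not> has_product_one_subseq G L S"
  shows "size S + 1 = L + 2 * n" "extremal_form G n L \<alpha> \<tau> S"
proof -
  define A where "A = alpha_part M"
  have sizeA: "size A + tau_count M = size S" unfolding A_def S using size_alpha_part[of M] by simp
  have noz: "\<not> zero_sum_sub (2 * n) L (\<lambda>x. x) A" unfolding A_def using no alpha_part_product_one S by blast
  have "\<not> (L + 2 * n \<le> size A + 1)" using EGZ[of "2 * n" L A "\<lambda>x. x"] noz L n2 by auto
  then have taus1: "tau_count M = 1" and sizeA': "size A + 2 = L + 2 * n" using sizeA tau_count size by linarith+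
  then show "size S + 1 = L + 2 * n" using sizeA by simp
  obtain a b where ab: "residues_mod (2 * n) A = replicate_mset (L - 1) a + replicate_mset (2 * n - 1) b"
    "coprime (a - b) (int (2 * n))"
    using extremal_abelian[of "2 * n" L A] n2 L sizeA' noz by auto
  have range: "x \<in> {0..<int (2 * n)}" if "x \<in># residues_mod (2 * n) A" for x using that n2 by auto
  have mem: "a \<in># residues_mod (2 * n) A" "b \<in># residues_mod (2 * n) A" unfolding ab(1) using L n2 by auto
  obtain r1 where r1: "a = int r1" "r1 < 2 * n" using range[OF mem(1)] by (cases a) auto
  obtain r2 where r2: "b = int r2" "r2 < 2 * n" using range[OF mem(2)] by (cases b) auto
  obtain g where g: "filter_mset fst M = {#g#}" using taus1 size_1_singleton_mset by blast
  have "g \<in># filter_mset fst M" unfolding g by simp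
  then have "fst g" by simp
  obtain r3 where r3: "int r3 = snd g mod int (2 * n)" using n2 by (metis of_nat_0_le_iff pos_mod_sign of_nat_0_less_iff mult_pos_pos zero_less_numeral zero_le_imp_eq_int order_less_le_trans)
  have "r3 < 2 * n" using r3 n2 by (metis of_nat_less_iff pos_mod_bound of_nat_0_less_iff mult_pos_pos zero_less_numeral order_less_le_trans)
  have "image_mset el (filter_mset (\<lambda>g. \<not> fst g) M) = image_mset (\<lambda>x. el (False, x)) (residues_mod (2 * n) A)"
    unfolding A_def by (induction M) (auto simp: el_reduce[unfolded of_nat_mult of_nat_numeral])
  also have "\<dots> = replicate_mset (L - 1) (\<alpha> [^] r1) + replicate_mset (2 * n - 1) (\<alpha> [^] r2)"
    unfolding ab(1) r1 r2 by (simp add: el_nat)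
  finally have alpha: "image_mset el (filter_mset (\<lambda>g. \<not> fst g) M)
    = replicate_mset (L - 1) (\<alpha> [^] r1) + replicate_mset (2 * n - 1) (\<alpha> [^] r2)" .
  have "el g = \<alpha> [^] r3 \<otimes> \<tau>" using \<open>fst g\<close> el_reduce[of True "snd g"] el_nat(2)[of r3] unfolding r3[symmetric]
    by (cases g) auto
  moreover have "S = image_mset el (filter_mset (\<lambda>g. \<not> fst g) M) + image_mset el (filter_mset fst M)"
    unfolding S by (metis add.commute image_mset_union multiset_partition)
  ultimately have "S = replicate_mset (L - 1) (\<alpha> [^] r1) + replicate_mset (2 * n - 1) (\<alpha> [^] r2) + {#\<alpha> [^] r3 \<otimes> \<tau>#}"
    unfolding g alpha by simp
  moreover have "gcd (int r1 - int r2) (2 * int n) = 1"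
    using ab(2) unfolding r1 r2 by (simp add: coprime_iff_gcd_eq_1)
  ultimately show "extremal_form G n L \<alpha> \<tau> S" unfolding extremal_form_def
    using r1(2) r2(2) \<open>r3 < 2 * n\<close>
    by (intro bexI[of _ r1] bexI[of _ r2] bexI[of _ r3]) auto
qed

text \<open>The fourth power of \<open>\<alpha>^b \<tau>\<close> is trivial, and 4 divides
  \<open>2 * n\<close> for even \<open>n\<close>; \<open>\<alpha>\<close> provides the divisor
  \<open>2 * n\<close>.\<close>

lemma group_exp_even: assumes "even n" shows "group_exp G = 2 * n"
proof -
  have "group.ord G x dvd 2 * n" if x: "x \<in> carrier G" for x
  proof -
    obtain b a where p: "x = el (b, a)" using x unfolding carrier_eq by force
    have "x [^] (2 * n) = \<one>"
    proof (cases b)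
      case False
      have "x [^] (2 * n) = (\<alpha> [^] a) [^] int (2 * n)" unfolding p el_def using False by (simp only: int_pow_int fst_conv snd_conv if_False)
      also have "\<dots> = \<alpha> [^] (a * int (2 * n))" by (simp only: int_pow_pow \<alpha>_closed)
      also have "\<dots> = \<alpha> [^] (0 :: int)" by (rule alpha_power_cong) simp
      finally show ?thesis by simp
    next
      case True
      have "x \<otimes> x = el (False, int n)" unfolding p el_mult mul_def using True by simp
      then have "x [^] (2::nat) = el (False, int n)" using x by (simp add: numeral_2_eq_2)
      moreover have "el (False, int n) \<otimes> el (False, int n) = \<one>"
        unfolding el_mult el_one[symmetric] el_eq_iff by (simp add: mul_def same_elt_def)
      ultimately have four: "x [^] (4::nat) = \<one>" using nat_pow_mult[OF x, of 2 2] by simp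
      obtain k where "n = 2 * k" using assms by blast
      then have "2 * n = 4 * k" by simp
      then have "x [^] (2 * n) = (x [^] (4::nat)) [^] k" using nat_pow_pow[OF x, of 4 k] by metis
      then show ?thesis unfolding four by simp
    qed
    then show ?thesis using pow_eq_id[OF x] by simp
  qed
  then have "group_exp G dvd 2 * n" unfolding group_exp_def by (auto intro: Lcm_least)
  have ord: "2 * n dvd group.ord G \<alpha>"
  proof -
    have "\<alpha> [^] group.ord G \<alpha> = \<one>" using pow_ord_eq_1 by simp
    then have "el (False, int (group.ord G \<alpha>)) = el (False, 0)" unfolding el_nat el_one .
    then have "int (2 * n) dvd int (group.ord G \<alpha>)" unfolding el_eq_iff same_elt_def by simp
    then show ?thesis by (simp only: int_dvd_int_iff)
  qed
  have "group.ord G \<alpha> dvd group_exp G" unfolding group_exp_def by (rule dvd_Lcm) simp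
  with ord have "2 * n dvd group_exp G" by (rule dvd_trans)
  with \<open>group_exp G dvd 2 * n\<close> show ?thesis by (rule dvd_antisym)
qed

end

section \<open>Change of presentation in the quaternion group\<close>

lemma (in group) dicyclic_presented:
  "2 \<le> n \<Longrightarrow> dicyclic_presentation n G \<alpha> \<tau> \<Longrightarrow> dicyclic_presented G n \<alpha> \<tau>"
  by (intro dicyclic_presented.intro dicyclic_presented_axioms.intro is_group)

lemma dicyclic_presentation_group:
  "dicyclic_presentation n G \<alpha> \<tau> \<Longrightarrow> group G"
  unfolding dicyclic_presentation_def has_presentation_def by simp

lemma dicyclic_presentation_presented:
  "2 \<le> n \<Longrightarrow> dicyclic_presentation n G \<alpha> \<tau> \<Longrightarrow> dicyclic_presented G n \<alpha> \<tau>"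
  using group.dicyclic_presented dicyclic_presentation_group by metis

text \<open>\<open>\<beta> = \<alpha>^t \<tau>\<close> satisfies
  \<open>\<beta>^2 = \<alpha>^2\<close> and is inverted by conjugation with \<open>\<alpha>\<close>,
  so both generators can exchange roles; the relations and the order 8 then suffice for a
  presentation.\<close>

lemma quaternion_presentation_swap:
  fixes G (structure)
  assumes "dicyclic_presentation 2 G \<alpha> \<tau>"
  shows "dicyclic_presentation 2 G (\<alpha> [^] (t::nat) \<otimes> \<tau>) \<alpha>"
proof -
  interpret dicyclic_presented G 2 \<alpha> \<tau> using dicyclic_presentation_presented[OF _ assms] by simp
  define \<beta> where "\<beta> = \<alpha> [^] t \<otimes> \<tau>"
  have \<beta>: "\<beta> = el (True, int t)" unfolding \<beta>_def by (simp add: el_nat)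
  have \<alpha>: "el (False, 1) = \<alpha>" unfolding el_def by (simp add: int_pow_1)
  have \<beta>2: "\<beta> [^] (2::nat) = el (False, 2)" unfolding \<beta> using el_mult[of "(True, int t)" "(True, int t)"]
    by (simp add: numeral_2_eq_2 mul_def)
  have "\<beta> [^] (4::nat) = \<beta> [^] (2::nat) \<otimes> \<beta> [^] (2::nat)" using nat_pow_mult[of \<beta> 2 2] by (simp add: \<beta>)
  also have "\<dots> = \<one>" unfolding \<beta>2 el_mult el_one[symmetric] el_eq_iff by (simp add: mul_def same_elt_def)
  finally have \<beta>4: "\<beta> [^] (4::nat) = \<one>" .
  have "inv \<beta> = el (True, int t + 2)"
  proof (rule inv_equality)
    show "el (True, int t + 2) \<otimes> \<beta> = \<one>" unfolding \<beta> el_mult el_one[symmetric] el_eq_iff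
      by (simp add: mul_def same_elt_def)
  qed (simp_all add: \<beta>)
  then have "inv \<beta> \<otimes> \<alpha> = el (mul 2 (True, int t + 2) (False, 1))"
    using el_mult[of "(True, int t + 2)" "(False, 1)"] by (simp only: \<alpha>)
  moreover have "\<alpha> \<otimes> \<beta> = el (mul 2 (False, 1) (True, int t))"
    using el_mult[of "(False, 1)" "(True, int t)"] by (simp only: \<alpha> \<beta>)
  ultimately have rel3: "\<alpha> \<otimes> \<beta> = inv \<beta> \<otimes> \<alpha>" by (simp add: el_eq_iff mul_def same_elt_def)
  have rel2: "\<alpha> \<otimes> \<alpha> = \<beta> [^] (2::nat)" unfolding \<beta>2
    using el_mult[of "(False, 1)" "(False, 1)"] by (simp add: \<alpha> mul_def)
  have "generate G {\<beta>, \<alpha>} = carrier G"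
  proof
    show "generate G {\<beta>, \<alpha>} \<subseteq> carrier G" by (rule generate_incl) (simp add: \<beta>)
    have sg: "subgroup (generate G {\<beta>, \<alpha>}) G" by (rule generate_is_subgroup) (simp add: \<beta>)
    have in1: "\<alpha> \<in> generate G {\<beta>, \<alpha>}" "\<beta> \<in> generate G {\<beta>, \<alpha>}" by (auto intro: generate.incl)
    have "\<alpha> [^] t \<in> generate G {\<beta>, \<alpha>}" using subgroup_int_pow_closed[OF sg in1(1), of "int t"] by (simp add: int_pow_int)
    then have "inv (\<alpha> [^] t) \<otimes> \<beta> \<in> generate G {\<beta>, \<alpha>}"
      using sg in1(2) by (intro subgroup.m_closed subgroup.m_inv_closed)
    moreover have "inv (\<alpha> [^] t) \<otimes> \<beta> = \<tau>" unfolding \<beta>_def by (simp add: m_assoc[symmetric])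
    ultimately have "generate G {\<alpha>, \<tau>} \<subseteq> generate G {\<beta>, \<alpha>}"
      using in1 by (intro generate_subgroup_incl[OF _ sg]) auto
    then show "carrier G \<subseteq> generate G {\<beta>, \<alpha>}" unfolding gens_generate .
  qed
  then show ?thesis unfolding \<beta>_def[symmetric]
    using order_eq \<beta>4 rel2 rel3 by (intro dicyclic_presentationI) (auto simp: order_def \<beta>)
qed

lemma dicyclic_presentation_closed:
  assumes "dicyclic_presentation n G \<alpha> \<tau>"
  shows "\<alpha> \<in> carrier G" "\<tau> \<in> carrier G"
  using assms unfolding dicyclic_presentation_def has_presentation_def range_case_dicyclic_gen by auto

text \<open>For \<open>\<beta>\<close> of order 4 these are the generators of its cyclic subgroup.
  The count refers to the group only, so it can be compared across presentations.\<close>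

definition cyclic_count :: "('a, 'b) monoid_scheme \<Rightarrow> 'a multiset \<Rightarrow> 'a \<Rightarrow> nat" where
  "cyclic_count G S \<beta> = size (filter_mset (\<lambda>x. x = \<beta> \<or> x = \<beta> [^]\<^bsub>G\<^esub> (3::nat)) S)"

context
  fixes G (structure) and \<alpha> \<tau>
  assumes presented: "dicyclic_presented G 2 \<alpha> \<tau>"
begin

interpretation dicyclic_presented G 2 \<alpha> \<tau> by (rule presented)

lemma quaternion_powers:
  shows "\<alpha> [^] (k::nat) = el (False, int k)"
    and "\<alpha> [^] (t::nat) \<otimes> \<tau> = el (True, int t)"
    and "el (True, a) [^] (2::nat) = el (False, 2)"
    and "el (True, a) [^] (3::nat) = el (True, a + 2)"
proof -
  show "\<alpha> [^] k = el (False, int k)" "\<alpha> [^] t \<otimes> \<tau> = el (True, int t)" by (simp_all add: el_nat)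
  show sq: "el (True, a) [^] (2::nat) = el (False, 2)"
    by (simp add: numeral_2_eq_2 el_mult mul_def)
  have "el (True, a) [^] (3::nat) = el (True, a) [^] (2::nat) \<otimes> el (True, a)"
    by (simp add: numeral_3_eq_3 numeral_2_eq_2)
  then show "el (True, a) [^] (3::nat) = el (True, a + 2)" unfolding sq el_mult
    by (simp add: mul_def add.commute)
qed

lemma cyclic_count_el:
  assumes S: "S = image_mset el M"
  shows "cyclic_count G S \<alpha> = class_size False 1 M"
    and "t < 2 \<Longrightarrow> cyclic_count G S (\<alpha> [^] t \<otimes> \<tau>) = class_size True (int t) M"
proof -
  have cyclic_count: "cyclic_count G S \<beta> = size (filter_mset (\<lambda>g. el g = \<beta> \<or> el g = \<beta> [^] (3::nat)) M)" for \<beta>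
    unfolding cyclic_count_def S by (simp flip: image_mset_filter_mset_swap)
  have "el g = \<alpha> \<or> el g = \<alpha> [^] (3::nat) \<longleftrightarrow> fst g = False \<and> snd g mod 2 = 1" for g
  proof -
    have "el g = \<alpha> \<longleftrightarrow> fst g = False \<and> 4 dvd snd g - 1"
      using el_eq_iff[of g "(False, 1)"] quaternion_powers(1)[of 1] by (simp add: same_elt_def)
    moreover have "el g = \<alpha> [^] (3::nat) \<longleftrightarrow> fst g = False \<and> 4 dvd snd g - 3"
      using el_eq_iff[of g "(False, 3)"] quaternion_powers(1)[of 3] by (simp add: same_elt_def)
    moreover have "4 dvd x - 1 \<or> 4 dvd x - 3 \<longleftrightarrow> x mod 2 = 1" for x :: int by presburger
    ultimately show ?thesis by blast
  qed
  then show "cyclic_count G S \<alpha> = class_size False 1 M" unfolding cyclic_count class_size_def by simp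
  assume t: "t < 2"
  have "el g = el (True, int t) \<or> el g = el (True, int t) [^] (3::nat) \<longleftrightarrow> fst g = True \<and> snd g mod 2 = int t" for g
  proof -
    have "4 dvd snd g - int t \<or> 4 dvd snd g - (int t + 2) \<longleftrightarrow> snd g mod 2 = int t" using t by presburger
    then show ?thesis unfolding quaternion_powers(4) el_eq_iff same_elt_def by auto
  qed
  then show "cyclic_count G S (\<alpha> [^] t \<otimes> \<tau>) = class_size True (int t) M" unfolding cyclic_count class_size_def quaternion_powers(2) by simp
qed

end

text \<open>A lower bound on the length is all that is assumed, so that one statement yields both
  the values of the constants and the shape of extremal sequences.\<close>

theorem inverse_product_one:
  fixes G (structure)
  assumes n2: "n \<ge> 2" and G: "dicyclic_group n G" and S: "set_mset S \<subseteq> carrier G"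
    and L: "L = 2 * n \<and> even n \<or> L = 4 * n"
    and size: "L + 2 * n \<le> size S + 1" and no: "\<not> has_product_one_subseq G L S"
  shows "size S + 1 = L + 2 * n \<and> (\<exists>\<alpha> \<tau>. dicyclic_presentation n G \<alpha> \<tau> \<and> extremal_form G n L \<alpha> \<tau> S)"
proof -
  have L': "4 dvd L" "2 * n dvd L" "L > 0" "L = 2 * n \<or> L = 4 * n" using L n2 by auto
  have "\<exists>\<alpha> \<tau> M. dicyclic_presentation n G \<alpha> \<tau> \<and> S = image_mset (dicyclic_presented.el G \<alpha> \<tau>) M \<and> tau_count M \<le> 1"
  proof (cases "n = 2")
    case False
    then have n3: "n \<ge> 3" using n2 by simp
    obtain \<alpha> \<tau> where pres: "dicyclic_presentation n G \<alpha> \<tau>" using G unfolding dicyclic_group_def by blast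
    interpret dicyclic_presented G n \<alpha> \<tau> using dicyclic_presentation_presented[OF n2 pres] .
    obtain M where M: "S = image_mset el M" using ex_image_el[OF S] .
    have "\<not> signed_product_one n L M" using signed_product_one_product_one no M by blast
    then have "tau_count M \<le> 1" using signed_product_one_two_taus[OF n3 L'(1-3), of M] size M by fastforce
    then show ?thesis using pres M by blast
  next
    case True
    obtain \<alpha>0 \<tau>0 where "dicyclic_presentation 2 G \<alpha>0 \<tau>0" using G True unfolding dicyclic_group_def by blast
    \<comment> \<open>Counts are bounded by the length of \<open>S\<close>, so a presentation with
      the largest count exists. Comparing it with its swaps for \<open>t = 0\<close> and
      \<open>t = 1\<close> gives the two inequalities that the quaternion case asks for.\<close>
    then have "\<exists>p. dicyclic_presentation 2 G (fst p) (snd p) \<and>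
        (\<forall>q. dicyclic_presentation 2 G (fst q) (snd q) \<longrightarrow> cyclic_count G S (fst q) \<le> cyclic_count G S (fst p))"
      by (intro ex_has_greatest_nat[of "\<lambda>p. dicyclic_presentation 2 G (fst p) (snd p)" "(\<alpha>0, \<tau>0)" _ "Suc (size S)"])
        (auto simp: cyclic_count_def less_Suc_eq_le)
    then obtain \<alpha> \<tau> where pres: "dicyclic_presentation 2 G \<alpha> \<tau>"
      and max: "\<And>\<beta> \<sigma>. dicyclic_presentation 2 G \<beta> \<sigma> \<Longrightarrow> cyclic_count G S \<beta> \<le> cyclic_count G S \<alpha>" by auto
    have presented: "dicyclic_presented G 2 \<alpha> \<tau>" using dicyclic_presentation_presented[OF _ pres] by simp
    interpret dicyclic_presented G 2 \<alpha> \<tau> by (rule presented)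
    obtain M where M: "S = image_mset el M" using ex_image_el[OF S] .
    have "class_size True 0 M \<le> class_size False 1 M" "class_size True 1 M \<le> class_size False 1 M"
      using max[OF quaternion_presentation_swap[OF pres, of 0]] max[OF quaternion_presentation_swap[OF pres, of 1]]
        cyclic_count_el(1)[OF presented M] cyclic_count_el(2)[OF presented M, of 0] cyclic_count_el(2)[OF presented M, of 1]
      by simp_all
    moreover have "\<not> signed_product_one 2 L M" using signed_product_one_product_one no M by blast
    ultimately have "tau_count M \<le> 1" using signed_product_one_quaternion[OF L'(1,3), of M] size M True by fastforce
    then show ?thesis using pres M True by blast
  qed
  then obtain \<alpha> \<tau> M where pres: "dicyclic_presentation n G \<alpha> \<tau>"
    and M: "S = image_mset (dicyclic_presented.el G \<alpha> \<tau>) M" "tau_count M \<le> 1" by blast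
  interpret dicyclic_presented G n \<alpha> \<tau> using dicyclic_presentation_presented[OF n2 pres] .
  show ?thesis using few_taus_extremal_form[OF L'(4) M size no] pres by metis
qed

text \<open>Sequences without the subsequence cannot be longer than the extremal ones; the exponents
  \<open>0\<close> and \<open>1\<close> give one of length \<open>L + 2 * n - 1\<close>.\<close>

lemma Least_product_one:
  fixes G (structure)
  assumes n2: "n \<ge> 2" and G: "dicyclic_group n G" and L: "L = 2 * n \<and> even n \<or> L = 4 * n"
  shows "(LEAST l. \<forall>S. set_mset S \<subseteq> carrier G \<longrightarrow> l \<le> size S \<longrightarrow> has_product_one_subseq G L S) = L + 2 * n"
proof (rule Least_equality)
  show "\<forall>S. set_mset S \<subseteq> carrier G \<longrightarrow> L + 2 * n \<le> size S \<longrightarrow> has_product_one_subseq G L S"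
  proof (intro allI impI, rule ccontr)
    fix S assume S: "set_mset S \<subseteq> carrier G" "L + 2 * n \<le> size S" "\<not> has_product_one_subseq G L S"
    then show False using inverse_product_one[OF n2 G S(1) L _ S(3)] by simp
  qed
next
  fix l assume l: "\<forall>S. set_mset S \<subseteq> carrier G \<longrightarrow> l \<le> size S \<longrightarrow> has_product_one_subseq G L S"
  obtain \<alpha> \<tau> where pres: "dicyclic_presentation n G \<alpha> \<tau>" using G unfolding dicyclic_group_def by blast
  interpret dicyclic_presented G n \<alpha> \<tau> using dicyclic_presentation_presented[OF n2 pres] .
  define S where "S = replicate_mset (L - 1) (\<alpha> [^] (0::nat)) + replicate_mset (2 * n - 1) (\<alpha> [^] (1::nat))
    + {#\<alpha> [^] (0::nat) \<otimes> \<tau>#}"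
  have "extremal_form G n L \<alpha> \<tau> S" unfolding extremal_form_def S_def
    using n2 by (intro bexI[of _ 0] bexI[of _ 1]) auto
  then have "size S + 1 = L + 2 * n" "set_mset S \<subseteq> carrier G" "\<not> has_product_one_subseq G L S"
    using extremal_form_no_product_one[of L S] L n2 by auto
  then show "L + 2 * n \<le> l" using l by (metis Suc_eq_plus1 not_less_eq_eq)
qed

theorem extremal_iff:
  fixes G (structure)
  assumes n2: "n \<ge> 2" and G: "dicyclic_group n G" and S: "set_mset S \<subseteq> carrier G"
    and L: "L = 2 * n \<and> even n \<or> L = 4 * n"
  shows "int (size S) = int (L + 2 * n) - 1 \<and> \<not> has_product_one_subseq G L S \<longleftrightarrow>
    (\<exists>\<alpha>\<in>carrier G. \<exists>\<tau>\<in>carrier G. dicyclic_presentation n G \<alpha> \<tau> \<and> extremal_form G n L \<alpha> \<tau> S)"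
proof
  assume "int (size S) = int (L + 2 * n) - 1 \<and> \<not> has_product_one_subseq G L S"
  then have "L + 2 * n \<le> size S + 1" "\<not> has_product_one_subseq G L S" by auto
  then show "\<exists>\<alpha>\<in>carrier G. \<exists>\<tau>\<in>carrier G. dicyclic_presentation n G \<alpha> \<tau> \<and> extremal_form G n L \<alpha> \<tau> S"
    using inverse_product_one[OF n2 G S L] dicyclic_presentation_closed by metis
next
  assume "\<exists>\<alpha>\<in>carrier G. \<exists>\<tau>\<in>carrier G. dicyclic_presentation n G \<alpha> \<tau> \<and> extremal_form G n L \<alpha> \<tau> S"
  then obtain \<alpha> \<tau> where pres: "dicyclic_presentation n G \<alpha> \<tau>" and ext: "extremal_form G n L \<alpha> \<tau> S" by blast
  interpret dicyclic_presented G n \<alpha> \<tau> using dicyclic_presentation_presented[OF n2 pres] .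
  have "size S + 1 = L + 2 * n" "\<not> has_product_one_subseq G L S"
    using extremal_form_no_product_one[OF ext] L n2 by auto
  then show "int (size S) = int (L + 2 * n) - 1 \<and> \<not> has_product_one_subseq G L S" by auto
qed

section \<open>The exceptional families for \<open>n = 2\<close>\<close>

lemma gcd_diff_four: "gcd (int a - int b) (2 * int 2) = 1 \<longleftrightarrow> even a \<noteq> even b"
proof -
  have "gcd (int a - int b) (2 * int 2) = 1 \<longleftrightarrow> coprime (int a - int b) (2 ^ 2)"
    by (simp add: coprime_iff_gcd_eq_1)
  also have "\<dots> \<longleftrightarrow> odd (int a - int b)" by (simp only: coprime_power_right_iff coprime_right_2_iff_odd) simp
  finally show ?thesis by simp
qed

lemma extremal_form_quaternion:
  fixes G (structure)
  shows "extremal_form G 2 L \<alpha> \<tau> S \<longleftrightarrow>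
    (\<exists>r1\<in>{0..3::nat}. \<exists>r2\<in>{0..3::nat}. \<exists>r3\<in>{0..3::nat}. even r1 \<noteq> even r2 \<and>
      S = replicate_mset (L - 1) (\<alpha> [^] r1) + replicate_mset 3 (\<alpha> [^] r2) + {#\<alpha> [^] r3 \<otimes> \<tau>#})"
  unfolding extremal_form_def gcd_diff_four by simp

text \<open>With \<open>\<alpha> [^] t3 \<otimes> \<tau>\<close> in the role of \<open>\<alpha>\<close>, the second and third exceptional families for \<open>n = 2\<close> become
  the first one.\<close>

lemma quaternion_swap_form:
  fixes G (structure)
  assumes pres: "dicyclic_presentation 2 G \<alpha> \<tau>" and t1: "t1 \<in> {0..3::nat}" "even t1"
    and S: "S = replicate_mset i (\<alpha> [^] t1) + replicate_mset j (\<alpha> [^] (t3::nat) \<otimes> \<tau>) + {#g#}"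
    and g: "(\<exists>t2\<in>{0..3::nat}. odd t2 \<and> g = \<alpha> [^] t2) \<or>
      (\<exists>t4\<in>{0..3::nat}. t3 mod 2 \<noteq> t4 mod 2 \<and> g = \<alpha> [^] t4 \<otimes> \<tau>)"
    and ij: "i = L - 1 \<and> j = 3 \<or> i = 3 \<and> j = L - 1"
  shows "\<exists>\<alpha>\<in>carrier G. \<exists>\<tau>\<in>carrier G. dicyclic_presentation 2 G \<alpha> \<tau> \<and> extremal_form G 2 L \<alpha> \<tau> S"
proof -
  have presented: "dicyclic_presented G 2 \<alpha> \<tau>" using dicyclic_presentation_presented[OF _ pres] by simp
  interpret dicyclic_presented G 2 \<alpha> \<tau> by (rule presented)
  note powers = quaternion_powers[OF presented]
  define \<beta> where "\<beta> = \<alpha> [^] t3 \<otimes> \<tau>"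
  have \<beta>: "\<beta> = el (True, int t3)" unfolding \<beta>_def powers(2) ..
  have \<beta>_closed: "\<beta> \<in> carrier G" unfolding \<beta>_def by simp
  \<comment> \<open>Even powers are central and \<open>\<beta>^2 = \<alpha>^2\<close>, so
    \<open>t1\<close> serves for both generators.\<close>
  have "\<alpha> [^] t1 = \<beta> [^] t1"
  proof -
    have "t1 = 0 \<or> t1 = 2" using t1 unfolding atLeastAtMost_iff by presburger
    then show ?thesis unfolding \<beta> using powers(1)[of 2] powers(3) by auto
  qed
  have \<alpha>: "el (False, 1) = \<alpha>" using powers(1)[of 1] by simp
  have b\<alpha>: "el p \<otimes> \<alpha> = el (mul 2 p (False, 1))" for p using el_mult[of p "(False, 1)"] unfolding \<alpha> .
  have \<beta>pow: "\<beta> [^] (0::nat) = el (False, 0)" "\<beta> [^] (1::nat) = el (True, int t3)"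
    "\<beta> [^] (2::nat) = el (False, 2)" "\<beta> [^] (3::nat) = el (True, int t3 + 2)"
    unfolding \<beta> powers(3,4) by (simp_all add: el_one)
  have "\<exists>r\<in>{0..3}. g = \<beta> [^] (r::nat) \<otimes> \<alpha>" using g
  proof (elim disjE bexE conjE)
    fix t2 :: nat assume t2: "t2 \<in> {0..3}" "odd t2" "g = \<alpha> [^] t2"
    then have "t2 = 1 \<or> t2 = 3" unfolding atLeastAtMost_iff by presburger
    then show ?thesis
    proof
      assume "t2 = 1"
      then have "g = \<beta> [^] (0::nat) \<otimes> \<alpha>" using t2(3) unfolding \<beta>pow b\<alpha> powers(1) by (simp add: mul_def)
      then show ?thesis by (intro bexI[of _ 0]) auto
    next
      assume "t2 = 3"
      then have "g = \<beta> [^] (2::nat) \<otimes> \<alpha>" using t2(3) unfolding \<beta>pow b\<alpha> powers(1) by (simp add: mul_def)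
      then show ?thesis by (intro bexI[of _ 2]) auto
    qed
  next
    fix t4 :: nat assume t4: "t4 \<in> {0..3}" "t3 mod 2 \<noteq> t4 mod 2" "g = \<alpha> [^] t4 \<otimes> \<tau>"
    have "4 dvd int t4 - (int t3 - 1) \<or> 4 dvd int t4 - (int t3 + 1)" using t4(2) by presburger
    then show ?thesis
    proof
      assume "4 dvd int t4 - (int t3 - 1)"
      then have "g = \<beta> [^] (1::nat) \<otimes> \<alpha>"
        unfolding t4(3) \<beta>pow b\<alpha> powers(2) el_eq_iff by (simp add: mul_def same_elt_def)
      then show ?thesis by (intro bexI[of _ 1]) auto
    next
      assume "4 dvd int t4 - (int t3 + 1)"
      then have "g = \<beta> [^] (3::nat) \<otimes> \<alpha>"
        unfolding t4(3) \<beta>pow b\<alpha> powers(2) el_eq_iff by (simp add: mul_def same_elt_def add.commute)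
      then show ?thesis by (intro bexI[of _ 3]) auto
    qed
  qed
  then obtain r where r: "r \<in> {0..3}" "g = \<beta> [^] (r::nat) \<otimes> \<alpha>" by blast
  have S': "S = replicate_mset i (\<beta> [^] t1) + replicate_mset j (\<beta> [^] (1::nat)) + {#\<beta> [^] r \<otimes> \<alpha>#}"
    unfolding S \<open>\<alpha> [^] t1 = \<beta> [^] t1\<close> r(2) using \<beta>_closed by (simp flip: \<beta>_def)
  have "extremal_form G 2 L \<beta> \<alpha> S" using ij
  proof
    assume ij: "i = L - 1 \<and> j = 3"
    then show ?thesis unfolding extremal_form_quaternion
      using S' t1 r by (intro bexI[of _ t1] bexI[of _ 1] bexI[of _ r] conjI) auto
  next
    assume ij: "i = 3 \<and> j = L - 1"
    then show ?thesis unfolding extremal_form_quaternion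
      using S' t1 r by (intro bexI[of _ 1] bexI[of _ t1] bexI[of _ r] conjI) (auto simp: add.commute)
  qed
  moreover have "dicyclic_presentation 2 G \<beta> \<alpha>" unfolding \<beta>_def by (rule quaternion_presentation_swap[OF pres])
  ultimately show ?thesis using \<beta>_closed \<alpha>_closed by blast
qed

text \<open>From left to right the first family suffices, once the even exponent is named
  \<open>t1\<close>; from right to left a swap of generators brings the other two families to
  it.\<close>

lemma quaternion_exp_forms:
  fixes G (structure)
  shows "(\<exists>\<alpha>\<in>carrier G. \<exists>\<tau>\<in>carrier G. dicyclic_presentation 2 G \<alpha> \<tau> \<and> extremal_form G 2 4 \<alpha> \<tau> S) \<longleftrightarrow>
    (\<exists>\<alpha>\<in>carrier G. \<exists>\<tau>\<in>carrier G. dicyclic_presentation 2 G \<alpha> \<tau> \<and>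
     (\<exists>t1\<in>{0..3::nat}. \<exists>t2\<in>{0..3::nat}. \<exists>t3\<in>{0..3::nat}. \<exists>t4\<in>{0..3::nat}.
        even t1 \<and> odd t2 \<and> t3 mod 2 \<noteq> t4 mod 2 \<and>
        S \<in> {replicate_mset 3 (\<alpha> [^] t1) + replicate_mset 3 (\<alpha> [^] t2) + {#\<alpha> [^] t3 \<otimes> \<tau>#},
             replicate_mset 3 (\<alpha> [^] t1) + replicate_mset 3 (\<alpha> [^] t3 \<otimes> \<tau>) + {#\<alpha> [^] t2#},
             replicate_mset 3 (\<alpha> [^] t1) + replicate_mset 3 (\<alpha> [^] t3 \<otimes> \<tau>)
               + {#\<alpha> [^] t4 \<otimes> \<tau>#}}))" (is "?l \<longleftrightarrow> ?r")
proof
  assume ?l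
  then obtain \<alpha> \<tau> where cl: "\<alpha> \<in> carrier G" "\<tau> \<in> carrier G" and pres: "dicyclic_presentation 2 G \<alpha> \<tau>"
    and ext: "extremal_form G 2 4 \<alpha> \<tau> S" by blast
  from ext[unfolded extremal_form_quaternion] obtain r1 r2 r3 where r: "r1 \<in> {0..3::nat}" "r2 \<in> {0..3::nat}" "r3 \<in> {0..3::nat}" "even r1 \<noteq> even r2"
    "S = replicate_mset 3 (\<alpha> [^] r1) + replicate_mset 3 (\<alpha> [^] r2) + {#\<alpha> [^] r3 \<otimes> \<tau>#}"
    by (elim bexE conjE) (rule that, simp_all)
  obtain t1 t2 where t: "t1 \<in> {0..3::nat}" "t2 \<in> {0..3::nat}" "even t1" "odd t2"
    "S = replicate_mset 3 (\<alpha> [^] t1) + replicate_mset 3 (\<alpha> [^] t2) + {#\<alpha> [^] r3 \<otimes> \<tau>#}"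
  proof (cases "even r1")
    case True
    show ?thesis by (rule that[of r1 r2]) (use r True in auto)
  next
    case False
    show ?thesis by (rule that[of r2 r1]) (use r False in \<open>auto simp: add.commute\<close>)
  qed
  \<comment> \<open>Any exponent in the range with the parity opposite to \<open>r3\<close> serves
    as the witness for \<open>t4\<close>.\<close>
  define t4 :: nat where "t4 = (if even r3 then 1 else 0)"
  have t4: "t4 \<in> {0..3}" "r3 mod 2 \<noteq> t4 mod 2" unfolding t4_def by (auto simp: odd_iff_mod_2_eq_one)
  show ?r
    by (rule bexI[OF _ cl(1)], rule bexI[OF _ cl(2)], rule conjI[OF pres], rule bexI[OF _ t(1)],
      rule bexI[OF _ t(2)], rule bexI[OF _ r(3)], rule bexI[OF _ t4(1)], intro conjI t(3,4) t4(2))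
      (simp add: t(5))
next
  assume ?r
  then obtain \<alpha> \<tau> t1 t2 t3 t4 where cl: "\<alpha> \<in> carrier G" "\<tau> \<in> carrier G" and pres: "dicyclic_presentation 2 G \<alpha> \<tau>"
    and t: "t1 \<in> {0..3::nat}" "t2 \<in> {0..3::nat}" "t3 \<in> {0..3::nat}" "t4 \<in> {0..3::nat}"
      "even t1" "odd t2" "t3 mod 2 \<noteq> t4 mod 2"
    and S: "S \<in> {replicate_mset 3 (\<alpha> [^] t1) + replicate_mset 3 (\<alpha> [^] t2) + {#\<alpha> [^] t3 \<otimes> \<tau>#},
             replicate_mset 3 (\<alpha> [^] t1) + replicate_mset 3 (\<alpha> [^] t3 \<otimes> \<tau>) + {#\<alpha> [^] t2#},
             replicate_mset 3 (\<alpha> [^] t1) + replicate_mset 3 (\<alpha> [^] t3 \<otimes> \<tau>)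
               + {#\<alpha> [^] t4 \<otimes> \<tau>#}}" by (elim bexE conjE)
  from S consider "S = replicate_mset 3 (\<alpha> [^] t1) + replicate_mset 3 (\<alpha> [^] t2) + {#\<alpha> [^] t3 \<otimes> \<tau>#}"
    | g where "S = replicate_mset 3 (\<alpha> [^] t1) + replicate_mset 3 (\<alpha> [^] t3 \<otimes> \<tau>) + {#g#}"
      "g = \<alpha> [^] t2 \<or> g = \<alpha> [^] t4 \<otimes> \<tau>" by blast
  then show ?l
  proof cases
    case 1
    then have "extremal_form G 2 4 \<alpha> \<tau> S" unfolding extremal_form_quaternion
      using t by (intro bexI[of _ t1] bexI[of _ t2] bexI[of _ t3]) auto
    then show ?thesis using cl pres by blast
  next
    case 2
    then show ?thesis using t by (intro quaternion_swap_form[OF pres t(1,5) 2(1), of 4]) auto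
  qed
qed

lemma quaternion_order_forms:
  fixes G (structure)
  shows "(\<exists>\<alpha>\<in>carrier G. \<exists>\<tau>\<in>carrier G. dicyclic_presentation 2 G \<alpha> \<tau> \<and> extremal_form G 2 8 \<alpha> \<tau> S) \<longleftrightarrow>
    (\<exists>\<alpha>\<in>carrier G. \<exists>\<tau>\<in>carrier G. dicyclic_presentation 2 G \<alpha> \<tau> \<and>
     (\<exists>t1\<in>{0..3::nat}. \<exists>t2\<in>{0..3::nat}. \<exists>t3\<in>{0..3::nat}. \<exists>t4\<in>{0..3::nat}.
        even t1 \<and> odd t2 \<and> t3 mod 2 \<noteq> t4 mod 2 \<and>
        (\<exists>S0\<in>{replicate_mset 4 (\<alpha> [^] t1), replicate_mset 4 (\<alpha> [^] t2)}.
         \<exists>S1\<in>{replicate_mset 4 (\<alpha> [^] t1), replicate_mset 4 (\<alpha> [^] t3 \<otimes> \<tau>)}.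
           S \<in> {(replicate_mset 3 (\<alpha> [^] t1) + replicate_mset 3 (\<alpha> [^] t2) + {#\<alpha> [^] t3 \<otimes> \<tau>#}) + S0,
                (replicate_mset 3 (\<alpha> [^] t1) + replicate_mset 3 (\<alpha> [^] t3 \<otimes> \<tau>) + {#\<alpha> [^] t2#}) + S1,
                (replicate_mset 3 (\<alpha> [^] t1) + replicate_mset 3 (\<alpha> [^] t3 \<otimes> \<tau>)
                  + {#\<alpha> [^] t4 \<otimes> \<tau>#}) + S1})))" (is "?l \<longleftrightarrow> ?r")
proof
  have seven: "replicate_mset 7 x = replicate_mset 3 x + replicate_mset 4 x" for x :: 'a
    by (intro multiset_eqI) simp
  {
    assume ?l
    then obtain \<alpha> \<tau> where cl: "\<alpha> \<in> carrier G" "\<tau> \<in> carrier G" and pres: "dicyclic_presentation 2 G \<alpha> \<tau>"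
      and ext: "extremal_form G 2 8 \<alpha> \<tau> S" by blast
    from ext[unfolded extremal_form_quaternion] obtain r1 r2 r3 where r: "r1 \<in> {0..3::nat}" "r2 \<in> {0..3::nat}" "r3 \<in> {0..3::nat}" "even r1 \<noteq> even r2"
      "S = replicate_mset 7 (\<alpha> [^] r1) + replicate_mset 3 (\<alpha> [^] r2) + {#\<alpha> [^] r3 \<otimes> \<tau>#}"
      by (elim bexE conjE) (rule that, simp_all)
    obtain t1 t2 S0 where t: "t1 \<in> {0..3::nat}" "t2 \<in> {0..3::nat}" "even t1" "odd t2"
      "S0 \<in> {replicate_mset 4 (\<alpha> [^] t1), replicate_mset 4 (\<alpha> [^] t2)}"
      "S = (replicate_mset 3 (\<alpha> [^] t1) + replicate_mset 3 (\<alpha> [^] t2) + {#\<alpha> [^] r3 \<otimes> \<tau>#}) + S0"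
    proof (cases "even r1")
      case True
      show ?thesis by (rule that[of r1 r2 "replicate_mset 4 (\<alpha> [^] r1)"]) (use r True in \<open>auto simp: seven ac_simps\<close>)
    next
      case False
      show ?thesis by (rule that[of r2 r1 "replicate_mset 4 (\<alpha> [^] r1)"]) (use r False in \<open>auto simp: seven ac_simps\<close>)
    qed
    define t4 :: nat where "t4 = (if even r3 then 1 else 0)"
    have t4: "t4 \<in> {0..3}" "r3 mod 2 \<noteq> t4 mod 2" unfolding t4_def by (auto simp: odd_iff_mod_2_eq_one)
    show ?r
      by (rule bexI[OF _ cl(1)], rule bexI[OF _ cl(2)], rule conjI[OF pres], rule bexI[OF _ t(1)],
        rule bexI[OF _ t(2)], rule bexI[OF _ r(3)], rule bexI[OF _ t4(1)], intro conjI t(3,4) t4(2),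
        rule bexI[OF _ t(5)], rule bexI[OF _ insertI1]) (simp add: t(6))
  next
    assume ?r
    then obtain \<alpha> \<tau> t1 t2 t3 t4 S0 S1 where cl: "\<alpha> \<in> carrier G" "\<tau> \<in> carrier G" and pres: "dicyclic_presentation 2 G \<alpha> \<tau>"
      and t: "t1 \<in> {0..3::nat}" "t2 \<in> {0..3::nat}" "t3 \<in> {0..3::nat}" "t4 \<in> {0..3::nat}"
        "even t1" "odd t2" "t3 mod 2 \<noteq> t4 mod 2"
      and S0: "S0 \<in> {replicate_mset 4 (\<alpha> [^] t1), replicate_mset 4 (\<alpha> [^] t2)}"
      and S1: "S1 \<in> {replicate_mset 4 (\<alpha> [^] t1), replicate_mset 4 (\<alpha> [^] t3 \<otimes> \<tau>)}"
      and S: "S \<in> {(replicate_mset 3 (\<alpha> [^] t1) + replicate_mset 3 (\<alpha> [^] t2) + {#\<alpha> [^] t3 \<otimes> \<tau>#}) + S0,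
                (replicate_mset 3 (\<alpha> [^] t1) + replicate_mset 3 (\<alpha> [^] t3 \<otimes> \<tau>) + {#\<alpha> [^] t2#}) + S1,
                (replicate_mset 3 (\<alpha> [^] t1) + replicate_mset 3 (\<alpha> [^] t3 \<otimes> \<tau>)
                  + {#\<alpha> [^] t4 \<otimes> \<tau>#}) + S1}" by (elim bexE conjE)
    from S consider "S = replicate_mset 3 (\<alpha> [^] t1) + replicate_mset 3 (\<alpha> [^] t2) + {#\<alpha> [^] t3 \<otimes> \<tau>#} + S0"
      | g where "S = replicate_mset 3 (\<alpha> [^] t1) + replicate_mset 3 (\<alpha> [^] t3 \<otimes> \<tau>) + {#g#} + S1"
        "g = \<alpha> [^] t2 \<or> g = \<alpha> [^] t4 \<otimes> \<tau>" by blast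
    then show ?l
    proof cases
      case 1
      have "S0 = replicate_mset 4 (\<alpha> [^] t1) \<or> S0 = replicate_mset 4 (\<alpha> [^] t2)" using S0 by simp
      then have "extremal_form G 2 8 \<alpha> \<tau> S"
      proof
        assume "S0 = replicate_mset 4 (\<alpha> [^] t1)"
        then have "S = replicate_mset 7 (\<alpha> [^] t1) + replicate_mset 3 (\<alpha> [^] t2) + {#\<alpha> [^] t3 \<otimes> \<tau>#}"
          using 1 by (simp add: seven ac_simps)
        then show ?thesis unfolding extremal_form_quaternion
          using t by (intro bexI[of _ t1] bexI[of _ t2] bexI[of _ t3]) auto
      next
        assume "S0 = replicate_mset 4 (\<alpha> [^] t2)"
        then have "S = replicate_mset 7 (\<alpha> [^] t2) + replicate_mset 3 (\<alpha> [^] t1) + {#\<alpha> [^] t3 \<otimes> \<tau>#}"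
          using 1 by (simp add: seven ac_simps)
        then show ?thesis unfolding extremal_form_quaternion
          using t by (intro bexI[of _ t2] bexI[of _ t1] bexI[of _ t3]) auto
      qed
      then show ?thesis using cl pres by blast
    next
      case 2
      \<comment> \<open>The four copies in \<open>S1\<close> go to one of the two repeated terms;
        \<open>i\<close> and \<open>j\<close> record which of them reaches seven.\<close>
      define i j :: nat where "i = (if S1 = replicate_mset 4 (\<alpha> [^] t1) then 7 else 3)"
        and "j = (if S1 = replicate_mset 4 (\<alpha> [^] t1) then 3 else 7)"
      have "S = replicate_mset i (\<alpha> [^] t1) + replicate_mset j (\<alpha> [^] t3 \<otimes> \<tau>) + {#g#}"
        using 2(1) S1 unfolding i_def j_def by (auto simp: seven ac_simps)
      then show ?thesis using t 2(2) by (intro quaternion_swap_form[OF pres t(1,5), of S i j t3 g 8]) (auto simp: i_def j_def)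
    qed
  }
qed

theorem theorem1p3:
  fixes G :: "('a, 'b) monoid_scheme" (structure)
    and n :: nat
    and S :: "'a multiset"
  assumes n: "n \<ge> 2"
    and G: "dicyclic_group n G"
    and S: "set_mset S \<subseteq> carrier G"
  shows
    "(even n \<longrightarrow>
        group_exp G = 2 * n \<and>
        ((int (size S) = int (s_const G) - 1 \<and> \<not> has_product_one_subseq G (group_exp G) S) \<longleftrightarrow>
         (\<exists>\<alpha>\<in>carrier G. \<exists>\<tau>\<in>carrier G. dicyclic_presentation n G \<alpha> \<tau> \<and>
           ((n \<ge> 4 \<and>
             (\<exists>r1\<in>{0..2 * n - 1}. \<exists>r2\<in>{0..2 * n - 1}. \<exists>r3\<in>{0..2 * n - 1}.
                gcd (int r1 - int r2) (2 * int n) = 1 \<and>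
                S = replicate_mset (2 * n - 1) (\<alpha> [^] r1) + replicate_mset (2 * n - 1) (\<alpha> [^] r2)
                    + {#\<alpha> [^] r3 \<otimes> \<tau>#})) \<or>
            (n = 2 \<and>
             (\<exists>t1\<in>{0..3::nat}. \<exists>t2\<in>{0..3::nat}. \<exists>t3\<in>{0..3::nat}. \<exists>t4\<in>{0..3::nat}.
                even t1 \<and> odd t2 \<and> t3 mod 2 \<noteq> t4 mod 2 \<and>
                S \<in> {replicate_mset 3 (\<alpha> [^] t1) + replicate_mset 3 (\<alpha> [^] t2) + {#\<alpha> [^] t3 \<otimes> \<tau>#},
                     replicate_mset 3 (\<alpha> [^] t1) + replicate_mset 3 (\<alpha> [^] t3 \<otimes> \<tau>) + {#\<alpha> [^] t2#},
                     replicate_mset 3 (\<alpha> [^] t1) + replicate_mset 3 (\<alpha> [^] t3 \<otimes> \<tau>)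
                       + {#\<alpha> [^] t4 \<otimes> \<tau>#}}))))))
     \<and>
     ((int (size S) = int (E_const G) - 1 \<and> \<not> has_product_one_subseq G (order G) S) \<longleftrightarrow>
      (\<exists>\<alpha>\<in>carrier G. \<exists>\<tau>\<in>carrier G. dicyclic_presentation n G \<alpha> \<tau> \<and>
        ((n \<ge> 3 \<and>
          (\<exists>r1\<in>{0..2 * n - 1}. \<exists>r2\<in>{0..2 * n - 1}. \<exists>r3\<in>{0..2 * n - 1}.
             gcd (int r1 - int r2) (2 * int n) = 1 \<and>
             S = replicate_mset (4 * n - 1) (\<alpha> [^] r1) + replicate_mset (2 * n - 1) (\<alpha> [^] r2)
                 + {#\<alpha> [^] r3 \<otimes> \<tau>#})) \<or>
         (n = 2 \<and>
          (\<exists>t1\<in>{0..3::nat}. \<exists>t2\<in>{0..3::nat}. \<exists>t3\<in>{0..3::nat}. \<exists>t4\<in>{0..3::nat}.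
             even t1 \<and> odd t2 \<and> t3 mod 2 \<noteq> t4 mod 2 \<and>
             (\<exists>S0\<in>{replicate_mset 4 (\<alpha> [^] t1), replicate_mset 4 (\<alpha> [^] t2)}.
              \<exists>S1\<in>{replicate_mset 4 (\<alpha> [^] t1), replicate_mset 4 (\<alpha> [^] t3 \<otimes> \<tau>)}.
                S \<in> {(replicate_mset 3 (\<alpha> [^] t1) + replicate_mset 3 (\<alpha> [^] t2) + {#\<alpha> [^] t3 \<otimes> \<tau>#}) + S0,
                     (replicate_mset 3 (\<alpha> [^] t1) + replicate_mset 3 (\<alpha> [^] t3 \<otimes> \<tau>) + {#\<alpha> [^] t2#}) + S1,
                     (replicate_mset 3 (\<alpha> [^] t1) + replicate_mset 3 (\<alpha> [^] t3 \<otimes> \<tau>)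
                       + {#\<alpha> [^] t4 \<otimes> \<tau>#}) + S1}))))))"
proof -
  obtain \<alpha> \<tau> where pres: "dicyclic_presentation n G \<alpha> \<tau>" using G unfolding dicyclic_group_def by blast
  interpret dicyclic_presented G n \<alpha> \<tau> using dicyclic_presentation_presented[OF n pres] .
  have exp: "group_exp G = 2 * n" "s_const G = 2 * n + 2 * n" if "even n"
    using group_exp_even[OF that] Least_product_one[OF n G, of "2 * n"] that unfolding s_const_def by simp_all
  have E: "E_const G = 4 * n + 2 * n" unfolding E_const_def order_eq using Least_product_one[OF n G, of "4 * n"] by simp
  show ?thesis
  \<comment> \<open>For \<open>n \<ge> 3\<close> unfolding \<open>extremal_form\<close> gives the
    claimed families; for \<open>n = 2\<close> it is traded for the exceptional ones.\<close>
  proof (cases "n = 2")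
    case True
      show ?thesis
      using extremal_iff[OF n G S, of "2 * n"] extremal_iff[OF n G S, of "4 * n"] exp E order_eq
        quaternion_exp_forms[of G S] quaternion_order_forms[of G S]
      unfolding True by simp
  next
    case False
    then have n3: "n \<ge> 3" and n4: "even n \<Longrightarrow> n \<ge> 4" using n by presburger+
    show ?thesis
      using extremal_iff[OF n G S, of "2 * n"] extremal_iff[OF n G S, of "4 * n"] exp E order_eq False n3 n4
      unfolding extremal_form_def by simp
  qed
qed

end
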